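(* Let $(X,d)$ be a separable ultra-metric space in which all closed balls are compact, let $\mu$ be a Radon measure on $X$ with full support, let $\sigma$ be a distance distribution function, and let $\mathcal{L}$ be the isotropic Laplacian associated with $(d,\mu,\sigma)$. Let $\psi:[0,\infty]\to[0,\infty]$ be any strictly increasing right-continuous function such that $\psi(0)=0$ and $\psi(\infty-)=\infty$. Then $\psi(\mathcal{L})$ is also an isotropic Laplacian, associated with $(d,\mu,\widetilde\sigma)$ for some other distance distribution function $\widetilde\sigma$.
   Context: Closed balls: $B_r(x)=\{y:d(x,y)\le r\}$; $\mathrm{Q}_rf(x)=\frac1{\mu(B_r(x))}\int_{B_r(x)}f\,d\mu$ for $r>0$. A distance distribution function is a strictly increasing left-continuous function $\sigma:[0,\infty]\to[0,1]$ with $\sigma(0+)=0$ and $\sigma(\infty)=1$. The isotropic Markov operator associated with $(d,\mu,\sigma)$ is $P=\int_{[0,\infty)}\mathrm{Q}_r\,d\sigma(r)$, a self-adjoint operator in $L^2(X,\mu)$ with spectrum in $[0,1]$; it generates the symmetric Markov semigroup $\{P^t\}_{t\ge0}$. The isotropic Laplacian associated with $(d,\mu,\sigma)$ is the (generally unbounded) non-negative definite self-adjoint operator $\mathcal{L}$ in $L^2(X,\mu)$ with $P^t=\exp(-t\mathcal{L})$ for all $t>0$, i.e. $\mathcal{L}=\log\frac1P$ in the sense of functional calculus. The operator $\psi(\mathcal{L})$ is defined by functional calculus. *)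

theory Defs
  imports "HOL-Analysis.Analysis"
begin

section \<open>Ultra-metric measure spaces\<close>

text \<open>The metric space $(X,d)$ is a type of class \<^class>\<open>metric_space\<close>, with $d$ = \<^const>\<open>dist\<close>;
  closed balls are \<^const>\<open>cball\<close>.\<close>

definition ultrametric :: "'a::metric_space itself \<Rightarrow> bool" where
  "ultrametric _ \<longleftrightarrow> (\<forall>x y z :: 'a. dist x z \<le> max (dist x y) (dist y z))"

definition radon_measure :: "'a::topological_space measure \<Rightarrow> bool" where
  "radon_measure M \<longleftrightarrow>
     sets M = sets borel \<and>
     (\<forall>K. compact K \<longrightarrow> emeasure M K < \<infinity>) \<and>
     (\<forall>A\<in>sets borel. emeasure M A = (INF U\<in>{U. open U \<and> A \<subseteq> U}. emeasure M U)) \<and>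
     (\<forall>U. open U \<longrightarrow> emeasure M U = (SUP K\<in>{K. compact K \<and> K \<subseteq> U}. emeasure M K))"

definition full_support :: "'a::topological_space measure \<Rightarrow> bool" where
  "full_support M \<longleftrightarrow> (\<forall>U. open U \<and> U \<noteq> {} \<longrightarrow> emeasure M U > 0)"

section \<open>Operators in $L^2(X,\mu)$\<close>

text \<open>Elements of $L^2(X,\mu)$ are handled through representatives: real-valued, measurable,
  square-integrable functions, identified when they agree almost everywhere. A (possibly
  unbounded) operator is its graph, a set of pairs of representatives. Graphs are closed under
  almost-everywhere equality in both arguments, so that equality of graphs is equality of
  operators in $L^2(X,\mu)$, domains included.\<close>

type_synonym 'a l2_op = "(('a \<Rightarrow> real) \<times> ('a \<Rightarrow> real)) set"

definition L2 :: "'a measure \<Rightarrow> ('a \<Rightarrow> real) set" where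
  "L2 M = {f \<in> borel_measurable M. integrable M (\<lambda>x. (f x)\<^sup>2)}"

definition l2_inner :: "'a measure \<Rightarrow> ('a \<Rightarrow> real) \<Rightarrow> ('a \<Rightarrow> real) \<Rightarrow> real" where
  "l2_inner M f g = (LINT x|M. f x * g x)"

definition l2_norm :: "'a measure \<Rightarrow> ('a \<Rightarrow> real) \<Rightarrow> real" where
  "l2_norm M f = sqrt (l2_inner M f f)"

text \<open>The second condition says both that the graph is closed under almost-everywhere equality
  and that it is single-valued modulo almost-everywhere equality.\<close>

definition linear_l2_op :: "'a measure \<Rightarrow> 'a l2_op \<Rightarrow> bool" where
  "linear_l2_op M T \<longleftrightarrow>
     T \<subseteq> L2 M \<times> L2 M \<and>
     (\<forall>(f, g)\<in>T. \<forall>f'\<in>L2 M. \<forall>g'\<in>L2 M.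
        (AE x in M. f' x = f x) \<longrightarrow> ((f', g') \<in> T \<longleftrightarrow> (AE x in M. g' x = g x))) \<and>
     ((\<lambda>_. 0), (\<lambda>_. 0)) \<in> T \<and>
     (\<forall>(f, g)\<in>T. \<forall>(f', g')\<in>T. \<forall>a b.
        ((\<lambda>x. a * f x + b * f' x), (\<lambda>x. a * g x + b * g' x)) \<in> T)"

text \<open>Some representative of $Tf$; it is only used for $f$ in the domain of $T$.\<close>

definition l2_apply :: "'a l2_op \<Rightarrow> ('a \<Rightarrow> real) \<Rightarrow> ('a \<Rightarrow> real)" where
  "l2_apply T f = (SOME g. (f, g) \<in> T)"

definition orthogonal_projection :: "'a measure \<Rightarrow> 'a l2_op \<Rightarrow> bool" where
  "orthogonal_projection M T \<longleftrightarrow>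
     linear_l2_op M T \<and> Domain T = L2 M \<and> T O T = T \<and>
     (\<forall>(f, g)\<in>T. \<forall>(f', g')\<in>T. l2_inner M g f' = l2_inner M f g')"

section \<open>Functional calculus\<close>

text \<open>Resolutions of the identity $(E_\lambda)_{\lambda\in R}$: increasing, strongly
  right-continuous families of orthogonal projections which converge strongly to $0$ at $-\infty$
  and to the identity at $+\infty$.\<close>

definition resolution_of_identity :: "'a measure \<Rightarrow> (real \<Rightarrow> 'a l2_op) \<Rightarrow> bool" where
  "resolution_of_identity M E \<longleftrightarrow>
     (\<forall>t. orthogonal_projection M (E t)) \<and>
     (\<forall>s t. s \<le> t \<longrightarrow> E s O E t = E s \<and> E t O E s = E s) \<and>
     (\<forall>f\<in>L2 M.
        (\<forall>t. ((\<lambda>s. l2_norm M (\<lambda>x. l2_apply (E s) f x - l2_apply (E t) f x)) \<longlongrightarrow> 0) (at_right t)) \<and>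
        ((\<lambda>s. l2_norm M (l2_apply (E s) f)) \<longlongrightarrow> 0) at_bot \<and>
        ((\<lambda>s. l2_norm M (\<lambda>x. l2_apply (E s) f x - f x)) \<longlongrightarrow> 0) at_top)"

text \<open>The measure $d(E_\lambda f,f)$.\<close>

definition spectral_measure :: "'a measure \<Rightarrow> (real \<Rightarrow> 'a l2_op) \<Rightarrow> ('a \<Rightarrow> real) \<Rightarrow> real measure" where
  "spectral_measure M E f = interval_measure (\<lambda>t. l2_inner M (l2_apply (E t) f) f)"

definition spectral_dom :: "'a measure \<Rightarrow> (real \<Rightarrow> 'a l2_op) \<Rightarrow> (real \<Rightarrow> real) \<Rightarrow> ('a \<Rightarrow> real) set" where
  "spectral_dom M E \<phi> = {f \<in> L2 M. integrable (spectral_measure M E f) (\<lambda>t. (\<phi> t)\<^sup>2)}"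

text \<open>The operator $\int\varphi\,dE_\lambda$, with domain $\{f : \int\varphi^2\,d(E_\lambda f,f)<\infty\}$
  and $(\int\varphi\,dE_\lambda\,f,h)=\int\varphi\,d(E_\lambda f,h)$. The integral against the signed
  measure $d(E_\lambda f,h)$ is expressed by polarization; it suffices to test with $h$ in the
  (dense) domain, for which both integrals converge.\<close>

definition spectral_integral :: "'a measure \<Rightarrow> (real \<Rightarrow> 'a l2_op) \<Rightarrow> (real \<Rightarrow> real) \<Rightarrow> 'a l2_op" where
  "spectral_integral M E \<phi> =
     {(f, g). f \<in> spectral_dom M E \<phi> \<and> g \<in> L2 M \<and>
        (\<forall>h\<in>spectral_dom M E \<phi>.
           l2_inner M g h =
             ((LINT t|spectral_measure M E (\<lambda>x. f x + h x). \<phi> t) -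
              (LINT t|spectral_measure M E (\<lambda>x. f x - h x). \<phi> t)) / 4)}"

text \<open>By the spectral theorem, for a self-adjoint operator $A$ there is exactly one resolution of
  the identity with $A=\int\lambda\,dE_\lambda$; then $\varphi(A)=\int\varphi(\lambda)\,dE_\lambda$.\<close>

definition spectral_resolution :: "'a measure \<Rightarrow> 'a l2_op \<Rightarrow> real \<Rightarrow> 'a l2_op" where
  "spectral_resolution M A =
     (THE E. resolution_of_identity M E \<and> A = spectral_integral M E (\<lambda>t. t))"

definition functional_calculus :: "'a measure \<Rightarrow> (real \<Rightarrow> real) \<Rightarrow> 'a l2_op \<Rightarrow> 'a l2_op" where
  "functional_calculus M \<phi> A = spectral_integral M (spectral_resolution M A) \<phi>"

section \<open>Isotropic Laplacians\<close>

text \<open>On the type \<^typ>\<open>ennreal\<close> $=[0,\infty]$ left-continuity includes the point $\infty$, and is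
  void at $0$.\<close>

definition distance_distribution :: "(ennreal \<Rightarrow> real) \<Rightarrow> bool" where
  "distance_distribution \<sigma> \<longleftrightarrow>
     range \<sigma> \<subseteq> {0..1} \<and> strict_mono \<sigma> \<and> (\<forall>r. continuous (at_left r) \<sigma>) \<and>
     (\<sigma> \<longlongrightarrow> 0) (at_right 0) \<and> \<sigma> \<infinity> = 1"

text \<open>The Stieltjes measure $d\sigma$ on $[0,\infty)$, determined by $d\sigma([a,b))=\sigma(b)-\sigma(a)$.
  \<^const>\<open>interval_measure\<close> measures the intervals $(a,b]$ and wants a right-continuous
  function, hence the use of $\sigma(r+)$. Since \<^const>\<open>ennreal\<close> maps negative numbers to $0$
  and $\sigma(0+)=0$, the negative half-line gets measure zero.\<close>

definition stieltjes :: "(ennreal \<Rightarrow> real) \<Rightarrow> real measure" where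
  "stieltjes \<sigma> = interval_measure (\<lambda>r. INF s\<in>{ennreal r<..}. \<sigma> s)"

definition ball_average :: "'a::metric_space measure \<Rightarrow> real \<Rightarrow> ('a \<Rightarrow> real) \<Rightarrow> 'a \<Rightarrow> real" where
  "ball_average M r f x = (LINT y:cball x r|M. f y) / measure M (cball x r)"

text \<open>For $f\in L^2$ the integral below converges absolutely for almost all $x$.\<close>

definition isotropic_markov_op :: "'a::metric_space measure \<Rightarrow> (ennreal \<Rightarrow> real) \<Rightarrow> 'a l2_op" where
  "isotropic_markov_op M \<sigma> =
     {(f, g). f \<in> L2 M \<and> g \<in> L2 M \<and>
        (AE x in M. g x = (LINT r:{0..}|stieltjes \<sigma>. ball_average M r f x))}"

text \<open>$\log\frac1P$. The spectrum of $P$ lies in $[0,1]$ and $P$ is injective, so the value of the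
  function $\log\frac1s$ at $s\le0$ is irrelevant.\<close>

definition isotropic_laplacian :: "'a::metric_space measure \<Rightarrow> (ennreal \<Rightarrow> real) \<Rightarrow> 'a l2_op" where
  "isotropic_laplacian M \<sigma> = functional_calculus M (\<lambda>s. ln (1 / s)) (isotropic_markov_op M \<sigma>)"

text \<open>$\psi(A)$ for a non-negative definite self-adjoint operator $A$ and $\psi:[0,\infty]\to[0,\infty]$
  finite on $[0,\infty)$. A strictly increasing $\psi$ has this finiteness property.\<close>

definition nonneg_functional_calculus ::
    "'a measure \<Rightarrow> (ennreal \<Rightarrow> ennreal) \<Rightarrow> 'a l2_op \<Rightarrow> 'a l2_op" where
  "nonneg_functional_calculus M \<psi> A = functional_calculus M (\<lambda>t. enn2real (\<psi> (ennreal t))) A"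

end

(*  The averaging operators Q_r are commuting projections, and a Haar-type orthonormal system e_n
    of L^2, built from a dense sequence, diagonalises all of them at once: Q_r e_n is e_n for r
    below a scale R_n in (0, oo] and 0 otherwise. Hence P = diag (sigma R_n). In such coordinates the
    functional calculus acts on the diagonal: phi (diag a) = diag (phi o a). Existence of the
    spectral resolution is explicit (cut off coordinates, Riesz-Fischer); uniqueness holds because
    an eigenvector with eigenvalue a is fixed by E_t for t >= a and killed for t < a, whatever the
    resolution E is. So the Laplacian is diag (log 1/sigma(R_n)), and
    sigma' = exp (- psi (log 1/sigma)) is the distance distribution function sought. *)
theory Submission
  imports Defs
begin

section \<open>The space $L^2$\<close>

text \<open>Passing to log 1/\<sigma> reverses the order, so the conditions on \<psi> match those on
  a distance distribution function one by one: right- against left-continuity,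
  \<open>\<psi> 0 = 0\<close> against the value 1 at infinity, divergence at infinity against the
  limit 0 at zero. Three obstacles shape the proof. The spectral resolution is defined with
  \<open>THE\<close>, so uniqueness has to be shown against arbitrary resolutions of the identity,
  whose spectral measures are not known to be discrete. The radii form a continuum, with no integer
  levels of a tree to induct on; compactness makes up for this, because the closed ball about a
  fixed point does not change when the radius grows slightly above r, and just below r it is the
  open ball. This gives both the totality of the orthonormal system and the joint measurability
  behind Fubini.\<close>

lemma L2_measurable: "f \<in> L2 M \<Longrightarrow> f \<in> borel_measurable M"
  by (simp add: L2_def)

lemma L2_integrable_mult:
  assumes "f \<in> L2 M" "g \<in> L2 M"
  shows "integrable M (\<lambda>x. f x * g x)"
proof (rule Bochner_Integration.integrable_bound)
  show "integrable M (\<lambda>x. (f x)\<^sup>2 + (g x)\<^sup>2)"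
    using assms by (simp add: L2_def)
  show "(\<lambda>x. f x * g x) \<in> borel_measurable M"
    using assms by (auto simp: L2_def)
  have "\<bar>a * b\<bar> \<le> a\<^sup>2 + b\<^sup>2" for a b :: real
  proof -
    have "0 \<le> (\<bar>a\<bar> - \<bar>b\<bar>)\<^sup>2" "0 \<le> a\<^sup>2" "0 \<le> b\<^sup>2" by simp_all
    then have "2 * (\<bar>a\<bar> * \<bar>b\<bar>) \<le> a\<^sup>2 + b\<^sup>2" by (simp add: power2_diff)
    moreover have "0 \<le> \<bar>a\<bar> * \<bar>b\<bar>" by simp
    ultimately show ?thesis unfolding abs_mult by linarith
  qed
  then show "AE x in M. norm (f x * g x) \<le> norm ((f x)\<^sup>2 + (g x)\<^sup>2)"
    by simp
qed

lemma L2_lincomb: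
  assumes "f \<in> L2 M" "g \<in> L2 M"
  shows "(\<lambda>x. a * f x + b * g x) \<in> L2 M"
proof -
  have "(\<lambda>x. (a * f x + b * g x)\<^sup>2) =
      (\<lambda>x. a\<^sup>2 * (f x)\<^sup>2 + 2 * a * b * (f x * g x) + b\<^sup>2 * (g x)\<^sup>2)"
    by (auto simp: power2_eq_square algebra_simps)
  then show ?thesis
    using assms L2_integrable_mult[OF assms] by (auto simp: L2_def)
qed

lemma L2_zero [simp]: "(\<lambda>_. 0) \<in> L2 M"
  by (simp add: L2_def)

lemma L2_add: "f \<in> L2 M \<Longrightarrow> g \<in> L2 M \<Longrightarrow> (\<lambda>x. f x + g x) \<in> L2 M"
  using L2_lincomb[of f M g 1 1] by simp

lemma L2_diff: "f \<in> L2 M \<Longrightarrow> g \<in> L2 M \<Longrightarrow> (\<lambda>x. f x - g x) \<in> L2 M"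
  using L2_lincomb[of f M g 1 "-1"] by simp

lemma L2_cmult: "f \<in> L2 M \<Longrightarrow> (\<lambda>x. a * f x) \<in> L2 M"
  using L2_lincomb[of f M f a 0] by simp

lemma L2_sum: "(\<And>i. i \<in> S \<Longrightarrow> f i \<in> L2 M) \<Longrightarrow> (\<lambda>x. \<Sum>i\<in>S. f i x) \<in> L2 M"
  by (induction S rule: infinite_finite_induct) (auto intro: L2_add)

lemma l2_inner_commute: "l2_inner M f g = l2_inner M g f"
  by (simp add: l2_inner_def mult.commute)

lemma l2_inner_lincomb_left:
  assumes "f \<in> L2 M" "g \<in> L2 M" "h \<in> L2 M"
  shows "l2_inner M (\<lambda>x. a * f x + b * g x) h = a * l2_inner M f h + b * l2_inner M g h"
proof -
  have "(\<lambda>x. (a * f x + b * g x) * h x) = (\<lambda>x. a * (f x * h x) + b * (g x * h x))"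
    by (auto simp: algebra_simps)
  then show ?thesis
    using L2_integrable_mult[OF assms(1,3)] L2_integrable_mult[OF assms(2,3)]
    by (simp add: l2_inner_def)
qed

lemma l2_inner_zero_left [simp]: "l2_inner M (\<lambda>_. 0) h = 0"
  by (simp add: l2_inner_def)

lemma l2_inner_zero_right [simp]: "l2_inner M h (\<lambda>_. 0) = 0"
  by (simp add: l2_inner_def)

lemma l2_inner_add_left:
  "f \<in> L2 M \<Longrightarrow> g \<in> L2 M \<Longrightarrow> h \<in> L2 M \<Longrightarrow>
    l2_inner M (\<lambda>x. f x + g x) h = l2_inner M f h + l2_inner M g h"
  using l2_inner_lincomb_left[of f M g h 1 1] by simp

lemma l2_inner_diff_left:
  "f \<in> L2 M \<Longrightarrow> g \<in> L2 M \<Longrightarrow> h \<in> L2 M \<Longrightarrow>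
    l2_inner M (\<lambda>x. f x - g x) h = l2_inner M f h - l2_inner M g h"
  using l2_inner_lincomb_left[of f M g h 1 "-1"] by simp

lemma l2_inner_cmult_left: "l2_inner M (\<lambda>x. a * f x) h = a * l2_inner M f h"
  by (simp add: l2_inner_def mult.assoc)

lemma l2_inner_add_right:
  "f \<in> L2 M \<Longrightarrow> g \<in> L2 M \<Longrightarrow> h \<in> L2 M \<Longrightarrow>
    l2_inner M h (\<lambda>x. f x + g x) = l2_inner M h f + l2_inner M h g"
  unfolding l2_inner_commute[of M h] by (rule l2_inner_add_left)

lemma l2_inner_diff_right:
  "f \<in> L2 M \<Longrightarrow> g \<in> L2 M \<Longrightarrow> h \<in> L2 M \<Longrightarrow>
    l2_inner M h (\<lambda>x. f x - g x) = l2_inner M h f - l2_inner M h g"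
  unfolding l2_inner_commute[of M h] by (rule l2_inner_diff_left)

lemma l2_inner_lincomb_right:
  "f \<in> L2 M \<Longrightarrow> g \<in> L2 M \<Longrightarrow> h \<in> L2 M \<Longrightarrow>
    l2_inner M h (\<lambda>x. a * f x + b * g x) = a * l2_inner M h f + b * l2_inner M h g"
  unfolding l2_inner_commute[of M h] by (rule l2_inner_lincomb_left)

lemma l2_inner_sum_left:
  assumes "\<And>i. i \<in> S \<Longrightarrow> f i \<in> L2 M" "h \<in> L2 M"
  shows "l2_inner M (\<lambda>x. \<Sum>i\<in>S. f i x) h = (\<Sum>i\<in>S. l2_inner M (f i) h)"
  using assms(1)
proof (induction S rule: infinite_finite_induct)
  case (insert i S)
  then show ?case
    using l2_inner_add_left[of "f i" M "\<lambda>x. \<Sum>i\<in>S. f i x" h] assms(2) by (simp add: L2_sum)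
qed auto

lemma l2_inner_cong_AE:
  assumes "f \<in> L2 M" "f' \<in> L2 M" "h \<in> L2 M" "AE x in M. f x = f' x"
  shows "l2_inner M f h = l2_inner M f' h"
  unfolding l2_inner_def
  using assms by (intro integral_cong_AE) (auto dest!: L2_measurable)

lemma l2_inner_self_nonneg [simp]: "0 \<le> l2_inner M f f"
  by (simp add: l2_inner_def)

lemma l2_inner_self_eq_0_iff:
  assumes "f \<in> L2 M"
  shows "l2_inner M f f = 0 \<longleftrightarrow> (AE x in M. f x = 0)"
  unfolding l2_inner_def
  using integral_nonneg_eq_0_iff_AE[OF L2_integrable_mult[OF assms assms]] by simp

lemma l2_norm_power2 [simp]: "(l2_norm M f)\<^sup>2 = l2_inner M f f"
  by (simp add: l2_norm_def)

lemma l2_norm_nonneg [simp]: "0 \<le> l2_norm M f"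
  by (simp add: l2_norm_def)

section \<open>Cauchy-Schwarz and completeness\<close>

lemma l2_Cauchy_Schwarz:
  assumes "f \<in> L2 M" "g \<in> L2 M"
  shows "\<bar>l2_inner M f g\<bar> \<le> l2_norm M f * l2_norm M g"
proof -
  define A B C where "A = l2_inner M f f" and "B = l2_inner M f g" and "C = l2_inner M g g"
  let ?h = "\<lambda>x. C * f x + (- B) * g x"
  have h: "?h \<in> L2 M" using assms by (rule L2_lincomb)
  have "l2_inner M ?h ?h = C * (C * A - B\<^sup>2)"
    using assms h
    by (simp only: l2_inner_lincomb_left l2_inner_lincomb_right)
      (simp add: A_def B_def C_def l2_inner_commute[of M g f] power2_eq_square algebra_simps)
  then have *: "0 \<le> C * (C * A - B\<^sup>2)" by (metis l2_inner_self_nonneg)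
  have "B\<^sup>2 \<le> A * C"
  proof (cases "C = 0")
    case True
    then have "AE x in M. g x = 0" using l2_inner_self_eq_0_iff[OF assms(2)] by (simp add: C_def)
    then have "l2_inner M g f = l2_inner M (\<lambda>_. 0) f"
      using assms by (intro l2_inner_cong_AE) auto
    then show ?thesis using True by (simp add: B_def l2_inner_commute)
  next
    case False
    then have "C > 0" using l2_inner_self_nonneg[of M g] by (simp add: C_def less_le)
    then show ?thesis using * by (simp add: zero_le_mult_iff mult.commute)
  qed
  then have "\<bar>B\<bar> \<le> sqrt (A * C)" using real_sqrt_le_mono[of "B\<^sup>2" "A * C"] by simp
  then show ?thesis by (simp add: A_def B_def C_def l2_norm_def real_sqrt_mult)
qed

lemma tendsto_l2_inner:
  assumes "\<And>k. s k \<in> L2 M" "f \<in> L2 M" "h \<in> L2 M"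
    and "((\<lambda>k. l2_norm M (\<lambda>x. f x - s k x)) \<longlongrightarrow> 0) F"
  shows "((\<lambda>k. l2_inner M (s k) h) \<longlongrightarrow> l2_inner M f h) F"
proof (rule LIM_zero_cancel, rule tendsto_0_le[where K="l2_norm M h"])
  show "\<forall>\<^sub>F k in F. norm (l2_inner M (s k) h - l2_inner M f h)
      \<le> norm (l2_norm M (\<lambda>x. f x - s k x)) * l2_norm M h"
  proof (rule always_eventually, rule allI)
    fix k
    show "norm (l2_inner M (s k) h - l2_inner M f h)
      \<le> norm (l2_norm M (\<lambda>x. f x - s k x)) * l2_norm M h"
      using l2_Cauchy_Schwarz[OF L2_diff[OF assms(2,1)] assms(3)]
      by (simp add: assms l2_inner_diff_left abs_minus_commute)
  qed
qed (fact assms(4))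

text \<open>The weight $4^k$ makes $|s_{k+1} - s_k|$ pointwise dominated by $2^{-k}$ times a fixed
  square-integrable function.\<close>

lemma L2_complete_fast:
  assumes s: "\<And>k. s k \<in> L2 M"
    and fast: "\<And>k. l2_inner M (\<lambda>x. s (Suc k) x - s k x) (\<lambda>x. s (Suc k) x - s k x) \<le> (1/8) ^ k"
  shows "\<exists>f\<in>L2 M. (\<lambda>k. l2_norm M (\<lambda>x. f x - s k x)) \<longlonglongrightarrow> 0"
proof -
  define D where "D k x = s (Suc k) x - s k x" for k x
  have D: "D k \<in> L2 M" for k unfolding D_def by (intro L2_diff s)
  have sm [measurable]: "s k \<in> borel_measurable M" for k using s L2_measurable by blast
  have Dm [measurable]: "D k \<in> borel_measurable M" for k using D L2_measurable by blast
  have Dint: "integrable M (\<lambda>x. 4 ^ k * (D k x)\<^sup>2)" for k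
    using D[of k] by (simp add: L2_def)
  have LD: "(LINT x|M. 4 ^ k * (D k x)\<^sup>2) \<le> (1/2) ^ k" for k
  proof -
    have "(LINT x|M. 4 ^ k * (D k x)\<^sup>2) = 4 ^ k * l2_inner M (D k) (D k)"
      by (simp add: l2_inner_def power2_eq_square)
    also have "\<dots> \<le> 4 ^ k * (1/8) ^ k" using fast[of k] by (intro mult_left_mono) (auto simp: D_def[abs_def])
    also have "\<dots> = (1/2) ^ k" by (simp flip: power_mult_distrib)
    finally show ?thesis .
  qed
  \<comment> \<open>The weight 4^k uses up only part of the assumed decay (1/8)^k, which leaves a
    geometric series with ratio 1/2.\<close>
  have Wfin: "(\<integral>\<^sup>+x. (\<Sum>k. ennreal (4 ^ k * (D k x)\<^sup>2)) \<partial>M) < \<infinity>"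
  proof -
    have "(\<integral>\<^sup>+x. (\<Sum>k. ennreal (4 ^ k * (D k x)\<^sup>2)) \<partial>M) = (\<Sum>k. \<integral>\<^sup>+x. ennreal (4 ^ k * (D k x)\<^sup>2) \<partial>M)"
      by (intro nn_integral_suminf) auto
    also have "\<dots> = (\<Sum>k. ennreal (LINT x|M. 4 ^ k * (D k x)\<^sup>2))"
      using Dint by (subst nn_integral_eq_integral) auto
    also have "\<dots> \<le> (\<Sum>k. ennreal ((1/2) ^ k))"
      using LD by (intro suminf_le ennreal_leI) auto
    also have "\<dots> < \<infinity>"
      by (subst suminf_ennreal2) (auto intro: summable_geometric)
    finally show ?thesis .
  qed
  define w where "w x = (\<Sum>k. 4 ^ k * (D k x)\<^sup>2)" for x
  have "AE x in M. (\<Sum>k. ennreal (4 ^ k * (D k x)\<^sup>2)) \<noteq> \<infinity>"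
    using Wfin by (intro nn_integral_PInf_AE) auto
  then have ae: "AE x in M. summable (\<lambda>k. 4 ^ k * (D k x)\<^sup>2)"
    by eventually_elim (auto intro: summable_suminf_not_top)
  have wm [measurable]: "w \<in> borel_measurable M" unfolding w_def[abs_def] by measurable
  have winter: "integrable M w"
  proof (rule integrableI_nonneg)
    show "AE x in M. 0 \<le> w x" using ae by eventually_elim (auto simp: w_def intro: suminf_nonneg)
    have "(\<integral>\<^sup>+x. ennreal (w x) \<partial>M) = (\<integral>\<^sup>+x. (\<Sum>k. ennreal (4 ^ k * (D k x)\<^sup>2)) \<partial>M)"
      using ae by (intro nn_integral_cong_AE) (auto elim!: eventually_mono simp: w_def suminf_ennreal2)
    then show "(\<integral>\<^sup>+x. ennreal (w x) \<partial>M) < \<infinity>" using Wfin by simp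
  qed measurable
  \<comment> \<open>\<open>lim\<close> is arbitrary at points of divergence; they form a null set,
    and the function so defined is measurable.\<close>
  define f where "f x = lim (\<lambda>k. s k x)" for x
  have fm [measurable]: "f \<in> borel_measurable M" unfolding f_def[abs_def] by measurable
  \<comment> \<open>A single term of the series \<open>w\<close> already gives |D_j| \<le> sqrt w *
    2^-j; the tail from k on sums to 2 * sqrt w * 2^-k, whose square is the bound.\<close>
  have bound: "(f x - s k x)\<^sup>2 \<le> 4 * (1/4) ^ k * w x" if sum: "summable (\<lambda>k. 4 ^ k * (D k x)\<^sup>2)" for x k
  proof -
    have w0: "0 \<le> w x" using sum by (auto simp: w_def intro: suminf_nonneg)
    have p2: "((2::real) ^ j)\<^sup>2 = 4 ^ j" "((1/2::real) ^ j)\<^sup>2 = (1/4) ^ j" for j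
      unfolding power2_eq_square by (simp_all flip: power_mult_distrib)
    have Db: "\<bar>D j x\<bar> \<le> sqrt (w x) * (1/2) ^ j" for j
    proof -
      have "4 ^ j * (D j x)\<^sup>2 \<le> w x"
        unfolding w_def using sum_le_suminf[OF sum, of "{j}"] by simp
      then have "(2 ^ j * D j x)\<^sup>2 \<le> w x"
        unfolding power_mult_distrib[of "2 ^ j"] p2 .
      then have "\<bar>2 ^ j * D j x\<bar> \<le> sqrt (w x)"
        using real_sqrt_le_mono[of "(2 ^ j * D j x)\<^sup>2" "w x"] by simp
      then show ?thesis by (simp add: abs_mult field_simps power_one_over)
    qed
    have sumD: "summable (\<lambda>j. D j x)"
      by (rule summable_comparison_test'[where g="\<lambda>j. sqrt (w x) * (1/2) ^ j" and N=0])
        (use Db in auto)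
    have tel: "(\<Sum>j<n. D j x) = s n x - s 0 x" for n
      by (induction n) (auto simp: D_def)
    have "(\<lambda>n. s n x - s 0 x) \<longlonglongrightarrow> (\<Sum>j. D j x)"
      using summable_LIMSEQ[OF sumD] by (simp add: tel)
    then have "(\<lambda>n. (s n x - s 0 x) + s 0 x) \<longlonglongrightarrow> (\<Sum>j. D j x) + s 0 x"
      by (intro tendsto_add tendsto_const)
    then have "f x = (\<Sum>j. D j x) + s 0 x" by (simp add: f_def limI)
    also have "(\<Sum>j. D j x) = (\<Sum>j. D (j + k) x) + (s k x - s 0 x)"
      using suminf_split_initial_segment[OF sumD, of k] by (simp add: tel)
    finally have eq: "f x - s k x = (\<Sum>j. D (j + k) x)" by simp
    have g: "summable (\<lambda>j. sqrt (w x) * (1/2) ^ (j + k))" "(\<Sum>j. sqrt (w x) * (1/2) ^ (j + k)) = 2 * sqrt (w x) * (1/2) ^ k"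
    proof -
      have "(\<lambda>j. (sqrt (w x) * (1/2)^k) * (1/2) ^ j) sums ((sqrt (w x) * (1/2)^k) * 2)"
        using geometric_sums[of "1/2::real"] by (intro sums_mult) simp
      then have "(\<lambda>j. sqrt (w x) * (1/2) ^ (j + k)) sums (2 * sqrt (w x) * (1/2) ^ k)"
        by (simp add: power_add mult_ac)
      then show "summable (\<lambda>j. sqrt (w x) * (1/2) ^ (j + k))" "(\<Sum>j. sqrt (w x) * (1/2) ^ (j + k)) = 2 * sqrt (w x) * (1/2) ^ k"
        by (auto simp: sums_iff)
    qed
    have nsum: "summable (\<lambda>j. norm (D (j + k) x))"
      by (rule summable_comparison_test'[OF g(1), of 0]) (use Db in auto)
    have "\<bar>f x - s k x\<bar> \<le> (\<Sum>j. norm (D (j + k) x))"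
      unfolding eq using summable_norm[OF nsum] by simp
    also have "\<dots> \<le> (\<Sum>j. sqrt (w x) * (1/2) ^ (j + k))"
      using Db by (intro suminf_le g nsum) auto
    also have "\<dots> = 2 * sqrt (w x) * (1/2) ^ k" by (rule g)
    finally have "\<bar>f x - s k x\<bar>\<^sup>2 \<le> (2 * sqrt (w x) * (1/2) ^ k)\<^sup>2"
      by (intro power_mono) auto
    also have "\<dots> = 4 * (1/4) ^ k * w x"
      using w0 unfolding power_mult_distrib p2 by simp
    finally show ?thesis by simp
  qed
  have L2d: "(\<lambda>x. f x - s k x) \<in> L2 M" for k
    unfolding L2_def
  proof (safe)
    show "integrable M (\<lambda>x. (f x - s k x)\<^sup>2)"
    proof (rule Bochner_Integration.integrable_bound)
      show "integrable M (\<lambda>x. 4 * (1/4) ^ k * w x)" using winter by simp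
      show "AE x in M. norm ((f x - s k x)\<^sup>2) \<le> norm (4 * (1/4) ^ k * w x)"
        using ae
      proof eventually_elim
        case (elim x)
        then show ?case using bound[OF elim, of k] by (smt (verit) real_norm_def zero_le_power2)
      qed
    qed measurable
  qed measurable
  have f: "f \<in> L2 M" using L2_add[OF L2d[of 0] s[of 0]] by simp
  have conv: "(\<lambda>k. l2_inner M (\<lambda>x. f x - s k x) (\<lambda>x. f x - s k x)) \<longlonglongrightarrow> 0"
  proof (rule tendsto_sandwich[where f="\<lambda>_. 0" and h="\<lambda>k. (4 * (1/4) ^ k) * (LINT x|M. w x)"])
    show "\<forall>\<^sub>F k in sequentially. l2_inner M (\<lambda>x. f x - s k x) (\<lambda>x. f x - s k x) \<le> (4 * (1/4) ^ k) * (LINT x|M. w x)"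
    proof (rule always_eventually, rule allI)
      fix k
      have "l2_inner M (\<lambda>x. f x - s k x) (\<lambda>x. f x - s k x) \<le> (LINT x|M. (4 * (1/4) ^ k) * w x)"
        unfolding l2_inner_def
      proof (rule integral_mono_AE)
        show "AE x in M. (f x - s k x) * (f x - s k x) \<le> 4 * (1 / 4) ^ k * w x"
          using ae by eventually_elim (use bound in \<open>simp add: power2_eq_square\<close>)
      qed (use L2d winter L2_integrable_mult in auto)
      then show "l2_inner M (\<lambda>x. f x - s k x) (\<lambda>x. f x - s k x) \<le> (4 * (1/4) ^ k) * (LINT x|M. w x)"
        by simp
    qed
    show "(\<lambda>k. (4 * (1/4) ^ k) * (LINT x|M. w x)) \<longlonglongrightarrow> 0"
      by (intro tendsto_mult_left_zero tendsto_mult_right_zero LIMSEQ_realpow_zero) auto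
  qed auto
  have "(\<lambda>k. l2_norm M (\<lambda>x. f x - s k x)) \<longlonglongrightarrow> 0"
    unfolding l2_norm_def using tendsto_real_sqrt[OF conv] by simp
  with f show ?thesis by blast
qed

section \<open>Diagonal operators\<close>

text \<open>Zero vectors are allowed among the \<open>e i\<close>: the enumeration of a dense
  sequence may repeat points and L^2 may be finite-dimensional, and the surplus indices then carry
  zero vectors.\<close>

locale l2_basis =
  fixes M :: "'a measure" and e :: "nat \<Rightarrow> 'a \<Rightarrow> real"
  assumes basis_L2: "e i \<in> L2 M"
    and basis_ortho: "i \<noteq> j \<Longrightarrow> l2_inner M (e i) (e j) = 0"
    and basis_normal: "e i = (\<lambda>_. 0) \<or> l2_inner M (e i) (e i) = 1"
    and basis_total: "f \<in> L2 M \<Longrightarrow> (\<And>i. l2_inner M f (e i) = 0) \<Longrightarrow> AE x in M. f x = 0"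
begin

definition coef :: "('a \<Rightarrow> real) \<Rightarrow> nat \<Rightarrow> real" where
  "coef f i = l2_inner M f (e i)"

lemma coef_lincomb:
  "f \<in> L2 M \<Longrightarrow> g \<in> L2 M \<Longrightarrow> coef (\<lambda>x. a * f x + b * g x) i = a * coef f i + b * coef g i"
  unfolding coef_def by (intro l2_inner_lincomb_left basis_L2)

lemma coef_add: "f \<in> L2 M \<Longrightarrow> g \<in> L2 M \<Longrightarrow> coef (\<lambda>x. f x + g x) i = coef f i + coef g i"
  unfolding coef_def by (intro l2_inner_add_left basis_L2)

lemma coef_diff: "f \<in> L2 M \<Longrightarrow> g \<in> L2 M \<Longrightarrow> coef (\<lambda>x. f x - g x) i = coef f i - coef g i"
  unfolding coef_def by (intro l2_inner_diff_left basis_L2)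

lemma coef_zero [simp]: "coef (\<lambda>_. 0) i = 0"
  by (simp add: coef_def)

lemma coef_basis: "i \<noteq> j \<Longrightarrow> coef (e j) i = 0"
  by (simp add: coef_def basis_ortho)

text \<open>The guard against zero vectors: a coefficient vanishes wherever \<open>e i\<close> does.
  The equation \<open>c i * coef (e i) i = c i\<close> is, besides square-summability, what a
  sequence must satisfy to be a coefficient sequence.\<close>

lemma coef_mult_coef_basis [simp]: "coef f i * coef (e i) i = coef f i"
  using basis_normal[of i] by (auto simp: coef_def)

lemma AE_eq_iff_coef:
  assumes "f \<in> L2 M" "g \<in> L2 M"
  shows "(AE x in M. f x = g x) \<longleftrightarrow> (\<forall>i. coef f i = coef g i)"
proof
  assume "AE x in M. f x = g x"
  then show "\<forall>i. coef f i = coef g i"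
    unfolding coef_def using assms by (auto intro!: l2_inner_cong_AE basis_L2)
next
  assume "\<forall>i. coef f i = coef g i"
  then have "AE x in M. f x - g x = 0"
    using assms by (intro basis_total L2_diff) (auto simp: coef_diff simp flip: coef_def)
  then show "AE x in M. f x = g x" by simp
qed

section \<open>Orthogonal expansions\<close>

definition partial_sum :: "(nat \<Rightarrow> real) \<Rightarrow> nat set \<Rightarrow> 'a \<Rightarrow> real" where
  "partial_sum c S x = (\<Sum>i\<in>S. c i * e i x)"

lemma partial_sum_L2: "partial_sum c S \<in> L2 M"
  unfolding partial_sum_def[abs_def] by (intro L2_sum L2_cmult basis_L2)

lemma inner_partial_sum:
  assumes "g \<in> L2 M"
  shows "l2_inner M (partial_sum c S) g = (\<Sum>i\<in>S. c i * coef g i)"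
  unfolding partial_sum_def[abs_def] coef_def
  by (subst l2_inner_sum_left)
    (auto intro!: L2_cmult basis_L2 assms sum.cong simp: l2_inner_cmult_left l2_inner_commute[of M g])

lemma coef_partial_sum:
  assumes "finite S" "\<And>i. c i * coef (e i) i = c i"
  shows "coef (partial_sum c S) i = (if i \<in> S then c i else 0)"
proof -
  have "coef (partial_sum c S) i = (\<Sum>j\<in>S. if i = j then c i else 0)"
    unfolding coef_def[of "partial_sum c S"] inner_partial_sum[OF basis_L2]
  proof (intro sum.cong refl)
    fix j
    show "c j * coef (e i) j = (if i = j then c i else 0)"
      using assms(2)[of i] coef_basis[of j i] by auto
  qed
  then show ?thesis using assms(1) by simp
qed

lemma inner_partial_sum_self:
  assumes "finite S" "\<And>i. c i * coef (e i) i = c i"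
  shows "l2_inner M (partial_sum c S) (partial_sum c S) = (\<Sum>i\<in>S. (c i)\<^sup>2)"
  using assms by (simp add: inner_partial_sum partial_sum_L2 coef_partial_sum power2_eq_square)

text \<open>Pythagoras, in a form that serves twice: it gives Bessel's inequality, and it identifies
  the norm of the limit in \<open>Riesz_Fischer\<close>.\<close>

lemma norm_diff_partial_sum:
  assumes "f \<in> L2 M" "finite S" "\<And>i. i \<in> S \<Longrightarrow> coef f i = c i" "\<And>i. c i * coef (e i) i = c i"
  shows "l2_inner M (\<lambda>x. f x - partial_sum c S x) (\<lambda>x. f x - partial_sum c S x)
    = l2_inner M f f - (\<Sum>i\<in>S. (c i)\<^sup>2)"
proof -
  have "l2_inner M (partial_sum c S) f = (\<Sum>i\<in>S. (c i)\<^sup>2)"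
    using assms by (simp add: inner_partial_sum power2_eq_square)
  then show ?thesis
    using assms(1) inner_partial_sum_self[OF assms(2,4)]
    by (simp add: l2_inner_diff_left l2_inner_diff_right L2_diff partial_sum_L2
        l2_inner_commute[of M f "partial_sum c S"])
qed

text \<open>The partial sums are cut at indices \<open>N k\<close> beyond which every block of
  squares has sum at most (1/8)^k, so consecutive cuts are as close as
  \<open>L2_complete_fast\<close> demands. Continuity of the inner product then yields the
  coefficients of the limit.\<close>

theorem Riesz_Fischer:
  assumes c: "summable (\<lambda>i. (c i)\<^sup>2)" "\<And>i. c i * coef (e i) i = c i"
  shows "\<exists>f\<in>L2 M. (\<forall>i. coef f i = c i) \<and> l2_inner M f f = (\<Sum>i. (c i)\<^sup>2)"
proof -
  have "\<exists>N. \<forall>n\<ge>N. \<forall>m. (\<Sum>i\<in>{n..<m}. (c i)\<^sup>2) \<le> (1/8) ^ k" for k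
  proof -
    have "(1/8::real) ^ k > 0" by simp
    then obtain N where N: "\<forall>m\<ge>N. \<forall>n. norm (\<Sum>i\<in>{m..<n}. (c i)\<^sup>2) < (1/8) ^ k"
      using c(1) unfolding summable_Cauchy by blast
    show ?thesis
    proof (intro exI[of _ N] allI impI)
      fix n m assume "N \<le> n"
      then have "norm (\<Sum>i\<in>{n..<m}. (c i)\<^sup>2) < (1/8) ^ k" using N by blast
      then show "(\<Sum>i\<in>{n..<m}. (c i)\<^sup>2) \<le> (1/8) ^ k" by simp
    qed
  qed
  then obtain N0 where N0: "\<And>k n m. n \<ge> N0 k \<Longrightarrow> (\<Sum>i\<in>{n..<m}. (c i)\<^sup>2) \<le> (1/8) ^ k"
    by metis
  \<comment> \<open>Adding up the \<open>N0 j\<close> makes \<open>N\<close> monotone; the summand k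
    makes it tend to infinity.\<close>
  define N where "N k = k + (\<Sum>j\<le>k. N0 j)" for k
  have N_ge: "N k \<ge> N0 k" "N k \<ge> k" for k
    using member_le_sum[of k "{..k}" N0] by (auto simp: N_def)
  have N_Suc: "N k \<le> N (Suc k)" for k by (simp add: N_def)
  have N_lim: "filterlim N at_top sequentially"
    using N_ge(2) by (intro filterlim_at_top_mono[OF filterlim_ident]) auto
  define s where "s k = partial_sum c {..<N k}" for k
  have s: "s k \<in> L2 M" for k by (simp add: s_def partial_sum_L2)
  have "\<exists>f\<in>L2 M. (\<lambda>k. l2_norm M (\<lambda>x. f x - s k x)) \<longlonglongrightarrow> 0"
  proof (rule L2_complete_fast[OF s])
    fix k
    have "s (Suc k) x - s k x = partial_sum c {N k..<N (Suc k)} x" for x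
    proof -
      have "{..<N (Suc k)} = {..<N k} \<union> {N k..<N (Suc k)}" using N_Suc[of k] by auto
      moreover have "{..<N k} \<inter> {N k..<N (Suc k)} = {}" by auto
      ultimately show ?thesis
        by (simp add: s_def partial_sum_def sum.union_disjoint)
    qed
    then show "l2_inner M (\<lambda>x. s (Suc k) x - s k x) (\<lambda>x. s (Suc k) x - s k x) \<le> (1/8) ^ k"
      using N0[OF N_ge(1), of k] by (simp add: inner_partial_sum_self c)
  qed
  then obtain f where f: "f \<in> L2 M" and lim: "(\<lambda>k. l2_norm M (\<lambda>x. f x - s k x)) \<longlonglongrightarrow> 0"
    by blast
  have coef: "coef f i = c i" for i
  proof (rule LIMSEQ_unique)
    show "(\<lambda>k. coef (s k) i) \<longlonglongrightarrow> coef f i"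
      unfolding coef_def by (rule tendsto_l2_inner[OF s f basis_L2 lim])
    have "\<forall>\<^sub>F k in sequentially. c i = coef (s k) i"
      using filterlim_at_top[THEN iffD1, OF N_lim, rule_format, of "Suc i"]
      by eventually_elim (simp add: s_def coef_partial_sum c)
    then show "(\<lambda>k. coef (s k) i) \<longlonglongrightarrow> c i"
      by (rule Lim_transform_eventually[OF tendsto_const])
  qed
  have "l2_inner M f f = (\<Sum>i. (c i)\<^sup>2)"
  proof (rule LIMSEQ_unique)
    have "(\<lambda>k. (l2_norm M (\<lambda>x. f x - s k x))\<^sup>2) \<longlonglongrightarrow> 0\<^sup>2"
      by (intro tendsto_power lim)
    then have "(\<lambda>k. l2_inner M f f - (\<Sum>i<N k. (c i)\<^sup>2)) \<longlonglongrightarrow> 0"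
      using norm_diff_partial_sum[OF f _ coef c(2)] by (simp add: s_def)
    then have "(\<lambda>k. l2_inner M f f - (l2_inner M f f - (\<Sum>i<N k. (c i)\<^sup>2))) \<longlonglongrightarrow> l2_inner M f f - 0"
      by (intro tendsto_diff tendsto_const)
    then show "(\<lambda>k. \<Sum>i<N k. (c i)\<^sup>2) \<longlonglongrightarrow> l2_inner M f f" by simp
    show "(\<lambda>k. \<Sum>i<N k. (c i)\<^sup>2) \<longlonglongrightarrow> (\<Sum>i. (c i)\<^sup>2)"
      by (rule filterlim_compose[OF summable_LIMSEQ[OF c(1)] N_lim])
  qed
  with f coef show ?thesis by blast
qed

text \<open>Bessel makes the squares summable, so \<open>Riesz_Fischer\<close> provides some g with
  the coefficients of f and the right norm; by totality g agrees with f almost everywhere.\<close>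

lemma Parseval_square:
  assumes f: "f \<in> L2 M"
  shows "(\<lambda>i. (coef f i)\<^sup>2) sums l2_inner M f f"
proof -
  have "summable (\<lambda>i. (coef f i)\<^sup>2)"
  proof (rule summableI_nonneg_bounded)
    fix n
    show "(\<Sum>i<n. (coef f i)\<^sup>2) \<le> l2_inner M f f"
      using norm_diff_partial_sum[OF f, of "{..<n}" "coef f"]
        l2_inner_self_nonneg[of M "\<lambda>x. f x - partial_sum (coef f) {..<n} x"] by simp
  qed simp
  note summable = this
  from Riesz_Fischer[OF this coef_mult_coef_basis] obtain g where
    g: "g \<in> L2 M" "\<forall>i. coef g i = coef f i" "l2_inner M g g = (\<Sum>i. (coef f i)\<^sup>2)" by auto
  then have ae: "AE x in M. f x = g x" using AE_eq_iff_coef f by simp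
  have "l2_inner M f f = l2_inner M g f" using f g ae by (intro l2_inner_cong_AE)
  also have "\<dots> = l2_inner M f g" by (rule l2_inner_commute)
  also have "\<dots> = l2_inner M g g" using f g ae by (intro l2_inner_cong_AE)
  finally show ?thesis using g(3) summable by (simp add: sums_iff)
qed

lemma Parseval:
  assumes f: "f \<in> L2 M" and g: "g \<in> L2 M"
  shows "(\<lambda>i. coef f i * coef g i) sums l2_inner M f g"
proof -
  have eq: "coef f i * coef g i =
      ((coef (\<lambda>x. f x + g x) i)\<^sup>2 - (coef (\<lambda>x. f x - g x) i)\<^sup>2) / 4" for i
    using f g by (simp add: coef_add coef_diff power2_eq_square algebra_simps)
  have eq': "l2_inner M f g = (l2_inner M (\<lambda>x. f x + g x) (\<lambda>x. f x + g x)
      - l2_inner M (\<lambda>x. f x - g x) (\<lambda>x. f x - g x)) / 4"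
    using f g by (simp add: l2_inner_add_left l2_inner_diff_left l2_inner_add_right
        l2_inner_diff_right L2_add L2_diff l2_inner_commute[of M g f])
  show ?thesis
    unfolding eq eq' using f g by (intro sums_divide sums_diff Parseval_square L2_add L2_diff)
qed

text \<open>The maximal domain is implicit: f belongs to it exactly when some square-integrable g
  has the multiplied coefficients. This is the domain of a spectral integral, also for unbounded
  a.\<close>

definition diag :: "(nat \<Rightarrow> real) \<Rightarrow> 'a l2_op" where
  "diag a = {(f, g). f \<in> L2 M \<and> g \<in> L2 M \<and> (\<forall>i. coef g i = a i * coef f i)}"

lemma diagD:
  "(f, g) \<in> diag a \<Longrightarrow> f \<in> L2 M" "(f, g) \<in> diag a \<Longrightarrow> g \<in> L2 M"
  "(f, g) \<in> diag a \<Longrightarrow> coef g i = a i * coef f i"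
  by (auto simp: diag_def)

lemma linear_l2_op_diag: "linear_l2_op M (diag a)"
  unfolding linear_l2_op_def
proof (intro conjI)
  show "\<forall>(f, g)\<in>diag a. \<forall>f'\<in>L2 M. \<forall>g'\<in>L2 M.
      (AE x in M. f' x = f x) \<longrightarrow> ((f', g') \<in> diag a) = (AE x in M. g' x = g x)"
    by (auto simp: diag_def AE_eq_iff_coef)
  show "\<forall>(f, g)\<in>diag a. \<forall>(f', g')\<in>diag a. \<forall>b c.
      (\<lambda>x. b * f x + c * f' x, \<lambda>x. b * g x + c * g' x) \<in> diag a"
    by (auto simp: diag_def L2_lincomb coef_lincomb algebra_simps)
qed (auto simp: diag_def)

section \<open>Spectral projections of a diagonal operator\<close>

definition spec_proj :: "(nat \<Rightarrow> real) \<Rightarrow> real \<Rightarrow> 'a l2_op" where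
  "spec_proj a t = diag (\<lambda>i. if a i \<le> t then 1 else 0)"

lemma ex_spec_proj:
  assumes f: "f \<in> L2 M"
  shows "\<exists>g. (f, g) \<in> spec_proj a t"
proof -
  let ?c = "\<lambda>i. (if a i \<le> t then 1 else 0) * coef f i"
  have "summable (\<lambda>i. (?c i)\<^sup>2)"
    by (rule summable_comparison_test'[where g="\<lambda>i. (coef f i)\<^sup>2" and N=0])
      (use Parseval_square[OF f] in \<open>auto simp: sums_iff\<close>)
  moreover have "?c i * coef (e i) i = ?c i" for i
    unfolding mult.assoc coef_mult_coef_basis ..
  ultimately obtain g where "g \<in> L2 M" "\<forall>i. coef g i = ?c i"
    using Riesz_Fischer[of ?c] by blast
  then show ?thesis using f by (auto simp: spec_proj_def diag_def)
qed

lemma spec_proj_apply: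
  assumes "f \<in> L2 M"
  shows "(f, l2_apply (spec_proj a t) f) \<in> spec_proj a t"
  unfolding l2_apply_def using someI_ex[OF ex_spec_proj[OF assms]] .

lemma spec_proj_apply_L2: "f \<in> L2 M \<Longrightarrow> l2_apply (spec_proj a t) f \<in> L2 M"
  using spec_proj_apply by (auto simp: spec_proj_def diag_def)

lemma coef_spec_proj_apply:
  "f \<in> L2 M \<Longrightarrow> coef (l2_apply (spec_proj a t) f) i = (if a i \<le> t then coef f i else 0)"
  using spec_proj_apply[of f a t] by (auto simp: spec_proj_def diag_def)

lemma orthogonal_projection_spec_proj: "orthogonal_projection M (spec_proj a t)"
  unfolding orthogonal_projection_def
proof (intro conjI)
  show "linear_l2_op M (spec_proj a t)" by (simp add: spec_proj_def linear_l2_op_diag)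
  show "Domain (spec_proj a t) = L2 M"
    using ex_spec_proj[of _ a t] by (auto simp: spec_proj_def diagD(1))
  show "spec_proj a t O spec_proj a t = spec_proj a t"
  proof (rule set_eqI, clarify, rule iffI)
    fix f g assume "(f, g) \<in> spec_proj a t O spec_proj a t"
    then show "(f, g) \<in> spec_proj a t" by (fastforce simp: spec_proj_def diag_def)
  next
    fix f g assume "(f, g) \<in> spec_proj a t"
    then have "(f, g) \<in> spec_proj a t" "(g, g) \<in> spec_proj a t" by (auto simp: spec_proj_def diag_def)
    then show "(f, g) \<in> spec_proj a t O spec_proj a t" by blast
  qed
  show "\<forall>(f, g)\<in>spec_proj a t. \<forall>(f', g')\<in>spec_proj a t. l2_inner M g f' = l2_inner M f g'"
  proof clarify
    fix f g f' g' assume *: "(f, g) \<in> spec_proj a t" "(f', g') \<in> spec_proj a t"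
    then have L: "f \<in> L2 M" "g \<in> L2 M" "f' \<in> L2 M" "g' \<in> L2 M"
      by (auto simp: spec_proj_def diag_def)
    have "coef g i * coef f' i = coef f i * coef g' i" for i
      using * by (auto simp: spec_proj_def diag_def)
    then show "l2_inner M g f' = l2_inner M f g'"
      using Parseval[OF L(2,3)] Parseval[OF L(1,4)] by (simp add: sums_iff)
  qed
qed

lemma spec_proj_comp:
  assumes "s \<le> t"
  shows "spec_proj a s O spec_proj a t = spec_proj a s" "spec_proj a t O spec_proj a s = spec_proj a s"
proof -
  show "spec_proj a s O spec_proj a t = spec_proj a s"
  proof (rule set_eqI, clarify, rule iffI)
    fix f g assume "(f, g) \<in> spec_proj a s O spec_proj a t"
    then obtain h where "(f, h) \<in> spec_proj a s" "(h, g) \<in> spec_proj a t" by blast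
    then show "(f, g) \<in> spec_proj a s" using assms by (force simp: spec_proj_def diag_def)
  next
    fix f g assume "(f, g) \<in> spec_proj a s"
    moreover from this have "(g, g) \<in> spec_proj a t"
      using assms by (auto simp: spec_proj_def diag_def)
    ultimately show "(f, g) \<in> spec_proj a s O spec_proj a t" by blast
  qed
  show "spec_proj a t O spec_proj a s = spec_proj a s"
  proof (rule set_eqI, clarify, rule iffI)
    fix f g assume "(f, g) \<in> spec_proj a t O spec_proj a s"
    then obtain h where "(f, h) \<in> spec_proj a t" "(h, g) \<in> spec_proj a s" by blast
    then show "(f, g) \<in> spec_proj a s" using assms by (force simp: spec_proj_def diag_def)
  next
    fix f g assume *: "(f, g) \<in> spec_proj a s"
    then have f: "f \<in> L2 M" by (simp add: spec_proj_def diag_def)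
    have "(l2_apply (spec_proj a t) f, g) \<in> spec_proj a s"
      using assms * spec_proj_apply_L2[OF f] coef_spec_proj_apply[OF f, of a t]
      by (auto simp: spec_proj_def diag_def)
    then show "(f, g) \<in> spec_proj a t O spec_proj a s" using spec_proj_apply[OF f] by blast
  qed
qed

text \<open>Dominated convergence for the coefficient series. Each coordinate of a spectral
  projection is a step function of the parameter, hence the hypothesis that coordinates are
  eventually zero.\<close>

lemma tendsto_l2_norm_0:
  assumes h: "\<And>s. h s \<in> L2 M" and f: "f \<in> L2 M" and F: "F \<noteq> bot"
    and bound: "\<And>s i. \<bar>coef (h s) i\<bar> \<le> \<bar>coef f i\<bar>"
    and lim: "\<And>i. \<forall>\<^sub>F s in F. coef (h s) i = 0"
  shows "((\<lambda>s. l2_norm M (h s)) \<longlongrightarrow> 0) F"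
proof -
  have "((\<lambda>s. \<Sum>i. (coef (h s) i)\<^sup>2) \<longlongrightarrow> (\<Sum>i. 0)) F"
  proof (rule tannerys_theorem[THEN conjunct2, THEN conjunct2])
    show "((\<lambda>s. (coef (h s) i)\<^sup>2) \<longlongrightarrow> 0) F" for i
      by (rule tendsto_eventually, rule eventually_mono[OF lim[of i]]) simp
    show "\<forall>\<^sub>F (i, s) in sequentially \<times>\<^sub>F F. norm ((coef (h s) i)\<^sup>2) \<le> (coef f i)\<^sup>2"
      using bound by (intro always_eventually) (auto simp: abs_le_square_iff)
    show "summable (\<lambda>i. (coef f i)\<^sup>2)" using Parseval_square[OF f] by (simp add: sums_iff)
  qed (fact F)
  moreover have "l2_inner M (h s) (h s) = (\<Sum>i. (coef (h s) i)\<^sup>2)" for s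
    using Parseval_square[OF h] by (simp add: sums_iff)
  ultimately have "((\<lambda>s. sqrt (l2_inner M (h s) (h s))) \<longlongrightarrow> sqrt 0) F"
    by (intro tendsto_real_sqrt) simp
  then show ?thesis by (simp add: l2_norm_def)
qed

text \<open>Coordinate i is switched on at t = a i, and stays on; switching on at the point itself,
  by a i \<le> t, is what makes the family right-continuous.\<close>

lemma resolution_of_identity_spec_proj: "resolution_of_identity M (spec_proj a)"
  unfolding resolution_of_identity_def
proof (intro conjI allI ballI impI)
  fix f t assume f: "f \<in> L2 M"
  note L = spec_proj_apply_L2[OF f] and c = coef_spec_proj_apply[OF f]
  \<comment> \<open>To the right of t nothing changes when s is replaced by \<open>max s t\<close>;
    the coordinates with a i \<le> t then cancel for every s.\<close>
  have "((\<lambda>s. l2_norm M (\<lambda>x. l2_apply (spec_proj a (max s t)) f x - l2_apply (spec_proj a t) f x)) \<longlongrightarrow> 0)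
      (at_right t)"
  proof (rule tendsto_l2_norm_0[OF _ f])
    fix i
    show "\<forall>\<^sub>F s in at_right t.
        coef (\<lambda>x. l2_apply (spec_proj a (max s t)) f x - l2_apply (spec_proj a t) f x) i = 0"
    proof (cases "a i \<le> t")
      case True
      then have "a i \<le> max s t" for s by simp
      then show ?thesis using L by (simp add: coef_diff c True)
    next
      case False
      then have "\<forall>\<^sub>F s in at_right t. s < a i" by (auto simp: eventually_at_right_field intro!: exI[of _ "a i"])
      then show ?thesis by eventually_elim (use False L in \<open>simp add: coef_diff c\<close>)
    qed
  qed (use L in \<open>auto intro!: L2_diff simp: coef_diff c\<close>)
  moreover have "\<forall>\<^sub>F s in at_right t. max s t = s"
    by (auto simp: eventually_at_filter intro!: always_eventually)
  ultimately show "((\<lambda>s. l2_norm M (\<lambda>x. l2_apply (spec_proj a s) f x - l2_apply (spec_proj a t) f x)) \<longlongrightarrow> 0)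
      (at_right t)"
    by (elim Lim_transform_eventually) (auto elim: eventually_mono)
next
  fix f assume f: "f \<in> L2 M"
  note L = spec_proj_apply_L2[OF f] and c = coef_spec_proj_apply[OF f]
  show "((\<lambda>s. l2_norm M (l2_apply (spec_proj a s) f)) \<longlongrightarrow> 0) at_bot"
  proof (rule tendsto_l2_norm_0[OF _ f])
    show "\<forall>\<^sub>F s in at_bot. coef (l2_apply (spec_proj a s) f) i = 0" for i
      using eventually_gt_at_bot[of "a i"] by eventually_elim (simp add: c)
  qed (use L in \<open>auto simp: c\<close>)
  show "((\<lambda>s. l2_norm M (\<lambda>x. l2_apply (spec_proj a s) f x - f x)) \<longlongrightarrow> 0) at_top"
  proof (rule tendsto_l2_norm_0[OF _ f])
    show "\<forall>\<^sub>F s in at_top. coef (\<lambda>x. l2_apply (spec_proj a s) f x - f x) i = 0" for i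
      using eventually_ge_at_top[of "a i"] by eventually_elim (use f L in \<open>simp add: coef_diff c\<close>)
  qed (use f L in \<open>auto intro!: L2_diff simp: coef_diff c\<close>)
qed (simp_all add: orthogonal_projection_spec_proj spec_proj_comp)

end

section \<open>Spectral measures and uniqueness of the resolution\<close>

lemma UN_Ioc_nat: "(\<Union>i::nat. {- real i<..real i}) = UNIV"
proof (rule UNIV_eq_I[symmetric])
  fix x :: real
  obtain n :: nat where "\<bar>x\<bar> < real n" using reals_Archimedean2 by blast
  then show "x \<in> (\<Union>i::nat. {- real i<..real i})" by (auto intro!: exI[of _ n])
qed

lemma interval_measure_eqI:
  assumes mono: "\<And>x y. x \<le> y \<Longrightarrow> F x \<le> F y"
    and right_cont: "\<And>a. continuous (at_right a) F"
    and sets: "sets N = sets borel"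
    and Ioc: "\<And>a b. a \<le> b \<Longrightarrow> emeasure N {a<..b} = ennreal (F b - F a)"
  shows "interval_measure F = N"
proof -
  let ?E = "range (\<lambda>(a, b). {a<..b::real})"
  have stable: "Int_stable ?E"
  proof (rule Int_stableI)
    fix X Y assume "X \<in> ?E" "Y \<in> ?E"
    then obtain a b c d where XY: "X = {a<..b}" "Y = {c<..d}" by auto
    have "X \<inter> Y = {max a c<..min b d}" by (auto simp: XY)
    then show "X \<inter> Y \<in> ?E" by auto
  qed
  have eq: "emeasure (interval_measure F) X = emeasure N X" if "X \<in> ?E" for X
  proof -
    from that obtain a b where X: "X = {a<..b}" by auto
    show ?thesis
      using Ioc[of a b] by (cases "a \<le> b")
        (simp_all add: X emeasure_interval_measure_Ioc_eq[OF mono right_cont])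
  qed
  show ?thesis
    by (rule measure_eqI_generator_eq[OF stable _ eq _ _ _ UN_Ioc_nat])
      (auto simp: borel_sigma_sets_Ioc sets emeasure_interval_measure_Ioc_eq[OF mono right_cont])
qed

lemma finite_interval_measure:
  assumes mono: "\<And>x y. x \<le> y \<Longrightarrow> F x \<le> F y"
    and right_cont: "\<And>a. continuous (at_right a) F"
    and bounds: "\<And>x. c \<le> F x" "\<And>x. F x \<le> C"
  shows "finite_measure (interval_measure F)"
proof
  have "emeasure (interval_measure F) UNIV = (SUP i::nat. emeasure (interval_measure F) {- real i<..real i})"
    unfolding UN_Ioc_nat[symmetric] by (rule SUP_emeasure_incseq[symmetric]) (auto simp: incseq_def)
  also have "\<dots> \<le> ennreal (C - c)"
    by (intro SUP_least) (auto simp: emeasure_interval_measure_Ioc_eq[OF mono right_cont]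
        intro!: ennreal_leI diff_mono bounds)
  finally show "emeasure (interval_measure F) (space (interval_measure F)) \<noteq> \<infinity>"
    by (auto simp: top_unique)
qed

text \<open>An arbitrary resolution, since uniqueness has to be tested against every
  competitor.\<close>

locale resolution =
  fixes M :: "'a measure" and E :: "real \<Rightarrow> 'a l2_op"
  assumes resolution: "resolution_of_identity M E"
begin

abbreviation proj :: "real \<Rightarrow> ('a \<Rightarrow> real) \<Rightarrow> 'a \<Rightarrow> real" where
  "proj t \<equiv> l2_apply (E t)"

lemma orth: "orthogonal_projection M (E t)"
  using resolution by (simp add: resolution_of_identity_def)

lemma linear: "linear_l2_op M (E t)" and dom: "Domain (E t) = L2 M"
  using orth by (auto simp: orthogonal_projection_def)

lemma proj_graph: "f \<in> L2 M \<Longrightarrow> (f, proj t f) \<in> E t"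
  using dom unfolding l2_apply_def by (metis DomainE someI_ex)

lemma graph_L2: "(f, g) \<in> E t \<Longrightarrow> f \<in> L2 M" "(f, g) \<in> E t \<Longrightarrow> g \<in> L2 M"
  using linear[of t, unfolded linear_l2_op_def, THEN conjunct1] by auto

lemma proj_L2: "f \<in> L2 M \<Longrightarrow> proj t f \<in> L2 M"
  using proj_graph graph_L2 by blast

lemma graph_cong:
  assumes "(f, g) \<in> E t" "f' \<in> L2 M" "g' \<in> L2 M" "AE x in M. f' x = f x"
  shows "(f', g') \<in> E t \<longleftrightarrow> (AE x in M. g' x = g x)"
  using linear[of t, unfolded linear_l2_op_def, THEN conjunct2, THEN conjunct1, THEN bspec, OF assms(1)]
    assms(2-4) by simp

lemma graph_unique:
  assumes "(f, g) \<in> E t" "(f, g') \<in> E t"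
  shows "AE x in M. g x = g' x"
  using graph_cong[of f g' t f g] assms graph_L2 by auto

lemma graph_inner:
  assumes "(f, g) \<in> E t" "f' \<in> L2 M"
  shows "l2_inner M g f' = l2_inner M f (proj t f')"
  using orth[of t] assms proj_graph[of f' t] by (fastforce simp: orthogonal_projection_def)

lemma inner_proj:
  "f \<in> L2 M \<Longrightarrow> g \<in> L2 M \<Longrightarrow> l2_inner M (proj t f) g = l2_inner M f (proj t g)"
  using graph_inner proj_graph by blast

lemma inner_graph_cong:
  assumes "(f, g) \<in> E t" "h \<in> L2 M"
  shows "l2_inner M (proj t f) h = l2_inner M g h"
  using assms graph_L2[OF assms(1)]
  by (intro l2_inner_cong_AE proj_L2 graph_unique[OF proj_graph[of f t]]) auto

text \<open>Representatives chosen by \<open>l2_apply\<close> are determined only almost everywhere,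
  and the composition in the axioms is relational. Testing against h removes both ambiguities, so
  composition laws are stated in this weak form.\<close>

lemma inner_proj_proj_le:
  assumes "f \<in> L2 M" "h \<in> L2 M" "s \<le> t"
  shows "l2_inner M (proj t (proj s f)) h = l2_inner M (proj s f) h"
proof (rule inner_graph_cong)
  have "(f, proj s f) \<in> E s O E t"
    using resolution assms proj_graph by (simp add: resolution_of_identity_def)
  then obtain k where k: "(f, k) \<in> E s" "(k, proj s f) \<in> E t" by blast
  have "AE x in M. proj s f x = k x" using graph_unique[OF proj_graph k(1)] assms by blast
  then show "(proj s f, proj s f) \<in> E t"
    using graph_cong[OF k(2), of "proj s f" "proj s f"] assms proj_L2 by auto
qed fact

lemma inner_proj_proj_min:
  assumes f: "f \<in> L2 M" and g: "g \<in> L2 M"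
  shows "l2_inner M (proj t (proj s f)) g = l2_inner M (proj (min s t) f) g"
proof (cases "s \<le> t")
  case True
  then show ?thesis using inner_proj_proj_le f g by (simp add: min_def)
next
  case False
  then have "l2_inner M (proj t (proj s f)) g = l2_inner M f (proj s (proj t g))"
    using f g by (simp add: inner_proj proj_L2)
  also have "\<dots> = l2_inner M (proj t g) f"
    unfolding l2_inner_commute[of M f] using False f g by (intro inner_proj_proj_le) auto
  also have "\<dots> = l2_inner M (proj t f) g"
    using inner_proj[OF f g, of t] by (simp add: l2_inner_commute[of M _ f])
  finally show ?thesis using False by (simp add: min_def)
qed

section \<open>Distribution functions of spectral measures\<close>

definition cdf :: "('a \<Rightarrow> real) \<Rightarrow> real \<Rightarrow> real" where
  "cdf f t = l2_inner M (proj t f) f"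

lemma inner_proj_proj_self:
  assumes f: "f \<in> L2 M"
  shows "l2_inner M (proj s f) (proj t f) = cdf f (min s t)"
  using inner_proj_proj_min[OF f f] inner_proj[OF proj_L2[OF f] f] by (simp add: cdf_def)

text \<open>Increments of the distribution function are squared norms. Monotonicity follows, and
  strong right-continuity of the resolution becomes right-continuity of
  \<open>cdf f\<close>.\<close>

lemma cdf_diff:
  assumes f: "f \<in> L2 M" and "s \<le> t"
  shows "l2_inner M (\<lambda>x. proj t f x - proj s f x) (\<lambda>x. proj t f x - proj s f x) = cdf f t - cdf f s"
  using assms by (simp add: l2_inner_diff_left l2_inner_diff_right L2_diff proj_L2 inner_proj_proj_self)

lemma cdf_mono: "f \<in> L2 M \<Longrightarrow> s \<le> t \<Longrightarrow> cdf f s \<le> cdf f t"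
  using cdf_diff[of f s t] l2_inner_self_nonneg[of M "\<lambda>x. proj t f x - proj s f x"] by simp

lemma cdf_nonneg: "f \<in> L2 M \<Longrightarrow> 0 \<le> cdf f t"
  using inner_proj_proj_self[of f t t] l2_inner_self_nonneg[of M "proj t f"] by simp

lemma norm_proj_diff_self:
  assumes f: "f \<in> L2 M"
  shows "l2_inner M (\<lambda>x. proj t f x - f x) (\<lambda>x. proj t f x - f x) = l2_inner M f f - cdf f t"
  using assms inner_proj_proj_self[OF f, of t t]
  by (simp add: l2_inner_diff_left l2_inner_diff_right L2_diff proj_L2 cdf_def l2_inner_commute[of M f "proj t f"])

lemma cdf_le: "f \<in> L2 M \<Longrightarrow> cdf f t \<le> l2_inner M f f"
  using norm_proj_diff_self[of f t] l2_inner_self_nonneg[of M "\<lambda>x. proj t f x - f x"] by simp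

lemma cdf_right_cont:
  assumes f: "f \<in> L2 M"
  shows "continuous (at_right t) (cdf f)"
  unfolding continuous_within
proof -
  have "((\<lambda>s. l2_norm M (\<lambda>x. proj s f x - proj t f x)) \<longlongrightarrow> 0) (at_right t)"
    using resolution f by (simp add: resolution_of_identity_def)
  from tendsto_power[OF this, of 2]
  have "((\<lambda>s. (l2_norm M (\<lambda>x. proj s f x - proj t f x))\<^sup>2) \<longlongrightarrow> 0) (at_right t)"
    by simp
  then have "((\<lambda>s. cdf f s - cdf f t) \<longlongrightarrow> 0) (at_right t)"
  proof (rule Lim_transform_eventually)
    show "\<forall>\<^sub>F s in at_right t. (l2_norm M (\<lambda>x. proj s f x - proj t f x))\<^sup>2 = cdf f s - cdf f t"
      using eventually_at_right_less[of t] by eventually_elim (use f in \<open>simp add: cdf_diff\<close>)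
  qed
  then show "(cdf f \<longlongrightarrow> cdf f t) (at_right t)" by (simp add: LIM_zero_iff)
qed

lemma cdf_at_bot:
  assumes f: "f \<in> L2 M"
  shows "(cdf f \<longlongrightarrow> 0) at_bot"
proof -
  have "((\<lambda>s. l2_norm M (proj s f)) \<longlongrightarrow> 0) at_bot"
    using resolution f by (simp add: resolution_of_identity_def)
  then have "((\<lambda>s. (l2_norm M (proj s f))\<^sup>2) \<longlongrightarrow> 0\<^sup>2) at_bot" by (intro tendsto_power)
  then show ?thesis using f by (simp add: inner_proj_proj_self)
qed

lemma cdf_at_top:
  assumes f: "f \<in> L2 M"
  shows "(cdf f \<longlongrightarrow> l2_inner M f f) at_top"
proof -
  have "((\<lambda>s. l2_norm M (\<lambda>x. proj s f x - f x)) \<longlongrightarrow> 0) at_top"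
    using resolution f by (simp add: resolution_of_identity_def)
  then have "((\<lambda>s. (l2_norm M (\<lambda>x. proj s f x - f x))\<^sup>2) \<longlongrightarrow> 0\<^sup>2) at_top" by (intro tendsto_power)
  then have "((\<lambda>s. l2_inner M f f - cdf f s) \<longlongrightarrow> 0) at_top"
    using f by (simp add: norm_proj_diff_self)
  then have "((\<lambda>s. l2_inner M f f - (l2_inner M f f - cdf f s)) \<longlongrightarrow> l2_inner M f f - 0) at_top"
    by (intro tendsto_diff tendsto_const)
  then show ?thesis by simp
qed

lemma spectral_measure_cdf: "spectral_measure M E f = interval_measure (cdf f)"
  by (simp add: spectral_measure_def cdf_def[abs_def])

lemma emeasure_spectral_measure_Ioc:
  "f \<in> L2 M \<Longrightarrow> a \<le> b \<Longrightarrow> emeasure (spectral_measure M E f) {a<..b} = ennreal (cdf f b - cdf f a)"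
  unfolding spectral_measure_cdf by (intro emeasure_interval_measure_Ioc cdf_mono cdf_right_cont)

lemma measure_spectral_measure_Ioc:
  "f \<in> L2 M \<Longrightarrow> a \<le> b \<Longrightarrow> measure (spectral_measure M E f) {a<..b} = cdf f b - cdf f a"
  by (simp add: measure_def emeasure_spectral_measure_Ioc cdf_mono)

lemma sets_spectral_measure [simp, measurable_cong]: "sets (spectral_measure M E f) = sets borel"
  by (simp add: spectral_measure_def)

lemma space_spectral_measure [simp]: "space (spectral_measure M E f) = UNIV"
  by (simp add: spectral_measure_def)

lemma finite_spectral_measure: "f \<in> L2 M \<Longrightarrow> finite_measure (spectral_measure M E f)"
  unfolding spectral_measure_cdf
  by (rule finite_interval_measure) (auto intro: cdf_mono cdf_right_cont cdf_nonneg cdf_le)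

lemma spectral_measure_eqI:
  assumes "f \<in> L2 M" "sets N = sets borel"
    and "\<And>a b. a \<le> b \<Longrightarrow> emeasure N {a<..b} = ennreal (cdf f b - cdf f a)"
  shows "spectral_measure M E f = N"
  unfolding spectral_measure_cdf
  using assms by (intro interval_measure_eqI cdf_mono cdf_right_cont)

text \<open>On the spectral window (r, s] the combination acts as (a + b) f and outside it as a f,
  so the density is (a + b)^2 there and a^2 elsewhere. It is used with coefficients (0, 1), (1, 1)
  and (1, -1), the vectors that polarization against h involves.\<close>

lemma spectral_measure_window:
  assumes f: "f \<in> L2 M" and rs: "r \<le> s"
  defines "h \<equiv> \<lambda>x. proj s f x - proj r f x"
  shows "spectral_measure M E (\<lambda>x. a * f x + b * h x) =
    density (spectral_measure M E f) (\<lambda>t. ennreal (a\<^sup>2 + (2 * a * b + b\<^sup>2) * indicator {r<..s} t))"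
    (is "spectral_measure M E ?w = density ?\<mu> ?k")
proof (rule spectral_measure_eqI)
  interpret \<mu>: finite_measure ?\<mu> by (rule finite_spectral_measure[OF f])
  have h: "h \<in> L2 M" unfolding h_def using f by (intro L2_diff proj_L2)
  show w: "?w \<in> L2 M" using f h by (rule L2_lincomb)
  \<comment> \<open>The spectral mass of f in the part of (r, s] up to t; all mixed terms reduce to
    it.\<close>
  define H where "H t = cdf f (min s t) - cdf f (min r t)" for t
  have phk: "l2_inner M (proj t h) k = l2_inner M (proj (min s t) f) k - l2_inner M (proj (min r t) f) k"
    if k: "k \<in> L2 M" for t k
  proof -
    have "l2_inner M (proj t h) k = l2_inner M h (proj t k)" using h k by (rule inner_proj)
    also have "\<dots> = l2_inner M (proj t (proj s f)) k - l2_inner M (proj t (proj r f)) k"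
      using f k unfolding h_def by (simp add: l2_inner_diff_left proj_L2 inner_proj)
    finally show ?thesis using f k by (simp add: inner_proj_proj_min)
  qed
  have hf: "l2_inner M (proj t h) f = H t" for t
    using f by (simp add: phk H_def cdf_def)
  have fh: "l2_inner M (proj t f) h = H t" for t
    using f h hf[of t] by (simp add: inner_proj l2_inner_commute[of M f])
  have hh: "l2_inner M (proj t h) h = H t" for t
    using h rs unfolding phk[OF h] fh by (simp add: H_def min_def)
  have plin: "l2_inner M (proj t ?w) k = a * l2_inner M (proj t f) k + b * l2_inner M (proj t h) k"
    if k: "k \<in> L2 M" for t k
    using f h k w by (simp add: inner_proj l2_inner_lincomb_left proj_L2)
  have cdfw: "cdf ?w t = a\<^sup>2 * cdf f t + (2 * a * b + b\<^sup>2) * H t" for t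
    unfolding cdf_def[of ?w] plin[OF w] using f h
    by (simp add: l2_inner_lincomb_right proj_L2 hf fh hh power2_eq_square algebra_simps flip: cdf_def[of f])
  show "sets (density ?\<mu> ?k) = sets borel" by simp
  fix p q :: real assume pq: "p \<le> q"
  have nonneg: "0 \<le> a\<^sup>2 + (2 * a * b + b\<^sup>2) * indicator {r<..s} t" for t
  proof -
    have "a\<^sup>2 + (2 * a * b + b\<^sup>2) = (a + b)\<^sup>2" by (simp add: power2_eq_square algebra_simps)
    then show ?thesis by (simp add: indicator_def)
  qed
  have IJ: "{p<..q} \<inter> {r<..s} = {max p r<..min q s}" by auto
  have mJ: "measure ?\<mu> ({p<..q} \<inter> {r<..s}) = H q - H p"
    unfolding IJ
  proof (cases "max p r \<le> min q s")
    case True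
    then show "measure ?\<mu> {max p r<..min q s} = H q - H p"
      using pq rs measure_spectral_measure_Ioc[OF f True]
      by (auto simp: H_def min_def max_def split: if_splits) (metis order_antisym order_trans)+
  next
    case False
    then show "measure ?\<mu> {max p r<..min q s} = H q - H p"
      using pq rs by (auto simp: H_def min_def max_def split: if_splits)
  qed
  have "emeasure (density ?\<mu> ?k) {p<..q} =
      (\<integral>\<^sup>+t. ennreal ((a\<^sup>2 + (2 * a * b + b\<^sup>2) * indicator {r<..s} t) * indicator {p<..q} t) \<partial>?\<mu>)"
    by (subst emeasure_density) (auto intro!: nn_integral_cong simp: indicator_def)
  also have "\<dots> = ennreal (LINT t|?\<mu>. (a\<^sup>2 + (2 * a * b + b\<^sup>2) * indicator {r<..s} t) * indicator {p<..q} t)"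
  proof (rule nn_integral_eq_integral)
    show "integrable ?\<mu> (\<lambda>t. (a\<^sup>2 + (2 * a * b + b\<^sup>2) * indicator {r<..s} t) * indicator {p<..q} t)"
    proof (rule \<mu>.integrable_const_bound)
      have "\<bar>a\<^sup>2 + (2 * a * b + b\<^sup>2)\<bar> \<le> a\<^sup>2 + \<bar>2 * a * b + b\<^sup>2\<bar>"
        by (rule order_trans[OF abs_triangle_ineq]) simp
      then show "AE t in ?\<mu>. norm ((a\<^sup>2 + (2 * a * b + b\<^sup>2) * indicator {r<..s} t) * indicator {p<..q} t)
          \<le> a\<^sup>2 + \<bar>2 * a * b + b\<^sup>2\<bar>"
        by (intro always_eventually allI) (auto simp: indicator_def)
    qed auto
    show "AE t in ?\<mu>. 0 \<le> (a\<^sup>2 + (2 * a * b + b\<^sup>2) * indicator {r<..s} t) * indicator {p<..q} t"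
      using nonneg by auto
  qed
  also have "(LINT t|?\<mu>. (a\<^sup>2 + (2 * a * b + b\<^sup>2) * indicator {r<..s} t) * indicator {p<..q} t) =
      (LINT t|?\<mu>. a\<^sup>2 * indicator {p<..q} t + (2 * a * b + b\<^sup>2) * indicator ({p<..q} \<inter> {r<..s}) t)"
    by (intro Bochner_Integration.integral_cong) (auto simp: indicator_def)
  also have "\<dots> = a\<^sup>2 * measure ?\<mu> {p<..q} + (2 * a * b + b\<^sup>2) * measure ?\<mu> ({p<..q} \<inter> {r<..s})"
    by (subst Bochner_Integration.integral_add) (auto simp: less_top[symmetric])
  also have "\<dots> = cdf ?w q - cdf ?w p"
    unfolding cdfw mJ measure_spectral_measure_Ioc[OF f pq]
    by (simp add: algebra_simps)
  finally show "emeasure (density ?\<mu> ?k) {p<..q} = ennreal (cdf ?w q - cdf ?w p)" .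
qed

text \<open>Testing the weak form of $\int\lambda\,dE_\lambda u = a u$ against $h = (E_s - E_r)u$.\<close>

lemma eigenvector_integral_zero:
  assumes u: "(u, \<lambda>x. a * u x) \<in> spectral_integral M E (\<lambda>t. t)" and rs: "r \<le> s"
  shows "(LINT t|spectral_measure M E u. (t - a) * indicator {r<..s} t) = 0"
proof -
  let ?\<mu> = "spectral_measure M E u"
  define h where "h x = proj s u x - proj r u x" for x
  have L: "u \<in> L2 M" and int2: "integrable ?\<mu> (\<lambda>t. t\<^sup>2)"
    using u by (auto simp: spectral_integral_def spectral_dom_def)
  interpret \<mu>: finite_measure ?\<mu> by (rule finite_spectral_measure[OF L])
  have h: "h \<in> L2 M" unfolding h_def[abs_def] using L by (intro L2_diff proj_L2)
  note window = spectral_measure_window[OF L rs, folded h_def]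
  have abs_le: "\<bar>t\<bar> \<le> 1 + t\<^sup>2" for t :: real
  proof -
    have "0 \<le> (\<bar>t\<bar> - 1)\<^sup>2" by simp
    then show ?thesis unfolding power2_diff by simp
  qed
  have int1: "integrable ?\<mu> (\<lambda>t. t)"
  proof (rule Bochner_Integration.integrable_bound)
    show "integrable ?\<mu> (\<lambda>t. 1 + t\<^sup>2)" using int2 by simp
    show "AE t in ?\<mu>. norm t \<le> norm (1 + t\<^sup>2)"
      using abs_le by (intro always_eventually allI) (smt (verit) real_norm_def zero_le_power2)
  qed simp
  have intJ: "integrable ?\<mu> (\<lambda>t. t * indicator {r<..s} t)"
    using int1 by (rule integrable_real_mult_indicator[rotated]) simp
  have int2J: "integrable ?\<mu> (\<lambda>t. indicator {r<..s} t * t\<^sup>2)"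
    using int2 by (subst mult.commute) (rule integrable_real_mult_indicator[rotated], auto)
  have "spectral_measure M E h = density ?\<mu> (\<lambda>t. ennreal (indicator {r<..s} t))"
    using window[of 0 1] by simp
  then have hd: "h \<in> spectral_dom M E (\<lambda>t. t)"
    using h int2J by (simp add: spectral_dom_def integrable_density)
  \<comment> \<open>The two polarized measures have densities 4 and 0 on the window and the same
    density 1 outside it; their difference is 4 times the restriction to the window, which absorbs
    the factor 1/4.\<close>
  have plus: "spectral_measure M E (\<lambda>x. u x + h x) = density ?\<mu> (\<lambda>t. ennreal (1 + 3 * indicator {r<..s} t))"
    using window[of 1 1] by simp
  have minus: "spectral_measure M E (\<lambda>x. u x - h x) = density ?\<mu> (\<lambda>t. ennreal (1 - indicator {r<..s} t))"
    using window[of 1 "-1"] by simp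
  have "l2_inner M (\<lambda>x. a * u x) h = ((LINT t|spectral_measure M E (\<lambda>x. u x + h x). t)
      - (LINT t|spectral_measure M E (\<lambda>x. u x - h x). t)) / 4"
    using u hd by (auto simp: spectral_integral_def)
  also have "(LINT t|spectral_measure M E (\<lambda>x. u x + h x). t) = (LINT t|?\<mu>. t + 3 * (t * indicator {r<..s} t))"
    unfolding plus by (subst integral_density) (auto intro!: Bochner_Integration.integral_cong simp: indicator_def)
  also have "\<dots> = (LINT t|?\<mu>. t) + 3 * (LINT t|?\<mu>. t * indicator {r<..s} t)"
    using int1 intJ by simp
  also have "(LINT t|spectral_measure M E (\<lambda>x. u x - h x). t) = (LINT t|?\<mu>. t - t * indicator {r<..s} t)"
    unfolding minus by (subst integral_density) (auto intro!: Bochner_Integration.integral_cong simp: indicator_def)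
  also have "\<dots> = (LINT t|?\<mu>. t) - (LINT t|?\<mu>. t * indicator {r<..s} t)"
    using int1 intJ by simp
  finally have "a * l2_inner M u h = (LINT t|?\<mu>. t * indicator {r<..s} t)"
    by (simp add: l2_inner_cmult_left)
  moreover have "l2_inner M u h = measure ?\<mu> {r<..s}"
    using L rs unfolding h_def[abs_def]
    by (simp add: l2_inner_diff_left proj_L2 measure_spectral_measure_Ioc cdf_def l2_inner_commute[of M u])
  moreover have "(LINT t|?\<mu>. (t - a) * indicator {r<..s} t) =
      (LINT t|?\<mu>. t * indicator {r<..s} t) - a * measure ?\<mu> {r<..s}"
    using intJ by (simp add: left_diff_distrib less_top[symmetric])
  ultimately show ?thesis by simp
qed

text \<open>On a window that misses a the function t - a has a strict constant sign, so its
  vanishing integral makes the window null. The case a = r is included because the window is open on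
  the left.\<close>

lemma cdf_eigenvector_const:
  assumes u: "(u, \<lambda>x. a * u x) \<in> spectral_integral M E (\<lambda>t. t)" and rs: "r \<le> s"
    and a: "a \<le> r \<or> s < a"
  shows "cdf u r = cdf u s"
proof -
  let ?\<mu> = "spectral_measure M E u"
  have L: "u \<in> L2 M" and int2: "integrable ?\<mu> (\<lambda>t. t\<^sup>2)"
    using u by (auto simp: spectral_integral_def spectral_dom_def)
  interpret \<mu>: finite_measure ?\<mu> by (rule finite_spectral_measure[OF L])
  have int: "integrable ?\<mu> (\<lambda>t. c * ((t - a) * indicator {r<..s} t))" for c
  proof (rule \<mu>.integrable_const_bound)
    show "AE t in ?\<mu>. norm (c * ((t - a) * indicator {r<..s} t)) \<le> \<bar>c\<bar> * (\<bar>r\<bar> + \<bar>s\<bar> + \<bar>a\<bar>)"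
      by (intro always_eventually allI) (auto simp: abs_mult indicator_def intro!: mult_left_mono)
  qed auto
  define c :: real where "c = (if a \<le> r then 1 else - 1)"
  have "(LINT t|?\<mu>. c * ((t - a) * indicator {r<..s} t)) = 0"
    using eigenvector_integral_zero[OF u rs] by simp
  moreover have "AE t in ?\<mu>. 0 \<le> c * ((t - a) * indicator {r<..s} t)"
    using a by (intro always_eventually) (auto simp: c_def indicator_def)
  ultimately have "AE t in ?\<mu>. c * ((t - a) * indicator {r<..s} t) = 0"
    using integral_nonneg_eq_0_iff_AE[OF int] by blast
  then have "AE t in ?\<mu>. t \<notin> {r<..s}"
    by eventually_elim (use a in \<open>auto simp: c_def indicator_def split: if_splits\<close>)
  then have "measure ?\<mu> {r<..s} = 0"
    by (subst (asm) AE_iff_measurable[OF _ refl]) (auto simp: measure_def greaterThanAtMost_def greaterThan_def atMost_def Int_def)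
  then show ?thesis using measure_spectral_measure_Ioc[OF L rs] by simp
qed

text \<open>The distribution function of an eigenvector is constant on either side of a, so its
  limits at plus and minus infinity determine it. Its extreme values, the full squared norm and 0,
  force \<open>proj t u\<close> to be u and 0 respectively.\<close>

lemma proj_eigenvector:
  assumes u: "(u, \<lambda>x. a * u x) \<in> spectral_integral M E (\<lambda>t. t)"
  shows "AE x in M. proj t u x = (if a \<le> t then 1 else 0) * u x"
proof -
  have L: "u \<in> L2 M" using u by (auto simp: spectral_integral_def spectral_dom_def)
  show ?thesis
  proof (cases "a \<le> t")
    case True
    have "((\<lambda>_::real. cdf u t) \<longlongrightarrow> l2_inner M u u) at_top"
    proof (rule Lim_transform_eventually[OF cdf_at_top[OF L]])
      show "\<forall>\<^sub>F s in at_top. cdf u s = cdf u t"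
        using eventually_ge_at_top[of t]
        by eventually_elim (use cdf_eigenvector_const[OF u] True in force)
    qed
    then have "cdf u t = l2_inner M u u" by (simp add: tendsto_const_iff)
    then have "AE x in M. proj t u x - u x = 0"
      using norm_proj_diff_self[OF L, of t] L
      by (simp add: l2_inner_self_eq_0_iff L2_diff proj_L2)
    then show ?thesis using True by simp
  next
    case False
    have "((\<lambda>_::real. cdf u t) \<longlongrightarrow> 0) at_bot"
    proof (rule Lim_transform_eventually[OF cdf_at_bot[OF L]])
      show "\<forall>\<^sub>F s in at_bot. cdf u s = cdf u t"
        using eventually_le_at_bot[of t]
        by eventually_elim (use cdf_eigenvector_const[OF u] False in force)
    qed
    then have "cdf u t = 0" by (simp add: tendsto_const_iff)
    then show ?thesis
      using inner_proj_proj_self[OF L, of t t] L False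
      by (simp add: l2_inner_self_eq_0_iff proj_L2)
  qed
qed

end

section \<open>Functional calculus of diagonal operators\<close>

context l2_basis
begin

text \<open>The discrete measure with mass (coef f i)^2 at a i, written as a push-forward so that
  the masses of indices with equal a i add up.\<close>

theorem spectral_measure_spec_proj:
  assumes f: "f \<in> L2 M"
  shows "spectral_measure M (spec_proj a) f =
    distr (density (count_space UNIV) (\<lambda>i. ennreal ((coef f i)\<^sup>2))) borel a"
proof -
  interpret resolution M "spec_proj a" by standard (rule resolution_of_identity_spec_proj)
  note sm = Parseval_square[OF f, THEN sums_summable]
  have sm': "summable (\<lambda>i. (coef f i)\<^sup>2 * indicator A (a i))" for A
    by (rule summable_comparison_test'[OF sm, of 0]) (auto simp: indicator_def)
  have cdf: "cdf f t = (\<Sum>i. (coef f i)\<^sup>2 * indicator {..t} (a i))" for t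
    using Parseval[OF spec_proj_apply_L2[OF f] f, of a t, THEN sums_unique]
    by (auto simp: cdf_def coef_spec_proj_apply f power2_eq_square indicator_def intro!: arg_cong[where f=suminf])
  show ?thesis
  proof (rule spectral_measure_eqI[OF f])
    fix p q :: real assume "p \<le> q"
    have "cdf f q - cdf f p = (\<Sum>i. (coef f i)\<^sup>2 * indicator {..q} (a i) - (coef f i)\<^sup>2 * indicator {..p} (a i))"
      unfolding cdf by (rule suminf_diff[OF sm' sm'])
    also have "\<dots> = (\<Sum>i. (coef f i)\<^sup>2 * indicator {p<..q} (a i))"
      using \<open>p \<le> q\<close> by (intro suminf_cong) (auto simp: indicator_def)
    finally have eq: "cdf f q - cdf f p = (\<Sum>i. (coef f i)\<^sup>2 * indicator {p<..q} (a i))" .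
    have "emeasure (distr (density (count_space UNIV) (\<lambda>i. ennreal ((coef f i)\<^sup>2))) borel a) {p<..q} =
        (\<integral>\<^sup>+i. ennreal ((coef f i)\<^sup>2 * indicator {p<..q} (a i)) \<partial>count_space UNIV)"
      by (subst emeasure_distr) (auto simp: emeasure_density indicator_def intro!: nn_integral_cong)
    also have "\<dots> = ennreal (cdf f q - cdf f p)"
      unfolding eq nn_integral_count_space_nat using sm' by (intro suminf_ennreal2) auto
    finally show "emeasure (distr (density (count_space UNIV) (\<lambda>i. ennreal ((coef f i)\<^sup>2))) borel a) {p<..q} =
        ennreal (cdf f q - cdf f p)" .
  qed simp
qed

lemma spectral_measure_spec_proj_integral:
  assumes f: "f \<in> L2 M" and [measurable]: "\<phi> \<in> borel_measurable borel"
  shows "integrable (spectral_measure M (spec_proj a) f) \<phi> \<longleftrightarrow>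
      summable (\<lambda>i. \<bar>(coef f i)\<^sup>2 * \<phi> (a i)\<bar>)"
    and "integrable (spectral_measure M (spec_proj a) f) \<phi> \<Longrightarrow>
      (LINT t|spectral_measure M (spec_proj a) f. \<phi> t) = (\<Sum>i. (coef f i)\<^sup>2 * \<phi> (a i))"
proof -
  show iff: "integrable (spectral_measure M (spec_proj a) f) \<phi> \<longleftrightarrow>
      summable (\<lambda>i. \<bar>(coef f i)\<^sup>2 * \<phi> (a i)\<bar>)"
    unfolding spectral_measure_spec_proj[OF f]
    by (simp add: integrable_distr_eq integrable_density integrable_count_space_nat_iff)
  assume int: "integrable (spectral_measure M (spec_proj a) f) \<phi>"
  have "(LINT t|spectral_measure M (spec_proj a) f. \<phi> t) =
      (LINT i|count_space UNIV. (coef f i)\<^sup>2 * \<phi> (a i))"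
    unfolding spectral_measure_spec_proj[OF f]
    by (simp add: integral_distr integral_density)
  also have "\<dots> = (\<Sum>i. (coef f i)\<^sup>2 * \<phi> (a i))"
    using int unfolding iff by (intro integral_count_space_nat) (simp add: integrable_count_space_nat_iff)
  finally show "(LINT t|spectral_measure M (spec_proj a) f. \<phi> t) = (\<Sum>i. (coef f i)\<^sup>2 * \<phi> (a i))" .
qed

theorem spectral_integral_spec_proj:
  assumes [measurable]: "\<phi> \<in> borel_measurable borel"
  shows "spectral_integral M (spec_proj a) \<phi> = diag (\<lambda>i. \<phi> (a i))"
proof -
  have dom: "f \<in> spectral_dom M (spec_proj a) \<phi> \<longleftrightarrow>
      f \<in> L2 M \<and> summable (\<lambda>i. (\<phi> (a i) * coef f i)\<^sup>2)" for f
    unfolding spectral_dom_def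
    by (auto simp: spectral_measure_spec_proj_integral(1) power_mult_distrib mult.commute)
  \<comment> \<open>Integrability of \<phi> itself, which makes the integrals in the definition
    genuine, follows from that of its square by |\<phi>| \<le> 1 + \<phi>^2 and finiteness of the
    measure.\<close>
  have sum: "summable (\<lambda>i. \<bar>(coef f i)\<^sup>2 * \<phi> (a i)\<bar>)" if "f \<in> spectral_dom M (spec_proj a) \<phi>" for f
  proof (rule summable_comparison_test'[where N=0])
    show "summable (\<lambda>i. (coef f i)\<^sup>2 + (\<phi> (a i) * coef f i)\<^sup>2)"
      using that Parseval_square[of f] unfolding dom by (intro summable_add) (auto simp: sums_iff)
    fix i
    have "\<bar>\<phi> (a i)\<bar> \<le> 1 + (\<phi> (a i))\<^sup>2"
    proof -
      have "0 \<le> (\<bar>\<phi> (a i)\<bar> - 1)\<^sup>2" by simp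
      then show ?thesis unfolding power2_diff by simp
    qed
    then have "(coef f i)\<^sup>2 * \<bar>\<phi> (a i)\<bar> \<le> (coef f i)\<^sup>2 * (1 + (\<phi> (a i))\<^sup>2)"
      by (intro mult_left_mono) auto
    then show "norm \<bar>(coef f i)\<^sup>2 * \<phi> (a i)\<bar> \<le> (coef f i)\<^sup>2 + (\<phi> (a i) * coef f i)\<^sup>2"
      by (simp add: abs_mult power_mult_distrib algebra_simps)
  qed
  have polar: "((LINT t|spectral_measure M (spec_proj a) (\<lambda>x. f x + h x). \<phi> t) -
              (LINT t|spectral_measure M (spec_proj a) (\<lambda>x. f x - h x). \<phi> t)) / 4 =
      (\<Sum>i. \<phi> (a i) * coef f i * coef h i)"
    if fd: "f \<in> spectral_dom M (spec_proj a) \<phi>" and hd: "h \<in> spectral_dom M (spec_proj a) \<phi>" for f h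
  proof -
    have f: "f \<in> L2 M" and h: "h \<in> L2 M" using fd hd by (auto simp: dom)
    have sq: "summable (\<lambda>i. (\<phi> (a i) * (coef f i + c * coef h i))\<^sup>2)" for c
    proof (rule summable_comparison_test'[where N=0])
      show "summable (\<lambda>i. 2 * (\<phi> (a i) * coef f i)\<^sup>2 + 2 * c\<^sup>2 * (\<phi> (a i) * coef h i)\<^sup>2)"
        using fd hd unfolding dom by (intro summable_add summable_mult) auto
      fix i
      have "(u + c * v)\<^sup>2 \<le> 2 * u\<^sup>2 + 2 * c\<^sup>2 * v\<^sup>2" for u v :: real
      proof -
        have "0 \<le> (u - c * v)\<^sup>2" by simp
        then show ?thesis by (simp add: power2_eq_square algebra_simps)
      qed
      from this[of "\<phi> (a i) * coef f i" "\<phi> (a i) * coef h i"]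
      show "norm ((\<phi> (a i) * (coef f i + c * coef h i))\<^sup>2)
          \<le> 2 * (\<phi> (a i) * coef f i)\<^sup>2 + 2 * c\<^sup>2 * (\<phi> (a i) * coef h i)\<^sup>2"
        by (simp add: algebra_simps)
    qed
    have p: "(\<lambda>x. f x + h x) \<in> spectral_dom M (spec_proj a) \<phi>"
      using f h sq[of 1] unfolding dom by (simp add: L2_add coef_add)
    have m: "(\<lambda>x. f x - h x) \<in> spectral_dom M (spec_proj a) \<phi>"
      using f h sq[of "-1"] unfolding dom by (simp add: L2_diff coef_diff)
    have I: "(LINT t|spectral_measure M (spec_proj a) k. \<phi> t) = (\<Sum>i. (coef k i)\<^sup>2 * \<phi> (a i))"
      if "k \<in> spectral_dom M (spec_proj a) \<phi>" for k
      using that sum[OF that] spectral_measure_spec_proj_integral[of k \<phi> a] by (simp add: dom)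
    note sp = summable_rabs_cancel[OF sum[OF p]] and sm = summable_rabs_cancel[OF sum[OF m]]
    note suminf_diff[OF sp sm] suminf_divide[OF summable_diff[OF sp sm], of 4]
    moreover have "((coef (\<lambda>x. f x + h x) i)\<^sup>2 * \<phi> (a i) - (coef (\<lambda>x. f x - h x) i)\<^sup>2 * \<phi> (a i)) / 4
        = \<phi> (a i) * coef f i * coef h i" for i
      using f h by (simp add: coef_add coef_diff power2_eq_square algebra_simps)
    ultimately show ?thesis unfolding I[OF p] I[OF m] by simp
  qed
  \<comment> \<open>A basis vector has at most one nonzero coefficient, so it lies in the domain for
    every \<phi>; as a test vector it reads off one coordinate of g.\<close>
  have basis_dom: "e i \<in> spectral_dom M (spec_proj a) \<phi>" for i
    unfolding dom
  proof
    show "summable (\<lambda>j. (\<phi> (a j) * coef (e i) j)\<^sup>2)"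
      by (rule summable_finite[of "{i}"]) (auto simp: coef_basis)
  qed (rule basis_L2)
  show ?thesis
  proof (rule set_eqI, clarify, rule iffI)
    fix f g assume fg: "(f, g) \<in> spectral_integral M (spec_proj a) \<phi>"
    then have fd: "f \<in> spectral_dom M (spec_proj a) \<phi>" and g: "g \<in> L2 M"
      by (auto simp: spectral_integral_def)
    have "coef g i = \<phi> (a i) * coef f i" for i
    proof -
      have "coef g i = (\<Sum>j. \<phi> (a j) * coef f j * coef (e i) j)"
        using fg basis_dom[of i] polar[OF fd basis_dom[of i]]
        unfolding coef_def[of g] by (auto simp: spectral_integral_def)
      also have "\<dots> = (\<Sum>j\<in>{i}. \<phi> (a j) * coef f j * coef (e i) j)"
        by (rule suminf_finite) (auto simp: coef_basis)
      finally show ?thesis by (simp add: mult.assoc del: mult_cancel_left1)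
    qed
    then show "(f, g) \<in> diag (\<lambda>i. \<phi> (a i))" using fd g by (simp add: diag_def dom)
  next
    fix f g assume fg: "(f, g) \<in> diag (\<lambda>i. \<phi> (a i))"
    note d = diagD[OF fg]
    have fd: "f \<in> spectral_dom M (spec_proj a) \<phi>"
      using d Parseval_square[OF d(2), THEN sums_summable] by (simp add: dom)
    have "l2_inner M g h = (\<Sum>i. \<phi> (a i) * coef f i * coef h i)" if "h \<in> L2 M" for h
      using Parseval[OF d(2) that, THEN sums_unique] by (simp add: d(3))
    then show "(f, g) \<in> spectral_integral M (spec_proj a) \<phi>"
      using fd d(2) polar[OF fd] unfolding spectral_integral_def by (simp add: dom)
  qed
qed

text \<open>A competing resolution acts on basis vectors as \<open>proj_eigenvector\<close> forces
  it to, and self-adjointness moves \<open>F t\<close> from f onto them in each coefficient.\<close>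

theorem spectral_resolution_diag: "spectral_resolution M (diag a) = spec_proj a"
  unfolding spectral_resolution_def
proof (rule the_equality)
  show "resolution_of_identity M (spec_proj a) \<and> diag a = spectral_integral M (spec_proj a) (\<lambda>t. t)"
    using resolution_of_identity_spec_proj spectral_integral_spec_proj[of "\<lambda>t. t" a] by simp
next
  fix F assume F: "resolution_of_identity M F \<and> diag a = spectral_integral M F (\<lambda>t. t)"
  interpret resolution M F by standard (use F in blast)
  show "F = spec_proj a"
  proof
    fix t
    have "(e i, \<lambda>x. a i * e i x) \<in> diag a" for i
      unfolding diag_def
    proof (clarify, intro conjI allI basis_L2 L2_cmult)
      fix j
      show "coef (\<lambda>x. a i * e i x) j = a j * coef (e i) j"
        unfolding coef_def l2_inner_cmult_left using basis_ortho[of i j] by (cases "i = j") auto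
    qed
    then have eig: "AE x in M. proj t (e i) x = (if a i \<le> t then 1 else 0) * e i x" for i
      using F by (intro proj_eigenvector) auto
    have sub: "(f, g) \<in> spec_proj a t" if fg: "(f, g) \<in> F t" for f g
    proof -
      have L: "f \<in> L2 M" "g \<in> L2 M" using graph_L2[OF fg] by auto
      have "coef g i = (if a i \<le> t then 1 else 0) * coef f i" for i
      proof -
        have "coef g i = l2_inner M (proj t (e i)) f"
          unfolding coef_def graph_inner[OF fg basis_L2] by (rule l2_inner_commute)
        also have "\<dots> = l2_inner M (\<lambda>x. (if a i \<le> t then 1 else 0) * e i x) f"
          using eig L by (intro l2_inner_cong_AE proj_L2 L2_cmult basis_L2) auto
        finally show ?thesis
          unfolding l2_inner_cmult_left by (simp add: coef_def l2_inner_commute)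
      qed
      then show ?thesis using L by (simp add: spec_proj_def diag_def)
    qed
    \<comment> \<open>The converse inclusion comes from totality: both relations are defined on all
      of L^2 and single-valued up to null sets.\<close>
    show "F t = spec_proj a t"
    proof (rule set_eqI, clarify, rule iffI)
      fix f g assume fg: "(f, g) \<in> spec_proj a t"
      then have L: "f \<in> L2 M" "g \<in> L2 M" by (auto simp: spec_proj_def diag_def)
      have "(f, proj t f) \<in> spec_proj a t" using sub proj_graph L by blast
      then have "AE x in M. g x = proj t f x"
        using fg L AE_eq_iff_coef[OF L(2) proj_L2[OF L(1)]] by (auto simp: spec_proj_def diag_def)
      then show "(f, g) \<in> F t" using graph_cong[OF proj_graph[OF L(1), of t], of f g] L by simp
    qed (rule sub)
  qed
qed

corollary functional_calculus_diag:
  "\<phi> \<in> borel_measurable borel \<Longrightarrow> functional_calculus M \<phi> (diag a) = diag (\<lambda>i. \<phi> (a i))"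
  by (simp add: functional_calculus_def spectral_resolution_diag spectral_integral_spec_proj)

end

section \<open>Averaging over balls of an ultra-metric space\<close>

lemma L2_indicator: "A \<in> sets M \<Longrightarrow> emeasure M A < \<infinity> \<Longrightarrow> indicator A \<in> L2 M"
  by (simp add: L2_def power2_eq_square flip: indicator_inter_arith)

text \<open>Written as an inner product with the indicator, so that linearity and Cauchy-Schwarz in
  L^2 apply directly.\<close>

definition integ :: "'a measure \<Rightarrow> ('a \<Rightarrow> real) \<Rightarrow> 'a set \<Rightarrow> real" where
  "integ M f A = l2_inner M f (indicator A)"

lemma integ_altdef: "integ M f A = (LINT x:A|M. f x)"
  by (simp add: integ_def l2_inner_def set_lebesgue_integral_def mult.commute)

lemma integ_disjoint_Union:
  assumes f: "f \<in> L2 M" and fin: "finite F" and dis: "disjoint F"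
    and F: "\<And>B. B \<in> F \<Longrightarrow> B \<in> sets M" "\<And>B. B \<in> F \<Longrightarrow> emeasure M B < \<infinity>"
  shows "integ M f (\<Union>F) = (\<Sum>B\<in>F. integ M f B)"
proof -
  have "indicator (\<Union>F) x = (\<Sum>B\<in>F. indicator B x :: real)" for x
    using indicator_UN_disjoint[of F "\<lambda>B. B" x] fin dis
    by (auto simp: disjoint_family_on_def disjoint_def)
  then have "integ M f (\<Union>F) = l2_inner M (\<lambda>x. \<Sum>B\<in>F. indicator B x) f"
    unfolding integ_def by (subst l2_inner_commute) (simp add: l2_inner_def)
  also have "\<dots> = (\<Sum>B\<in>F. integ M f B)"
    using f F by (subst l2_inner_sum_left) (auto intro: L2_indicator simp: integ_def l2_inner_commute)
  finally show ?thesis .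
qed

lemma integ_incseq_lim:
  assumes h: "h \<in> L2 M" and A: "\<And>i. A i \<in> sets M" "incseq A" "emeasure M (\<Union>i. A i) < \<infinity>"
  shows "(\<lambda>i. integ M h (A i)) \<longlonglongrightarrow> integ M h (\<Union>i. A i)"
  unfolding integ_def l2_inner_def
proof (rule integral_dominated_convergence)
  have [measurable]: "h \<in> borel_measurable M" using h by (rule L2_measurable)
  have U [measurable]: "(\<Union>i. A i) \<in> sets M" using A by auto
  note A(1) [measurable]
  show "integrable M (\<lambda>x. \<bar>h x * indicator (\<Union>i. A i) x\<bar>)"
    using L2_integrable_mult[OF h L2_indicator[OF U A(3)]] by simp
  show "(\<lambda>x. h x * indicator (\<Union>i. A i) x) \<in> borel_measurable M" by measurable
  show "(\<lambda>x. h x * indicator (A i) x) \<in> borel_measurable M" for i by measurable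
  show "AE x in M. (\<lambda>i. h x * indicator (A i) x) \<longlonglongrightarrow> h x * indicator (\<Union>i. A i) x"
    using A(2) by (intro always_eventually allI tendsto_mult tendsto_const LIMSEQ_indicator_incseq)
  show "AE x in M. norm (h x * indicator (A i) x) \<le> \<bar>h x * indicator (\<Union>i. A i) x\<bar>" for i
    by (intro always_eventually allI) (auto simp: indicator_def)
qed

text \<open>Separability enters as an explicit dense sequence, because its order drives the
  construction of the Haar system.\<close>

locale ultrametric_measure =
  fixes M :: "'a::metric_space measure" and X :: "nat \<Rightarrow> 'a"
  assumes ultra: "dist x z \<le> max (dist x y) (dist y (z::'a))"
    and dense: "0 < r \<Longrightarrow> \<exists>n. dist (X n) x < r"
    and compact_cball: "compact (cball (x::'a) r)"
    and sets_M [measurable_cong, simp]: "sets M = sets borel"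
    and finite_compact: "compact K \<Longrightarrow> emeasure M K < \<infinity>"
    and support: "open U \<Longrightarrow> U \<noteq> {} \<Longrightarrow> emeasure M U > 0"
begin

lemma space_M [simp]: "space M = UNIV"
  using sets_eq_imp_space_eq[OF sets_M] by simp

section \<open>Geometry of ultra-metric balls\<close>

lemma dist_le: "dist x y \<le> r \<Longrightarrow> dist y z \<le> r \<Longrightarrow> dist x (z::'a) \<le> r"
  using ultra[of x z y] by simp

lemma dist_less: "dist x y < r \<Longrightarrow> dist y z < r \<Longrightarrow> dist x (z::'a) < r"
  using ultra[of x z y] by simp

lemma cball_eq: "dist x y \<le> r \<Longrightarrow> cball x r = cball (y::'a) r"
  using dist_le[of x y r] dist_le[of y x r] by (auto simp: dist_commute)

lemma ball_eq: "dist x y < r \<Longrightarrow> ball x r = ball (y::'a) r"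
  using dist_less[of x y r] dist_less[of y x r] by (auto simp: dist_commute)

lemma open_cball:
  assumes "0 < r" shows "open (cball (x::'a) r)"
  unfolding open_contains_ball
proof
  fix y assume "y \<in> cball x r"
  then have "cball x r = cball y r" by (intro cball_eq) simp
  then show "\<exists>e>0. ball y e \<subseteq> cball x r" using assms ball_subset_cball by metis
qed

text \<open>For r > 0 these are the clopen unions of closed balls of radius r, the sets over which
  averaging at radius r preserves integrals.\<close>

definition saturated :: "real \<Rightarrow> 'a set \<Rightarrow> bool" where
  "saturated r A \<longleftrightarrow> (\<forall>x\<in>A. cball x r \<subseteq> A)"

lemma saturatedD: "saturated r A \<Longrightarrow> dist x y \<le> r \<Longrightarrow> x \<in> A \<Longrightarrow> y \<in> A"
  unfolding saturated_def using mem_cball by blast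

lemma open_saturated:
  assumes "saturated r A" "0 < r"
  shows "open A"
proof -
  have "A = (\<Union>x\<in>A. cball x r)" using assms by (auto simp: saturated_def)
  then show ?thesis using open_cball[OF assms(2)] by (metis open_UN)
qed

lemma closed_saturated:
  assumes "saturated r A" "0 < r"
  shows "closed A"
proof -
  have "saturated r (- A)"
    using assms(1) unfolding saturated_def by (force simp: dist_commute)
  then show ?thesis using open_saturated[OF _ assms(2)] by (simp add: closed_def)
qed

lemma saturated_Int: "saturated r A \<Longrightarrow> saturated r B \<Longrightarrow> saturated r (A \<inter> B)"
  by (auto simp: saturated_def)

lemma saturated_UN: "(\<And>i. i \<in> I \<Longrightarrow> saturated r (A i)) \<Longrightarrow> saturated r (\<Union>i\<in>I. A i)"
  by (fastforce simp: saturated_def)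

lemma saturated_UNIV: "saturated r UNIV"
  by (simp add: saturated_def)

lemma saturated_cball: "r \<le> s \<Longrightarrow> saturated r (cball x s)"
  using dist_le by (auto simp: saturated_def)

lemma saturated_ball: "r < s \<Longrightarrow> saturated r (ball x s)"
  using dist_less by (auto simp: saturated_def)

lemma closed_ball: "closed (ball (x::'a) r)"
proof (cases "0 < r")
  case True
  then show ?thesis using closed_saturated[OF saturated_ball[of "r/2" r x]] by simp
qed (simp add: not_less ball_empty)

lemma compact_ball: "compact (ball (x::'a) r)"
  using closed_Int_compact[OF closed_ball[of x r] compact_cball[of x r]] ball_subset_cball[of x r]
  by (simp add: Int_absorb2)

text \<open>The part of \<open>cball x (2 * r)\<close> outside \<open>cball x r\<close> is compact,
  so the distance to x attains its minimum there, and this minimum exceeds r: there are no points at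
  distances just above r.\<close>

lemma cball_isolated_right:
  assumes r: "0 < r"
  shows "\<exists>s>r. cball (x::'a) s = cball x r"
proof -
  let ?K = "cball x (2 * r) - cball x r"
  have K: "compact ?K"
    by (intro compact_diff compact_cball open_cball r)
  show ?thesis
  proof (cases "?K = {}")
    case True
    then show ?thesis using r by (intro exI[of _ "2 * r"]) auto
  next
    case False
    then obtain y where y: "y \<in> ?K" and min: "\<And>z. z \<in> ?K \<Longrightarrow> dist x y \<le> dist x z"
      using continuous_attains_inf[OF K False continuous_on_dist[OF continuous_on_const continuous_on_id], of x]
      by blast
    have "cball x ((r + dist x y) / 2) = cball x r"
    proof
      show "cball x ((r + dist x y) / 2) \<subseteq> cball x r"
      proof
        fix z assume z: "z \<in> cball x ((r + dist x y) / 2)"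
        show "z \<in> cball x r"
        proof (rule ccontr)
          assume nz: "z \<notin> cball x r"
          then have "z \<in> ?K" using y z r by auto
          from min[OF this] show False using y z by auto
        qed
      qed
    qed (use y in auto)
    then show ?thesis using y by (intro exI[of _ "(r + dist x y) / 2"]) auto
  qed
qed

text \<open>Open balls are compact here, so the distance to x attains a maximum below r. Taking the
  larger of it and r / 2 keeps the new radius positive when the ball is the single point x.\<close>

lemma cball_isolated_left:
  assumes r: "0 < r"
  shows "\<exists>s>0. s < r \<and> cball (x::'a) s = ball x r"
proof -
  have "ball x r \<noteq> {}" using r by auto
  then obtain y where y: "y \<in> ball x r" and max: "\<And>z. z \<in> ball x r \<Longrightarrow> dist x z \<le> dist x y"
    using continuous_attains_sup[OF compact_ball _ continuous_on_dist[OF continuous_on_const continuous_on_id], of x r x]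
    by blast
  have "cball x (max (dist x y) (r / 2)) = ball x r"
    using y r max by (auto simp: le_max_iff_disj)
  then show ?thesis using y r by (intro exI[of _ "max (dist x y) (r / 2)"]) auto
qed

lemma emeasure_cball: "emeasure M (cball x r) < \<infinity>"
  by (intro finite_compact compact_cball)

lemma emeasure_ball: "emeasure M (ball x r) < \<infinity>"
  by (intro finite_compact compact_ball)

lemma measure_pos:
  assumes "open U" "U \<noteq> {}" "emeasure M U < \<infinity>"
  shows "0 < measure M U"
  using support[OF assms(1,2)] assms(3) by (simp add: measure_def enn2real_positive_iff)

lemma measure_cball_pos: "0 < r \<Longrightarrow> 0 < measure M (cball x r)"
  by (intro measure_pos open_cball emeasure_cball) auto

lemma measure_ball_pos: "0 < r \<Longrightarrow> 0 < measure M (ball x r)"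
  by (intro measure_pos emeasure_ball) auto

lemma UN_cball_nat: "(\<Union>n::nat. cball x (real n)) = UNIV"
proof (rule UNIV_eq_I[symmetric])
  fix y
  show "y \<in> (\<Union>n::nat. cball x (real n))"
    using real_arch_simple[of "dist x y"] by auto
qed

lemma sigma_finite: "sigma_finite_measure M"
proof
  show "\<exists>A. countable A \<and> A \<subseteq> sets M \<and> \<Union>A = space M \<and> (\<forall>a\<in>A. emeasure M a \<noteq> \<infinity>)"
    using UN_cball_nat[of "X 0"] emeasure_cball[of "X 0"]
    by (intro exI[of _ "range (\<lambda>n::nat. cball (X 0) (real n))"]) (auto simp: less_top)
qed

lemma compact_saturated_partition:
  assumes K: "compact K" "saturated r K" and r: "0 < r"
  obtains F where "finite F" "disjoint F" "\<Union>F = K" "\<And>B. B \<in> F \<Longrightarrow> \<exists>x\<in>K. B = cball x r"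
proof -
  have "K \<subseteq> (\<Union>x\<in>K. cball x r)" using r by auto
  then obtain T where T: "T \<subseteq> K" "finite T" "K \<subseteq> (\<Union>x\<in>T. cball x r)"
    using compactE_image[OF K(1), of K "\<lambda>x. cball x r"] open_cball[OF r] by metis
  show ?thesis
  proof (rule that[of "(\<lambda>x. cball x r) ` T"])
    show "\<Union> ((\<lambda>x. cball x r) ` T) = K"
      using T K(2) by (auto simp: saturated_def)
    show "disjoint ((\<lambda>x. cball x r) ` T)"
    proof (rule disjointI, rule ccontr)
      fix A B assume "A \<in> (\<lambda>x. cball x r) ` T" "B \<in> (\<lambda>x. cball x r) ` T" "A \<noteq> B" "A \<inter> B \<noteq> {}"
      then obtain x y z where *: "A = cball x r" "B = cball y r" "z \<in> A" "z \<in> B" by blast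
      then have "A = cball z r" "B = cball z r"
        using cball_eq[of x z r] cball_eq[of y z r] by auto
      then show False using \<open>A \<noteq> B\<close> by simp
    qed
  qed (use T in auto)
qed

section \<open>Averaging operators\<close>

lemma ball_average_integ: "ball_average M r f x = integ M f (cball x r) / measure M (cball x r)"
  by (simp add: ball_average_def integ_altdef)

lemma ball_average_cong: "dist x y \<le> r \<Longrightarrow> ball_average M r f x = ball_average M r f y"
  using cball_eq[of x y r] by (simp add: ball_average_integ)

lemma measurable_locally_constant:
  fixes g :: "'a \<Rightarrow> real"
  assumes r: "0 < r" and g: "\<And>x y. dist x y \<le> r \<Longrightarrow> g x = g y"
  shows "g \<in> borel_measurable M"
proof -
  have "continuous_on UNIV g"
    unfolding continuous_on_iff
  proof (intro ballI allI impI)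
    fix x e :: real and y :: 'a assume "0 < e"
    then show "\<exists>d>0. \<forall>x'\<in>UNIV. dist x' y < d \<longrightarrow> dist (g x') (g y) < e"
      using g r by (intro exI[of _ r]) (metis dist_self less_imp_le)
  qed
  then show ?thesis by (simp add: borel_measurable_continuous_onI cong: measurable_cong_sets)
qed

lemma ball_average_measurable [measurable]:
  "0 < r \<Longrightarrow> ball_average M r f \<in> borel_measurable M"
  by (rule measurable_locally_constant, assumption, rule ball_average_cong)

text \<open>On a compact saturated set the average is a conditional expectation for a finite
  partition into balls. As g is constant on the blocks, <g, g> = <g, f>, and Cauchy-Schwarz gives
  the contraction.\<close>

lemma ball_average_compact:
  assumes f: "f \<in> L2 M" and r: "0 < r" and K: "compact K" "saturated r K"
  defines "g \<equiv> \<lambda>x. ball_average M r f x * indicator K x"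
  shows "g \<in> L2 M" "l2_inner M g g \<le> l2_inner M f f" "integ M (ball_average M r f) K = integ M f K"
proof -
  obtain F where F: "finite F" "disjoint F" "\<Union>F = K" "\<And>B. B \<in> F \<Longrightarrow> \<exists>x\<in>K. B = cball x r"
    using compact_saturated_partition[OF K r] by blast
  have FM: "B \<in> sets M" "emeasure M B < \<infinity>" "0 < measure M B" if "B \<in> F" for B
    using F(4)[OF that] emeasure_cball measure_cball_pos[OF r] by auto
  have FL: "indicator B \<in> L2 M" if "B \<in> F" for B using FM[OF that] by (intro L2_indicator)
  define c where "c B = integ M f B / measure M B" for B
  have c: "c B * measure M B = integ M f B" if "B \<in> F" for B using FM[OF that] by (simp add: c_def)
  have avg: "ball_average M r f x = c B" if "B \<in> F" "x \<in> B" for B x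
  proof -
    obtain y where "B = cball y r" using F(4)[OF \<open>B \<in> F\<close>] by blast
    then have "cball x r = B" using cball_eq[of y x r] that by simp
    then show ?thesis by (simp add: ball_average_integ c_def)
  qed
  have g: "g = (\<lambda>x. \<Sum>B\<in>F. c B * indicator B x)"
  proof
    fix x
    show "g x = (\<Sum>B\<in>F. c B * indicator B x)"
    proof (cases "x \<in> K")
      case False
      then have "x \<notin> B" if "B \<in> F" for B using F(3) that by blast
      then show ?thesis using False by (simp add: g_def)
    next
      case True
      then obtain B where B: "B \<in> F" "x \<in> B" using F(3) by blast
      have "x \<notin> B'" if "B' \<in> F - {B}" for B'
        using F(2) B that unfolding disjoint_def by blast
      then have "(\<Sum>B\<in>F. c B * indicator B x) = c B"
        using B F(1) by (subst sum.remove[of _ B]) auto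
      then show ?thesis using avg[OF B] True by (simp add: g_def)
    qed
  qed
  show gL: "g \<in> L2 M" unfolding g by (intro L2_sum L2_cmult FL)
  have gh: "l2_inner M g h = (\<Sum>B\<in>F. c B * integ M h B)" if "h \<in> L2 M" for h
    unfolding g by (subst l2_inner_sum_left)
      (use that in \<open>auto intro!: L2_cmult FL sum.cong simp: l2_inner_cmult_left integ_def l2_inner_commute\<close>)
  have gB: "integ M g B = integ M f B" if "B \<in> F" for B
  proof -
    have "integ M g B = (LINT x|M. c B * indicator B x)"
      unfolding integ_def l2_inner_def
      by (intro Bochner_Integration.integral_cong refl)
        (use that F(3) in \<open>auto simp: g_def indicator_def avg\<close>)
    then show ?thesis using c[OF that] FM[OF that] by simp
  qed
  have "l2_inner M g g = l2_inner M g f"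
    unfolding gh[OF gL] gh[OF f] by (intro sum.cong) (auto simp: gB)
  also have "\<dots> \<le> l2_norm M g * l2_norm M f"
    using l2_Cauchy_Schwarz[OF gL f] by simp
  finally have "l2_norm M g * l2_norm M g \<le> l2_norm M g * l2_norm M f"
    by (simp flip: power2_eq_square)
  then have "l2_norm M g \<le> l2_norm M f"
    by (cases "l2_norm M g = 0") (simp_all add: mult_le_cancel_left less_le)
  then have "(l2_norm M g)\<^sup>2 \<le> (l2_norm M f)\<^sup>2" by (intro power_mono) auto
  then show "l2_inner M g g \<le> l2_inner M f f" by simp
  have "integ M (ball_average M r f) K = integ M g K"
    unfolding integ_def l2_inner_def
    by (intro Bochner_Integration.integral_cong) (auto simp: g_def indicator_def)
  also have "\<dots> = (\<Sum>B\<in>F. integ M g B)"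
    unfolding F(3)[symmetric] using FM by (intro integ_disjoint_Union gL F) auto
  also have "\<dots> = (\<Sum>B\<in>F. integ M f B)"
    by (intro sum.cong) (auto simp: gB)
  also have "\<dots> = integ M f K"
    unfolding F(3)[symmetric] using FM by (intro integ_disjoint_Union[symmetric] f F) auto
  finally show "integ M (ball_average M r f) K = integ M f K" .
qed

lemma ball_average_nn_integral:
  assumes f: "f \<in> L2 M" and r: "0 < r"
  shows "(\<integral>\<^sup>+x. ennreal ((ball_average M r f x)\<^sup>2) \<partial>M) \<le> ennreal (l2_inner M f f)"
proof -
  let ?N = "density M (\<lambda>x. ennreal ((ball_average M r f x)\<^sup>2))"
  \<comment> \<open>Starting at a radius of at least r makes every ball of the exhaustion saturated
    for r.\<close>
  obtain n0 :: nat where n0: "r \<le> real n0" using real_arch_simple by blast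
  define K where "K n = cball (X 0) (real (n + n0))" for n
  have K: "compact (K n)" "saturated r (K n)" for n
    using n0 by (auto simp: K_def compact_cball intro!: saturated_cball)
  have "(\<Union>n. K n) = UNIV"
  proof (rule UNIV_eq_I[symmetric])
    fix y
    obtain n :: nat where "dist (X 0) y \<le> real n" using real_arch_simple by blast
    then have "y \<in> K n" by (simp add: K_def)
    then show "y \<in> (\<Union>n. K n)" by blast
  qed
  moreover have "incseq K" by (auto simp: K_def incseq_def)
  moreover have "range K \<subseteq> sets ?N" using compact_imp_closed[OF K(1)] by auto
  ultimately have "(SUP n. emeasure ?N (K n)) = emeasure ?N UNIV"
    using SUP_emeasure_incseq[of K ?N] by simp
  moreover have "emeasure ?N UNIV = (\<integral>\<^sup>+x. ennreal ((ball_average M r f x)\<^sup>2) \<partial>M)"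
    using r by (subst emeasure_density) auto
  moreover have "emeasure ?N (K n) \<le> ennreal (l2_inner M f f)" for n
  proof -
    let ?g = "\<lambda>x. ball_average M r f x * indicator (K n) x"
    have g: "?g \<in> L2 M" "l2_inner M ?g ?g \<le> l2_inner M f f"
      using ball_average_compact[OF f r K] by auto
    have "emeasure ?N (K n) = (\<integral>\<^sup>+x. ennreal (?g x * ?g x) \<partial>M)"
      using r K(1) by (subst emeasure_density)
        (auto simp: power2_eq_square indicator_def compact_imp_closed intro!: nn_integral_cong)
    also have "\<dots> = ennreal (l2_inner M ?g ?g)"
      unfolding l2_inner_def by (intro nn_integral_eq_integral L2_integrable_mult g) simp
    finally show ?thesis using g(2) by (simp add: ennreal_leI)
  qed
  ultimately show ?thesis by (metis (no_types, lifting) SUP_least)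
qed

lemma ball_average_L2:
  assumes f: "f \<in> L2 M" and r: "0 < r"
  shows "ball_average M r f \<in> L2 M"
proof -
  have "integrable M (\<lambda>x. (ball_average M r f x)\<^sup>2)"
  proof (rule integrableI_nonneg)
    show "(\<integral>\<^sup>+x. ennreal ((ball_average M r f x)\<^sup>2) \<partial>M) < \<infinity>"
      using ball_average_nn_integral[OF f r] by (rule order_le_less_trans) simp
  qed (use r in auto)
  then show ?thesis using r by (simp add: L2_def)
qed

text \<open>A may be unbounded: the whole space occurs when the measure is finite. Its intersections
  with large balls are compact and saturated, and dominated convergence carries the identity over to
  A.\<close>

lemma integ_ball_average:
  assumes f: "f \<in> L2 M" and r: "0 < r" and A: "saturated r A" "emeasure M A < \<infinity>"
  shows "integ M (ball_average M r f) A = integ M f A"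
proof -
  obtain n0 :: nat where n0: "r \<le> real n0" using real_arch_simple by blast
  define K where "K n = A \<inter> cball (X 0) (real (n + n0))" for n
  have K: "compact (K n)" "saturated r (K n)" for n
    using n0 closed_saturated[OF A(1) r]
    by (auto simp: K_def intro!: closed_Int_compact compact_cball saturated_Int A saturated_cball)
  have UK: "(\<Union>n. K n) = A"
  proof
    show "A \<subseteq> (\<Union>n. K n)"
    proof
      fix y assume "y \<in> A"
      obtain n :: nat where "dist (X 0) y \<le> real n" using real_arch_simple by blast
      then have "y \<in> K n" using \<open>y \<in> A\<close> by (simp add: K_def)
      then show "y \<in> (\<Union>n. K n)" by blast
    qed
  qed (auto simp: K_def)
  have lim: "(\<lambda>n. integ M h (K n)) \<longlonglongrightarrow> integ M h A" if "h \<in> L2 M" for h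
    unfolding UK[symmetric]
    using that A(2) compact_imp_closed[OF K(1)]
    by (intro integ_incseq_lim) (auto simp: UK incseq_def, auto simp: K_def)
  have "(\<lambda>n. integ M (ball_average M r f) (K n)) \<longlonglongrightarrow> integ M (ball_average M r f) A"
    by (intro lim ball_average_L2 f r)
  then have "(\<lambda>n. integ M f (K n)) \<longlonglongrightarrow> integ M (ball_average M r f) A"
    by (simp add: ball_average_compact(3)[OF f r K])
  then show ?thesis using lim[OF f] LIMSEQ_unique by blast
qed

end

section \<open>A Haar system\<close>

lemma integ_const:
  assumes "A \<in> sets M" "\<And>x. x \<in> A \<Longrightarrow> h x = c"
  shows "integ M h A = c * measure M A"
proof -
  have "integ M h A = (LINT x|M. c * indicator A x)"
    unfolding integ_def l2_inner_def
    by (intro Bochner_Integration.integral_cong) (use assms(2) in \<open>auto simp: indicator_def\<close>)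
  then show ?thesis using assms(1) sets.sets_into_space[OF assms(1)] by (simp add: Int_absorb1)
qed

context ultrametric_measure
begin

text \<open>A Haar-type system adapted to the dense sequence. The ball \<open>near n\<close> is the one that $x_n$
  opens among its siblings, the open balls of radius \<open>gap n\<close> in the closed ball of that radius;
  \<open>far n\<close> is the union of the siblings already met by $x_0,\dots,x_{n-1}$. Each \<open>wave n\<close> is a
  normalised difference of the two uniform distributions; \<open>wave 0\<close> is the normalised constant when
  $\mu$ is finite. Points that repeat earlier ones give the zero function.\<close>

definition gap :: "nat \<Rightarrow> real" where
  "gap n = Min ((\<lambda>k. dist (X k) (X n)) ` {..<n})"

text \<open>\<open>0 < n\<close> is explicit because \<open>gap 0\<close> is the minimum of an empty
  set.\<close>

definition active :: "nat \<Rightarrow> bool" where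
  "active n \<longleftrightarrow> 0 < n \<and> 0 < gap n"

definition near :: "nat \<Rightarrow> 'a set" where
  "near n = ball (X n) (gap n)"

definition far :: "nat \<Rightarrow> 'a set" where
  "far n = (\<Union>k\<in>{k. k < n \<and> dist (X k) (X n) = gap n}. ball (X k) (gap n))"

text \<open>The L^2 norm of the difference of the two uniform distributions: their supports are
  disjoint, so the squared norms, each the reciprocal of a measure, add up.\<close>

definition wave_scale :: "nat \<Rightarrow> real" where
  "wave_scale n = sqrt (1 / measure M (near n) + 1 / measure M (far n))"

definition wave :: "nat \<Rightarrow> 'a \<Rightarrow> real" where
  "wave n x =
    (if active n then (indicator (near n) x / measure M (near n) - indicator (far n) x / measure M (far n)) / wave_scale n
     else if n = 0 \<and> emeasure M UNIV < \<infinity> then 1 / sqrt (measure M UNIV) else 0)"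

lemma gap_le: "k < n \<Longrightarrow> gap n \<le> dist (X k) (X n)"
  unfolding gap_def by (intro Min_le) auto

lemma gap_attained: "0 < n \<Longrightarrow> \<exists>k<n. dist (X k) (X n) = gap n"
proof -
  assume "0 < n"
  then have "gap n \<in> (\<lambda>k. dist (X k) (X n)) ` {..<n}" unfolding gap_def by (intro Min_in) auto
  then show ?thesis by auto
qed

lemma saturated_near: "r < gap n \<Longrightarrow> saturated r (near n)"
  unfolding near_def by (rule saturated_ball)

lemma saturated_far: "r < gap n \<Longrightarrow> saturated r (far n)"
  unfolding far_def by (intro saturated_UN saturated_ball)

lemma open_near: "open (near n)" and open_far: "open (far n)"
  by (auto simp: near_def far_def)

lemma near_far_cball: "near n \<union> far n \<subseteq> cball (X n) (gap n)"
proof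
  fix x assume "x \<in> near n \<union> far n"
  then show "x \<in> cball (X n) (gap n)"
  proof
    assume "x \<in> far n"
    then obtain k where "dist (X k) (X n) = gap n" "dist (X k) x < gap n" by (auto simp: far_def)
    then show ?thesis using dist_le[of "X n" "X k" "gap n" x] by (simp add: dist_commute)
  qed (auto simp: near_def)
qed

lemma near_far_dist: "x \<in> near n \<union> far n \<Longrightarrow> dist (X n) x \<le> gap n"
  using near_far_cball mem_cball by blast

lemma near_far_disjoint: "near n \<inter> far n = {}"
proof -
  have False if k: "dist (X k) (X n) = gap n" and x: "dist (X k) x < gap n" "dist (X n) x < gap n" for k x
    using dist_less[of "X k" x "gap n" "X n"] k x by (simp add: dist_commute)
  then show ?thesis by (fastforce simp: near_def far_def)
qed

lemma emeasure_near: "emeasure M (near n) < \<infinity>" and emeasure_far: "emeasure M (far n) < \<infinity>"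
proof -
  have "emeasure M (near n) \<le> emeasure M (cball (X n) (gap n))" "emeasure M (far n) \<le> emeasure M (cball (X n) (gap n))"
    using near_far_cball[of n] by (auto intro!: emeasure_mono)
  then show "emeasure M (near n) < \<infinity>" "emeasure M (far n) < \<infinity>"
    using emeasure_cball[of "X n" "gap n"] by auto
qed

lemma sets_near [measurable, simp]: "near n \<in> sets borel" and sets_far [measurable, simp]: "far n \<in> sets borel"
  using open_near open_far by auto

lemma measure_near_pos: "active n \<Longrightarrow> 0 < measure M (near n)"
  unfolding near_def by (intro measure_ball_pos) (simp add: active_def)

lemma measure_far_pos:
  assumes "active n" shows "0 < measure M (far n)"
proof (rule measure_pos[OF open_far _ emeasure_far])
  obtain k where "k < n" "dist (X k) (X n) = gap n" using gap_attained assms by (auto simp: active_def)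
  then have "X k \<in> far n" using assms by (auto simp: far_def active_def intro!: exI[of _ k])
  then show "far n \<noteq> {}" by auto
qed

lemma wave_scale_pos: "active n \<Longrightarrow> 0 < wave_scale n"
  using measure_near_pos[of n] measure_far_pos[of n] by (simp add: wave_scale_def add_pos_pos)

lemma L2_near: "indicator (near n) \<in> L2 M" and L2_far: "indicator (far n) \<in> L2 M"
  by (auto intro!: L2_indicator emeasure_near emeasure_far)

lemma wave_active:
  "active n \<Longrightarrow> wave n = (\<lambda>x. (1 / (measure M (near n) * wave_scale n)) * indicator (near n) x
      + (- 1 / (measure M (far n) * wave_scale n)) * indicator (far n) x)"
  by (auto simp: wave_def diff_divide_distrib)

lemma wave_const: "\<not> active n \<Longrightarrow> wave n x = wave n y"
  by (simp add: wave_def)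

lemma wave_L2: "wave n \<in> L2 M"
proof (cases "active n")
  case True
  then show ?thesis unfolding wave_active[OF True] by (intro L2_lincomb L2_near L2_far)
next
  case False
  show ?thesis
  proof (cases "n = 0 \<and> emeasure M UNIV < \<infinity>")
    case True
    then have "(\<lambda>x. (1 / sqrt (measure M UNIV)) * indicator UNIV x) \<in> L2 M"
      by (intro L2_cmult L2_indicator) auto
    then show ?thesis using False True by (simp add: wave_def[abs_def])
  next
    case nfin: False
    then have "wave n = (\<lambda>_. 0)" using False by (auto simp: wave_def)
    then show ?thesis by simp
  qed
qed

lemma inner_wave:
  assumes "h \<in> L2 M" "active n"
  shows "l2_inner M h (wave n) =
    (integ M h (near n) / measure M (near n) - integ M h (far n) / measure M (far n)) / wave_scale n"
  unfolding wave_active[OF assms(2)] using assms(1)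
  by (simp only: l2_inner_lincomb_right L2_near L2_far) (simp add: integ_def diff_divide_distrib)

text \<open>Before normalization the two parts of a wave have masses 1 and -1, so a constant on its
  support integrates to zero. Orthogonality of two active waves and the vanishing of averages at
  large radii both reduce to this.\<close>

lemma inner_wave_const:
  assumes "h \<in> L2 M" "active n" "\<And>x. x \<in> near n \<union> far n \<Longrightarrow> h x = c"
  shows "l2_inner M h (wave n) = 0"
  using assms measure_near_pos[of n] measure_far_pos[of n]
  by (simp add: inner_wave integ_const[of _ M h c])

lemma wave_cong:
  assumes "active n" "dist x y < gap n"
  shows "wave n x = wave n y"
proof -
  have "x \<in> A \<longleftrightarrow> y \<in> A" if "saturated (dist x y) A" for A
    using saturatedD[OF that, of x y] saturatedD[OF that, of y x] by (auto simp: dist_commute)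
  then have "x \<in> near n \<longleftrightarrow> y \<in> near n" "x \<in> far n \<longleftrightarrow> y \<in> far n"
    using saturated_near[OF assms(2)] saturated_far[OF assms(2)] by blast+
  then show ?thesis using assms by (simp add: wave_def indicator_def)
qed

lemma wave_outside: "active n \<Longrightarrow> x \<notin> near n \<union> far n \<Longrightarrow> wave n x = 0"
  by (simp add: wave_def)

lemma wave_normal: "wave n = (\<lambda>_. 0) \<or> l2_inner M (wave n) (wave n) = 1"
proof (cases "active n")
  case True
  let ?a = "measure M (near n)" and ?b = "measure M (far n)" and ?s = "wave_scale n"
  have pos: "0 < ?a" "0 < ?b" "0 < ?s"
    using True by (auto intro: measure_near_pos measure_far_pos wave_scale_pos)
  have "integ M (wave n) (near n) = 1 / (?a * ?s) * ?a"
    using near_far_disjoint[of n] True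
    by (intro integ_const) (auto simp: wave_active disjoint_iff indicator_def)
  moreover have "integ M (wave n) (far n) = - 1 / (?b * ?s) * ?b"
    using near_far_disjoint[of n] True
    by (intro integ_const) (auto simp: wave_active disjoint_iff indicator_def)
  ultimately have eq: "integ M (wave n) (near n) = 1 / ?s" "integ M (wave n) (far n) = - 1 / ?s"
    using pos by simp_all
  have "l2_inner M (wave n) (wave n) = (1 / ?a + 1 / ?b) / ?s\<^sup>2"
    unfolding inner_wave[OF wave_L2 True] eq using pos by (simp add: power2_eq_square field_simps)
  also have "?s\<^sup>2 = 1 / ?a + 1 / ?b" using pos by (simp add: wave_scale_def)
  finally show ?thesis using add_pos_pos[of "1 / ?a" "1 / ?b"] pos by simp
next
  case False
  show ?thesis
  proof (cases "n = 0 \<and> emeasure M UNIV < \<infinity>")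
    case True
    then have "0 < measure M UNIV" by (intro measure_pos) auto
    then show ?thesis using False True
      by (simp add: wave_def l2_inner_def)
  next
    case nfin: False
    then show ?thesis using False by (auto simp: wave_def)
  qed
qed

text \<open>One wave is always constant on the support of the other. If the gaps differ, the wave of
  larger gap is constant on the closed ball carrying the other one. If they agree, the carrying
  balls are disjoint or equal; when equal, the support of wave i lies in \<open>far j\<close>, where
  wave j is constant.\<close>

lemma wave_ortho_less:
  assumes ij: "i < j"
  shows "l2_inner M (wave i) (wave j) = 0"
proof (cases "active j")
  case False
  then have "wave j = (\<lambda>_. 0)" using ij by (auto simp: wave_def)
  then show ?thesis by simp
next
  case j: True
  show ?thesis
  proof (cases "active i")
    case False
    then show ?thesis
      by (intro inner_wave_const[where c="wave i undefined", OF wave_L2 j] wave_const)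
  next
    case i: True
    consider "gap j < gap i" | "gap i < gap j" | "gap i = gap j" "gap i < dist (X i) (X j)"
      | "gap i = gap j" "dist (X i) (X j) \<le> gap j" by linarith
    then show ?thesis
    proof cases
      case 1
      show ?thesis
      proof (rule inner_wave_const[OF wave_L2 j])
        fix x assume "x \<in> near j \<union> far j"
        then have "dist (X j) x \<le> gap j" by (rule near_far_dist)
        then show "wave i x = wave i (X j)" using wave_cong[OF i] 1 by (simp add: dist_commute)
      qed
    next
      case 2
      have "l2_inner M (wave j) (wave i) = 0"
      proof (rule inner_wave_const[OF wave_L2 i])
        fix x assume "x \<in> near i \<union> far i"
        then have "dist (X i) x \<le> gap i" by (rule near_far_dist)
        then show "wave j x = wave j (X i)" using wave_cong[OF j] 2 by (simp add: dist_commute)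
      qed
      then show ?thesis by (simp add: l2_inner_commute)
    next
      case 3
      show ?thesis
      proof (rule inner_wave_const[OF wave_L2 j])
        fix x assume "x \<in> near j \<union> far j"
        then have "dist x (X j) \<le> gap i" using near_far_dist[of x j] 3 by (simp add: dist_commute)
        then have "\<not> dist (X i) x \<le> gap i" using dist_le[of "X i" x "gap i" "X j"] 3 by auto
        then show "wave i x = 0" using near_far_dist[of x i] by (intro wave_outside i) blast
      qed
    next
      case 4
      have d: "dist (X i) (X j) = gap j" using 4 gap_le[OF ij] by simp
      \<comment> \<open>Here i < j is essential: the open balls making up wave i have centres of
        index at most i, which have been met before x_j and so are at distance at least
        \<open>gap j\<close> from it.\<close>
      have sub: "near i \<union> far i \<subseteq> far j"
      proof
        fix x assume "x \<in> near i \<union> far i"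
        then have "\<exists>k. k \<le> i \<and> dist (X k) (X i) \<le> gap i \<and> dist (X k) x < gap i"
        proof
          assume "x \<in> near i"
          then show ?thesis using i by (intro exI[of _ i]) (auto simp: near_def active_def)
        next
          assume "x \<in> far i"
          then obtain k where "k < i" "dist (X k) (X i) = gap i" "dist (X k) x < gap i"
            by (auto simp: far_def)
          then show ?thesis by (intro exI[of _ k]) auto
        qed
        then obtain k where k: "k \<le> i" "dist (X k) (X i) \<le> gap i" "dist (X k) x < gap i" by blast
        have "dist (X k) (X j) \<le> gap j" using dist_le[of "X k" "X i" "gap j" "X j"] k d 4 by simp
        moreover have "gap j \<le> dist (X k) (X j)" using k ij by (intro gap_le) simp
        ultimately show "x \<in> far j" using k ij 4 by (auto simp: far_def intro!: exI[of _ k])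
      qed
      have "l2_inner M (wave j) (wave i) = 0"
      proof (rule inner_wave_const[OF wave_L2 i])
        fix x assume "x \<in> near i \<union> far i"
        then have "x \<in> far j" "x \<notin> near j" using sub near_far_disjoint[of j] by auto
        then show "wave j x = - 1 / (measure M (far j) * wave_scale j)" by (simp add: wave_active[OF j])
      qed
      then show ?thesis by (simp add: l2_inner_commute)
    qed
  qed
qed

lemma wave_ortho: "i \<noteq> j \<Longrightarrow> l2_inner M (wave i) (wave j) = 0"
  using wave_ortho_less[of i j] wave_ortho_less[of j i] by (cases i j rule: linorder_cases) (auto simp: l2_inner_commute)

section \<open>Totality of the system\<close>

lemma integ_Union_balls:
  assumes f: "f \<in> L2 M" and T: "finite T" and c: "\<And>y. y \<in> T \<Longrightarrow> integ M f (ball y r) = \<alpha> * measure M (ball y r)"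
  shows "integ M f (\<Union>y\<in>T. ball y r) = \<alpha> * measure M (\<Union>y\<in>T. ball y r)"
proof -
  let ?F = "(\<lambda>y. ball y r) ` T"
  have dis: "disjoint ?F"
  proof (rule disjointI, rule ccontr)
    fix A B assume "A \<in> ?F" "B \<in> ?F" "A \<noteq> B" "A \<inter> B \<noteq> {}"
    then obtain x y z where *: "A = ball x r" "B = ball y r" "z \<in> A" "z \<in> B" by blast
    then have "A = ball z r" "B = ball z r"
      using ball_eq[of x z r] ball_eq[of y z r] by auto
    then show False using \<open>A \<noteq> B\<close> by simp
  qed
  have "integ M f (\<Union>?F) = (\<Sum>B\<in>?F. integ M f B)"
    using T dis emeasure_ball by (intro integ_disjoint_Union[OF f]) auto
  also have "\<dots> = \<alpha> * (\<Sum>B\<in>?F. measure M B)"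
    unfolding sum_distrib_left by (intro sum.cong) (auto simp: c)
  also have "(\<Sum>B\<in>?F. measure M B) = measure M (\<Union>?F)"
    using T dis emeasure_ball
    by (intro measure_Union'[symmetric]) (auto simp: fmeasurable_def disjoint_def pairwise_def disjnt_def)
  finally show ?thesis by simp
qed

text \<open>Each new sibling opened by the dense sequence has the same mean of $f$ as the union of the
  earlier ones, so by induction all siblings have the same mean.\<close>

lemma integ_ball_cball_proportional:
  assumes f: "f \<in> L2 M" and zero: "\<And>n. l2_inner M f (wave n) = 0" and r: "0 < r"
  shows "\<exists>\<alpha>. integ M f (ball c r) = \<alpha> * measure M (ball c r) \<and> integ M f (cball c r) = \<alpha> * measure M (cball c r)"
proof -
  \<comment> \<open>The first point of the dense sequence in the closed ball starts the induction;
    its open ball fixes the mean \<alpha>.\<close>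
  define m where "m = (LEAST n. X n \<in> cball c r)"
  have ex: "\<exists>n. dist (X n) y < r" for y using dense[OF r] .
  have m: "X m \<in> cball c r"
  proof -
    obtain n where "dist (X n) c < r" using ex by blast
    then have "X n \<in> cball c r" by (simp add: dist_commute)
    then show ?thesis unfolding m_def by (rule LeastI)
  qed
  have m_le: "m \<le> n" if "X n \<in> cball c r" for n
    unfolding m_def using that by (rule Least_le)
  define \<alpha> where "\<alpha> = integ M f (ball (X m) r) / measure M (ball (X m) r)"
  have ball: "integ M f (ball (X n) r) = \<alpha> * measure M (ball (X n) r)" if "X n \<in> cball c r" for n
    using that
  proof (induction n rule: less_induct)
    case (less n)
    show ?case
    proof (cases "\<exists>k<n. dist (X k) (X n) < r")
      case True
      then obtain k where k: "k < n" "dist (X k) (X n) < r" by blast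
      have "dist c (X k) \<le> r" using dist_le[of c "X n" r "X k"] less.prems k by (simp add: dist_commute)
      then show ?thesis using less.IH[OF k(1)] ball_eq[OF k(2)] by simp
    next
      case False
      show ?thesis
      proof (cases "n = m")
        case True
        then show ?thesis using measure_ball_pos[OF r, of "X m"] by (simp add: \<alpha>_def)
      next
        case nm: False
        then have mn: "m < n" using m_le[OF less.prems] by simp
        have "dist (X m) (X n) \<le> r" using dist_le[of "X m" c r "X n"] m less.prems by (simp add: dist_commute)
        \<comment> \<open>No earlier point is closer than r, while x_m is within r: the gap is
          exactly r, and wave n compares siblings at this very scale.\<close>
        then have gap: "gap n = r"
          using False gap_le[OF mn] gap_attained[of n] mn by fastforce
        have act: "active n" using gap mn r by (simp add: active_def)
        have far: "far n = (\<Union>y\<in>X ` {k. k < n \<and> dist (X k) (X n) = r}. ball y r)"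
          by (auto simp: far_def gap)
        have "integ M f (far n) = \<alpha> * measure M (far n)"
          unfolding far
        proof (rule integ_Union_balls[OF f])
          fix y assume "y \<in> X ` {k. k < n \<and> dist (X k) (X n) = r}"
          then obtain k where k: "y = X k" "k < n" "dist (X k) (X n) = r" by blast
          have "dist c (X k) \<le> r" using dist_le[of c "X n" r "X k"] less.prems k by (simp add: dist_commute)
          then show "integ M f (ball y r) = \<alpha> * measure M (ball y r)" using less.IH[OF k(2)] k by simp
        qed simp
        moreover have "integ M f (near n) / measure M (near n) = integ M f (far n) / measure M (far n)"
          using zero[of n] inner_wave[OF f act] wave_scale_pos[OF act] by simp
        ultimately show ?thesis
          using measure_near_pos[OF act] measure_far_pos[OF act] by (simp add: near_def gap field_simps)
      qed
    qed
  qed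
  have ball': "integ M f (ball y r) = \<alpha> * measure M (ball y r)" if y: "y \<in> cball c r" for y
  proof -
    obtain n where n: "dist (X n) y < r" using ex by blast
    then have "dist c (X n) \<le> r" using dist_le[of c y r "X n"] y by (simp add: dist_commute)
    then show ?thesis using ball[of n] ball_eq[OF n] by simp
  qed
  have "cball c r \<subseteq> (\<Union>y\<in>cball c r. ball y r)" using r by auto
  then obtain T where T: "T \<subseteq> cball c r" "finite T" "cball c r \<subseteq> (\<Union>y\<in>T. ball y r)"
    using compactE_image[OF compact_cball[of c r], of "cball c r" "\<lambda>y. ball y r"] open_ball by metis
  have "(\<Union>y\<in>T. ball y r) = cball c r"
  proof
    show "(\<Union>y\<in>T. ball y r) \<subseteq> cball c r"
    proof
      fix z assume "z \<in> (\<Union>y\<in>T. ball y r)"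
      then obtain y where "dist c y \<le> r" "dist y z < r" using T(1) by auto
      then show "z \<in> cball c r" using dist_le[of c y r z] by simp
    qed
  qed (rule T)
  moreover have "integ M f (\<Union>y\<in>T. ball y r) = \<alpha> * measure M (\<Union>y\<in>T. ball y r)"
    using T(1) by (intro integ_Union_balls f T(2) ball') blast
  ultimately have "integ M f (cball c r) = \<alpha> * measure M (cball c r)" by simp
  moreover have "integ M f (ball c r) = \<alpha> * measure M (ball c r)" using r by (intro ball') simp
  ultimately show ?thesis by blast
qed

text \<open>For a fixed centre the mean is a locally constant function of the radius: just above r
  the ball does not change, and just below r it is the open ball, which has the same mean as the
  closed one. As the half-line of radii is connected, the mean is constant.\<close>

lemma integ_cball_proportional:
  assumes f: "f \<in> L2 M" and zero: "\<And>n. l2_inner M f (wave n) = 0"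
  shows "\<exists>\<beta>. \<forall>c r. 0 < r \<longrightarrow> integ M f (cball c r) = \<beta> * measure M (cball c r)"
proof -
  define avg where "avg A = integ M f A / measure M A" for A
  have ball_cball: "avg (ball c r) = avg (cball c r)" if "0 < r" for c r
    using integ_ball_cball_proportional[OF f zero that, of c] measure_ball_pos[OF that, of c] measure_cball_pos[OF that, of c]
    by (auto simp: avg_def)
  have const: "avg (cball c r) = avg (cball c s)" if "0 < r" "0 < s" for c r s
  proof -
    have "(\<lambda>r. avg (cball c r)) constant_on {0<..}"
    proof (rule locally_constant_imp_constant)
      fix r :: real assume "r \<in> {0<..}"
      then have r: "0 < r" by simp
      obtain u where u: "u > r" "cball c u = cball c r" using cball_isolated_right[OF r] by blast
      obtain v where v: "0 < v" "v < r" "cball c v = ball c r" using cball_isolated_left[OF r] by blast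
      have "avg (cball c t) = avg (cball c r)" if t: "t \<in> {v<..<u}" for t
      proof (cases "t < r")
        case True
        then have "cball c t \<subseteq> ball c r" by auto
        moreover have "cball c v \<subseteq> cball c t" using t by auto
        ultimately have "cball c t = ball c r" using v(3) by simp
        then show ?thesis using ball_cball[OF r] by simp
      next
        case False
        then have "cball c r \<subseteq> cball c t" by auto
        moreover have "cball c t \<subseteq> cball c u" using t by auto
        ultimately have "cball c t = cball c r" using u(2) by simp
        then show ?thesis by simp
      qed
      moreover have "openin (top_of_set {0<..}) {v<..<u}"
        using v(1) by (intro open_subset open_greaterThanLessThan) auto
      moreover have "r \<in> {v<..<u}" using u(1) v(2) by simp
      ultimately show "\<exists>T. openin (top_of_set {0<..}) T \<and> r \<in> T \<and> (\<forall>t\<in>T. avg (cball c t) = avg (cball c r))"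
        by blast
    qed (rule connected_Ioi)
    then obtain y where "\<forall>t\<in>{0<..}. avg (cball c t) = y" unfolding constant_on_def by blast
    then show ?thesis using that by simp
  qed
  have "avg (cball c r) = avg (cball (X 0) 1)" if "0 < r" for c r
  proof -
    \<comment> \<open>Two centres share their closed ball once the radius reaches their
      distance.\<close>
    let ?s = "max 1 (dist c (X 0))"
    have "avg (cball c r) = avg (cball c ?s)" using that by (intro const) auto
    also have "cball c ?s = cball (X 0) ?s" by (intro cball_eq) simp
    also have "avg (cball (X 0) ?s) = avg (cball (X 0) 1)" by (intro const) auto
    finally show ?thesis .
  qed
  note avg1 = this
  show ?thesis
  proof (intro exI[of _ "avg (cball (X 0) 1)"] allI impI)
    fix c and r :: real assume r: "0 < r"
    show "integ M f (cball c r) = avg (cball (X 0) 1) * measure M (cball c r)"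
      using measure_cball_pos[OF r, of c] unfolding avg1[OF r, of c, symmetric] by (simp add: avg_def)
  qed
qed

text \<open>The common mean \<beta> is the only freedom left. If \<mu> is finite,
  \<open>wave 0\<close> makes the total integral zero. If it is infinite, Cauchy-Schwarz gives
  |\<beta>| sqrt(\<mu>(B)) \<le> ||f|| for balls B of unbounded measure.\<close>

lemma integ_cball_zero:
  assumes f: "f \<in> L2 M" and zero: "\<And>n. l2_inner M f (wave n) = 0" and r: "0 < r"
  shows "integ M f (cball c r) = 0"
proof -
  obtain \<beta> where \<beta>: "\<And>c r. 0 < r \<Longrightarrow> integ M f (cball c r) = \<beta> * measure M (cball c r)"
    using integ_cball_proportional[OF f zero] by blast
  define B where "B n = cball (X 0) (real (Suc n))" for n
  have B: "range B \<subseteq> sets M" "incseq B" by (auto simp: B_def incseq_def)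
  have UB: "(\<Union>n. B n) = UNIV"
  proof (rule UNIV_eq_I[symmetric])
    fix y
    obtain n :: nat where "dist (X 0) y \<le> real n" using real_arch_simple by blast
    then have "y \<in> B n" by (simp add: B_def)
    then show "y \<in> (\<Union>n. B n)" by blast
  qed
  have \<beta>B: "integ M f (B n) = \<beta> * measure M (B n)" for n unfolding B_def by (rule \<beta>) simp
  have BL: "indicator (B n) \<in> L2 M" for n using B emeasure_cball by (auto simp: B_def intro: L2_indicator)
  have "\<beta> = 0"
  proof (cases "emeasure M UNIV < \<infinity>")
    case True
    have "wave 0 = (\<lambda>_. 1 / sqrt (measure M UNIV))" using True by (auto simp: wave_def active_def)
    moreover have pos: "0 < measure M UNIV" using True by (intro measure_pos) auto
    ultimately have "integ M f UNIV = 0"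
      using zero[of 0] by (simp add: integ_def l2_inner_def)
    moreover have lim: "(\<lambda>n. integ M f (B n)) \<longlonglongrightarrow> integ M f UNIV"
      unfolding UB[symmetric] using B True by (intro integ_incseq_lim f) (auto simp: UB)
    moreover have "(\<lambda>n. integ M f (B n)) \<longlonglongrightarrow> \<beta> * measure M UNIV"
      unfolding \<beta>B
      unfolding UB[symmetric] using B True
      by (intro tendsto_mult tendsto_const Lim_measure_incseq) (auto simp: UB)
    ultimately have "\<beta> * measure M UNIV = 0" using LIMSEQ_unique by metis
    then show ?thesis using pos by simp
  next
    case False
    show ?thesis
    proof (rule ccontr)
      assume "\<beta> \<noteq> 0"
      have bound: "measure M (B n) \<le> (l2_norm M f / \<bar>\<beta>\<bar>)\<^sup>2" for n
      proof -
        let ?b = "measure M (B n)"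
        have pos: "0 < ?b" unfolding B_def by (intro measure_cball_pos) simp
        have "l2_norm M (indicator (B n)) = sqrt ?b"
          using B emeasure_cball by (simp add: l2_norm_def l2_inner_def flip: indicator_inter_arith)
        then have "\<bar>\<beta>\<bar> * ?b \<le> l2_norm M f * sqrt ?b"
          using l2_Cauchy_Schwarz[OF f BL[of n]] \<beta>B[of n] pos by (simp add: integ_def abs_mult)
        then have "(\<bar>\<beta>\<bar> * sqrt ?b) * sqrt ?b \<le> l2_norm M f * sqrt ?b"
          using pos by (simp add: mult.assoc)
        then have "\<bar>\<beta>\<bar> * sqrt ?b \<le> l2_norm M f" using pos by simp
        then have "sqrt ?b \<le> l2_norm M f / \<bar>\<beta>\<bar>" using \<open>\<beta> \<noteq> 0\<close> by (simp add: field_simps)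
        then have "(sqrt ?b)\<^sup>2 \<le> (l2_norm M f / \<bar>\<beta>\<bar>)\<^sup>2" by (intro power_mono) auto
        then show ?thesis by simp
      qed
      have "emeasure M (B n) \<le> ennreal ((l2_norm M f / \<bar>\<beta>\<bar>)\<^sup>2)" for n
        using bound[of n] emeasure_cball[of "X 0" "real (Suc n)"]
        by (subst emeasure_eq_ennreal_measure) (auto simp: B_def intro: ennreal_leI)
      then have "(SUP n. emeasure M (B n)) \<le> ennreal ((l2_norm M f / \<bar>\<beta>\<bar>)\<^sup>2)" by (intro SUP_least)
      then have "emeasure M UNIV \<le> ennreal ((l2_norm M f / \<bar>\<beta>\<bar>)\<^sup>2)"
        using SUP_emeasure_incseq[OF B] by (simp add: UB)
      then show False using False by (auto simp: less_top[symmetric] top_unique)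
    qed
  qed
  then show ?thesis using \<beta>[OF r, of c] by simp
qed

text \<open>A small ball about a point of an open set can be recentred at a point of the dense
  sequence, so countably many balls cover the set. The empty set is added to make the generator
  stable under intersection, as balls that meet are nested.\<close>

lemma borel_eq_sigma_cballs:
  "sets (borel :: 'a measure) = sigma_sets UNIV (insert {} {cball x r | x r. 0 < r})"
proof -
  let ?E = "insert {} {cball (x::'a) r | x r. 0 < r}"
  have "sigma_sets UNIV {S :: 'a set. open S} = sigma_sets UNIV ?E"
  proof (rule sigma_sets_eqI)
    fix S :: "'a set" assume "S \<in> {S. open S}"
    then have S: "open S" by simp
    define J where "J = {(n, k). cball (X n) (1 / real (Suc k)) \<subseteq> S}"
    have "S = (\<Union>(n, k)\<in>J. cball (X n) (1 / real (Suc k)))"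
    proof
      show "S \<subseteq> (\<Union>(n, k)\<in>J. cball (X n) (1 / real (Suc k)))"
      proof
        fix x assume "x \<in> S"
        then obtain d where d: "0 < d" "ball x d \<subseteq> S" using S by (meson openE)
        obtain k where k: "1 / real (Suc k) < d" using nat_approx_posE[OF d(1)] by blast
        obtain n where n: "dist (X n) x < 1 / real (Suc k)" using dense[of "1 / real (Suc k)" x] by auto
        have "cball (X n) (1 / real (Suc k)) = cball x (1 / real (Suc k))"
          using n by (intro cball_eq) simp
        also have "\<dots> \<subseteq> S" using k d(2) by fastforce
        finally have "(n, k) \<in> J" by (simp add: J_def)
        then show "x \<in> (\<Union>(n, k)\<in>J. cball (X n) (1 / real (Suc k)))" using n by force
      qed
    qed (auto simp: J_def)
    also have "\<dots> \<in> sigma_sets UNIV ?E"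
    proof (rule sigma_sets_UNION)
      show "countable ((\<lambda>(n, k). cball (X n) (1 / real (Suc k))) ` J)" by simp
      fix b assume "b \<in> (\<lambda>(n, k). cball (X n) (1 / real (Suc k))) ` J"
      then have "b \<in> ?E" by force
      then show "b \<in> sigma_sets UNIV ?E" by (rule sigma_sets.Basic)
    qed
    finally show "S \<in> sigma_sets UNIV ?E" .
  next
    fix b assume "b \<in> ?E"
    then have "open b" using open_cball by auto
    then show "b \<in> sigma_sets UNIV {S. open S}" by (intro sigma_sets.Basic) simp
  qed
  then show ?thesis by (simp add: borel_def)
qed

lemma wave_total:
  assumes f: "f \<in> L2 M" and zero: "\<And>n. l2_inner M f (wave n) = 0"
  shows "AE x in M. f x = 0"
proof -
  let ?E = "insert {} {cball (x::'a) r | x r. 0 < r}"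
  have [measurable]: "f \<in> borel_measurable M" using f by (rule L2_measurable)
  \<comment> \<open>\<open>ennreal\<close> truncates at 0, so the densities are the positive and the
    negative part of f; if they agree, both vanish.\<close>
  let ?P = "density M (\<lambda>x. ennreal (f x))" and ?N = "density M (\<lambda>x. ennreal (- f x))"
  have E: "emeasure ?P A = emeasure ?N A \<and> emeasure ?P A \<noteq> \<infinity>" if A_E: "A \<in> ?E" for A
  proof (cases "A = {}")
    case False
    then obtain c r where A: "A = cball c r" "0 < r" using A_E by blast
    have int: "integrable M (\<lambda>x. f x * indicator A x)"
      unfolding A using emeasure_cball by (intro L2_integrable_mult f L2_indicator) auto
    have i: "integrable M (\<lambda>x. max 0 (f x * indicator A x))" "integrable M (\<lambda>x. max 0 (- (f x * indicator A x)))"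
      using int by (auto intro!: Bochner_Integration.integrable_max)
    have "(LINT x|M. max 0 (f x * indicator A x)) - (LINT x|M. max 0 (- (f x * indicator A x)))
        = (LINT x|M. max 0 (f x * indicator A x) - max 0 (- (f x * indicator A x)))"
      using i by simp
    also have "\<dots> = (LINT x|M. f x * indicator A x)"
      by (intro Bochner_Integration.integral_cong) auto
    also have "\<dots> = 0" using integ_cball_zero[OF f zero A(2), of c] by (simp add: integ_def l2_inner_def A)
    finally have eq: "(LINT x|M. max 0 (f x * indicator A x)) = (LINT x|M. max 0 (- (f x * indicator A x)))" by simp
    have "emeasure ?P A = (\<integral>\<^sup>+x. ennreal (max 0 (f x * indicator A x)) \<partial>M)"
      unfolding A(1) by (subst emeasure_density) (auto intro!: nn_integral_cong simp: indicator_def ennreal_neg max_def)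
    also have "\<dots> = ennreal (LINT x|M. max 0 (f x * indicator A x))"
      by (intro nn_integral_eq_integral i) auto
    finally have P: "emeasure ?P A = ennreal (LINT x|M. max 0 (f x * indicator A x))" .
    have "emeasure ?N A = (\<integral>\<^sup>+x. ennreal (max 0 (- (f x * indicator A x))) \<partial>M)"
      unfolding A(1) by (subst emeasure_density) (auto intro!: nn_integral_cong simp: indicator_def ennreal_neg max_def)
    also have "\<dots> = ennreal (LINT x|M. max 0 (- (f x * indicator A x)))"
      by (intro nn_integral_eq_integral i) auto
    finally show ?thesis using P eq by simp
  qed simp
  have "?P = ?N"
  proof (rule measure_eqI_generator_eq[where E="?E" and A="\<lambda>n. cball (X 0) (real (Suc n))"])
    show "Int_stable ?E"
    proof (rule Int_stableI)
      fix A B assume AB: "A \<in> ?E" "B \<in> ?E"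
      show "A \<inter> B \<in> ?E"
      proof (cases "A \<inter> B = {}")
        case False
        then obtain z where z: "z \<in> A" "z \<in> B" by blast
        then obtain x r y s where *: "A = cball x r" "B = cball y s" "0 < r" "0 < s" using AB by auto
        then have "A = cball z r" "B = cball z s"
          using cball_eq[of x z r] cball_eq[of y z s] z by auto
        then have "A \<inter> B = cball z (min r s)" by auto
        moreover have "0 < min r s" using * by simp
        ultimately show ?thesis by blast
      qed simp
    qed
    show "(\<Union>n. cball (X 0) (real (Suc n))) = UNIV"
    proof (rule UNIV_eq_I[symmetric])
      fix y
      obtain n :: nat where "dist (X 0) y \<le> real n" using real_arch_simple by blast
      then have "y \<in> cball (X 0) (real (Suc n))" by simp
      then show "y \<in> (\<Union>n. cball (X 0) (real (Suc n)))" by blast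
    qed
    show "range (\<lambda>n. cball (X 0) (real (Suc n))) \<subseteq> ?E" by force
    show "emeasure ?P (cball (X 0) (real (Suc n))) \<noteq> \<infinity>" for n
      using E[of "cball (X 0) (real (Suc n))"] by force
    show "sets ?P = sigma_sets UNIV ?E" "sets ?N = sigma_sets UNIV ?E"
      using borel_eq_sigma_cballs by simp_all
  qed (use E in auto)
  then have "AE x in M. ennreal (f x) = ennreal (- f x)"
    using sigma_finite_measure.density_unique_iff[OF sigma_finite] by simp
  then show ?thesis
  proof eventually_elim
    case (elim x)
    then show ?case by (cases "0 \<le> f x") (auto simp: ennreal_neg ennreal_eq_0_iff)
  qed
qed

sublocale l2_basis M wave
  by standard (auto intro: wave_L2 wave_ortho wave_total simp: wave_normal)

end

section \<open>Isotropic Markov operators are diagonal\<close>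

locale distance_distribution_function =
  fixes \<sigma> :: "ennreal \<Rightarrow> real"
  assumes dd: "distance_distribution \<sigma>"
begin

lemma sigma_nonneg: "0 \<le> \<sigma> r" and sigma_le_1: "\<sigma> r \<le> 1"
  using dd by (auto simp: distance_distribution_def subset_iff)

lemma sigma_strict: "r < s \<Longrightarrow> \<sigma> r < \<sigma> s"
  using dd by (auto simp: distance_distribution_def strict_mono_def)

lemma sigma_mono: "r \<le> s \<Longrightarrow> \<sigma> r \<le> \<sigma> s"
  using sigma_strict[of r s] by (cases "r = s") (auto simp: less_le)

lemma sigma_pos: "0 < r \<Longrightarrow> 0 < \<sigma> r"
  using sigma_strict[of 0 r] sigma_nonneg[of 0] by linarith

lemma sigma_left: "(\<sigma> \<longlongrightarrow> \<sigma> r) (at_left r)"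
  using dd by (auto simp: distance_distribution_def continuous_within)

lemma sigma_at_0: "(\<sigma> \<longlongrightarrow> 0) (at_right 0)"
  using dd by (auto simp: distance_distribution_def)

lemma sigma_infinity: "\<sigma> \<infinity> = 1"
  using dd by (auto simp: distance_distribution_def)

section \<open>The Stieltjes measure of a distance distribution function\<close>

definition sigma_right :: "real \<Rightarrow> real" where
  "sigma_right r = (INF s\<in>{ennreal r<..}. \<sigma> s)"

lemma Ioi_nonempty: "{ennreal r<..} \<noteq> {}"
  using ennreal_less_top by blast

lemma sigma_right_le: "ennreal r < s \<Longrightarrow> sigma_right r \<le> \<sigma> s"
  unfolding sigma_right_def by (intro cINF_lower bdd_belowI2[where m=0] sigma_nonneg) auto

lemma le_sigma_right: "s \<le> ennreal r \<Longrightarrow> \<sigma> s \<le> sigma_right r"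
  unfolding sigma_right_def
  by (intro cINF_greatest Ioi_nonempty sigma_mono) auto

lemma sigma_right_nonneg: "0 \<le> sigma_right r"
  using le_sigma_right[of 0 r] sigma_nonneg[of 0] by simp

lemma sigma_right_le_1: "sigma_right r \<le> 1"
  using sigma_right_le[of r top] sigma_le_1[of top] by simp

lemma sigma_right_mono: "r \<le> s \<Longrightarrow> sigma_right r \<le> sigma_right s"
  unfolding sigma_right_def[of s]
  by (intro cINF_greatest Ioi_nonempty sigma_right_le) (auto intro: le_less_trans ennreal_leI)

lemma ex_sigma_less:
  assumes "sigma_right r < c"
  shows "\<exists>s>ennreal r. \<sigma> s < c"
proof (rule ccontr)
  assume "\<not> ?thesis"
  then have "c \<le> sigma_right r" unfolding sigma_right_def by (intro cINF_greatest Ioi_nonempty) (auto simp: not_less[symmetric])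
  then show False using assms by simp
qed

lemma sigma_right_right_cont: "continuous (at_right r) sigma_right"
proof (subst continuous_at_right_real_increasing, erule sigma_right_mono, intro allI impI)
  fix e :: real assume "0 < e"
  then obtain s where s: "ennreal r < s" "\<sigma> s < sigma_right r + e" using ex_sigma_less[of r "sigma_right r + e"] by auto
  obtain t where t: "ennreal r < t" "t < s" using dense[OF s(1)] by blast
  then obtain b where b: "t = ennreal b" "0 \<le> b" by (cases t rule: ennreal_cases) auto
  then have "r < b" using t(1) by (metis ennreal_leI linorder_not_less)
  moreover have "sigma_right b \<le> \<sigma> s" using sigma_right_le t b by simp
  ultimately show "\<exists>d>0. sigma_right (r + d) - sigma_right r < e" using s(2) by (intro exI[of _ "b - r"]) auto
qed

text \<open>Hence the measure is concentrated on positive radii: \<open>ennreal\<close> sends r to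
  0, and \<sigma>(0+) = 0 leaves no atom there.\<close>

lemma sigma_right_nonpos:
  assumes "r \<le> 0" shows "sigma_right r = 0"
proof -
  have "sigma_right r \<le> 0"
  proof (rule ccontr)
    assume "\<not> sigma_right r \<le> 0"
    then have "\<forall>\<^sub>F s in at_right 0. \<sigma> s < sigma_right r"
      using sigma_at_0 by (intro order_tendstoD) auto
    then obtain b where b: "0 < b" "\<And>s. 0 < s \<Longrightarrow> s < b \<Longrightarrow> \<sigma> s < sigma_right r"
      unfolding eventually_at_right[OF ennreal_zero_less_top] by blast
    then obtain s where "\<sigma> s < sigma_right r" "0 < s" using dense[OF b(1)] by blast
    then show False using sigma_right_le[of r s] assms by (simp add: ennreal_neg)
  qed
  then show ?thesis using sigma_right_nonneg[of r] by simp
qed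

lemma stieltjes_eq: "stieltjes \<sigma> = interval_measure sigma_right"
  by (simp add: stieltjes_def sigma_right_def[abs_def])

lemma sets_stieltjes [simp, measurable_cong]: "sets (stieltjes \<sigma>) = sets borel"
  by (simp add: stieltjes_eq)

lemma space_stieltjes [simp]: "space (stieltjes \<sigma>) = UNIV"
  by (simp add: stieltjes_eq)

lemma emeasure_stieltjes_Ioc: "a \<le> b \<Longrightarrow> emeasure (stieltjes \<sigma>) {a<..b} = ennreal (sigma_right b - sigma_right a)"
  unfolding stieltjes_eq by (intro emeasure_interval_measure_Ioc sigma_right_mono sigma_right_right_cont)

lemma finite_stieltjes: "finite_measure (stieltjes \<sigma>)"
  unfolding stieltjes_eq
  by (rule finite_interval_measure) (auto intro: sigma_right_mono sigma_right_right_cont sigma_right_nonneg sigma_right_le_1)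

lemma stieltjes_AE_pos: "AE r in stieltjes \<sigma>. 0 < r"
proof -
  have "(\<Union>n::nat. {- real n<..0}) \<in> null_sets (stieltjes \<sigma>)"
    by (intro null_sets_UN) (simp add: null_sets_def emeasure_stieltjes_Ioc sigma_right_nonpos)
  then show ?thesis
  proof (rule AE_I')
    show "{r \<in> space (stieltjes \<sigma>). \<not> 0 < r} \<subseteq> (\<Union>n::nat. {- real n<..0})"
    proof
      fix r assume "r \<in> {r \<in> space (stieltjes \<sigma>). \<not> 0 < r}"
      moreover obtain n :: nat where "- r < real n" using reals_Archimedean2 by blast
      ultimately have "r \<in> {- real n<..0}" by auto
      then show "r \<in> (\<Union>n::nat. {- real n<..0})" by blast
    qed
  qed
qed

text \<open>This mass will be the eigenvalue of P belonging to scale R. The interval is open at R,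
  and left-continuity of \<sigma>, also at infinity, gives it exactly the mass
  \<open>\<sigma> R\<close>.\<close>

lemma measure_stieltjes:
  assumes R: "0 < R"
  shows "measure (stieltjes \<sigma>) {r. 0 < r \<and> ennreal r < R} = \<sigma> R"
proof -
  let ?S = "stieltjes \<sigma>"
  let ?A = "{r. 0 < r \<and> ennreal r < R}"
  interpret S: finite_measure ?S by (rule finite_stieltjes)
  \<comment> \<open>The intervals (0, b n] exhaust the set from inside, with a separate sequence for
    infinite R; where \<open>b n\<close> is not positive the interval is empty.\<close>
  define b where "b n = (if R = top then real n else enn2real R - 1 / real (Suc n))" for n
  have A [measurable]: "?A \<in> sets borel" by measurable
  have sub: "{0<..b n} \<subseteq> ?A" for n
  proof
    fix r assume r: "r \<in> {0<..b n}"
    show "r \<in> ?A"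
    proof (cases R rule: ennreal_cases)
      case (real x)
      have "b n = x - 1 / real (Suc n)" using real by (simp add: b_def)
      moreover have "0 < 1 / real (Suc n)" by simp
      ultimately have "r < x" using r unfolding greaterThanAtMost_iff by linarith
      then show ?thesis using r real by (simp add: ennreal_less_iff)
    next
      case top
      then show ?thesis using r by simp
    qed
  qed
  have inc: "incseq (\<lambda>n. {0<..b n})"
  proof -
    have "b m \<le> b n" if "m \<le> n" for m n
      using that by (auto simp: b_def intro!: divide_left_mono)
    then show ?thesis by (force simp: incseq_def)
  qed
  have UA: "(\<Union>n. {0<..b n}) = ?A"
  proof
    show "?A \<subseteq> (\<Union>n. {0<..b n})"
    proof
      fix r assume r: "r \<in> ?A"
      have "\<exists>n. r \<le> b n"
      proof (cases R rule: ennreal_cases)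
        case (real x)
        then have "0 < x - r" using r ennreal_less_iff[of r x] by auto
        then obtain n where "1 / real (Suc n) < x - r" using nat_approx_posE by blast
        then show ?thesis using real by (intro exI[of _ n]) (simp add: b_def)
      next
        case top
        then show ?thesis using real_arch_simple[of r] by (simp add: b_def)
      qed
      then show "r \<in> (\<Union>n. {0<..b n})" using r by auto
    qed
  qed (use sub in blast)
  have mA: "measure ?S {0<..c} = sigma_right c" if "0 \<le> c" for c
    using emeasure_stieltjes_Ioc[OF that] sigma_right_nonneg by (simp add: measure_def sigma_right_nonpos)
  have "(\<lambda>n. measure ?S {0<..b n}) \<longlonglongrightarrow> measure ?S ?A"
    unfolding UA[symmetric] by (intro S.finite_Lim_measure_incseq inc) auto
  moreover have "measure ?S {0<..b n} \<le> \<sigma> R" for n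
  proof (cases "0 < b n")
    case True
    then have "b n \<in> ?A" using sub[of n] by auto
    then show ?thesis using True mA[of "b n"] sigma_right_le[of "b n" R] by simp
  next
    case False
    then show ?thesis using sigma_nonneg by (simp add: greaterThanAtMost_empty)
  qed
  ultimately have upper: "measure ?S ?A \<le> \<sigma> R" by (intro LIMSEQ_le_const2) auto
  have lower: "\<sigma> R \<le> measure ?S ?A"
  proof (rule tendsto_upperbound[OF sigma_left])
    show "\<forall>\<^sub>F s in at_left R. \<sigma> s \<le> measure ?S ?A"
      unfolding eventually_at_left[OF R]
    proof (intro exI[of _ 0] conjI R allI impI)
      fix s assume s: "0 < s" "s < R"
      then obtain c where c: "s = ennreal c" "0 \<le> c" by (cases s rule: ennreal_cases) auto
      have "\<sigma> s \<le> sigma_right c" using c by (intro le_sigma_right) simp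
      also have "\<dots> = measure ?S {0<..c}" using c by (simp add: mA)
      also have "\<dots> \<le> measure ?S ?A"
      proof (intro S.finite_measure_mono)
        show "{0<..c} \<subseteq> ?A" using s c by (auto intro: le_less_trans[OF ennreal_leI])
      qed simp
      finally show "\<sigma> s \<le> measure ?S ?A" .
    qed
    show "at_left R \<noteq> bot"
    proof
      assume "at_left R = bot"
      then have "\<forall>\<^sub>F s in at_left R. False" by simp
      then obtain t where "t < R" "\<And>y. t < y \<Longrightarrow> \<not> y < R" unfolding eventually_at_left[OF R] by blast
      then show False using dense[of t R] by blast
    qed
  qed
  show ?thesis using upper lower by simp
qed

end

section \<open>Averages and the Markov operator in Haar coordinates\<close>

context ultrametric_measure
begin

text \<open>Infinity is the scale of the constant wave: every averaging fixes it, and its eigenvalue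
  is \<sigma> at infinity, that is, 1.\<close>

definition scale :: "nat \<Rightarrow> ennreal" where
  "scale n = (if active n then ennreal (gap n) else \<infinity>)"

lemma scale_pos: "0 < scale n"
  by (simp add: scale_def active_def)

text \<open>Below the gap both parts of the wave are saturated, and averaging preserves the
  integrals over them; from the gap on, the average is constant on the support of the wave.\<close>

lemma inner_ball_average_wave:
  assumes f: "f \<in> L2 M" and r: "0 < r"
  shows "l2_inner M (ball_average M r f) (wave n) = (if ennreal r < scale n then l2_inner M f (wave n) else 0)"
proof (cases "active n")
  case True
  note L = ball_average_L2[OF f r]
  show ?thesis
  proof (cases "r < gap n")
    case rg: True
    then show ?thesis
      using True r by (simp add: inner_wave L f scale_def ennreal_less_iff
          integ_ball_average[OF f r saturated_near[OF rg] emeasure_near]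
          integ_ball_average[OF f r saturated_far[OF rg] emeasure_far])
  next
    case False
    have "l2_inner M (ball_average M r f) (wave n) = 0"
    proof (rule inner_wave_const[OF L True])
      fix x assume "x \<in> near n \<union> far n"
      then have "dist x (X n) \<le> r" using near_far_dist[of x n] False by (simp add: dist_commute)
      then show "ball_average M r f x = ball_average M r f (X n)" by (rule ball_average_cong)
    qed
    moreover have "\<not> ennreal r < scale n" using False True r by (simp add: scale_def ennreal_less_iff)
    ultimately show ?thesis by simp
  qed
next
  case False
  show ?thesis
  proof (cases "n = 0 \<and> emeasure M UNIV < \<infinity>")
    case True
    then have "integ M (ball_average M r f) UNIV = integ M f UNIV"
      by (intro integ_ball_average f r saturated_UNIV) simp
    then have "l2_inner M (ball_average M r f) (\<lambda>_. 1 / sqrt (measure M UNIV)) = l2_inner M f (\<lambda>_. 1 / sqrt (measure M UNIV))"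
      by (simp add: integ_def l2_inner_def)
    moreover have "wave n = (\<lambda>_. 1 / sqrt (measure M UNIV))" using False True by (auto simp: wave_def)
    ultimately show ?thesis using False by (simp add: scale_def)
  next
    case nfin: False
    then have "wave n = (\<lambda>_. 0)" using False by (auto simp: wave_def)
    then show ?thesis by simp
  qed
qed

text \<open>The cut-off at r = 0 avoids the balls \<open>cball x 0\<close>, which are single points
  and may be null; d\<sigma> does not charge the radii removed.\<close>

definition pos_average :: "('a \<Rightarrow> real) \<Rightarrow> real \<Rightarrow> 'a \<Rightarrow> real" where
  "pos_average f r x = (if 0 < r then ball_average M r f x else 0)"

text \<open>The radius is rounded up to a multiple of 1/(i+1), strictly above r by the
  \<open>+ 1\<close>. For a fixed grid value the average is measurable in x, and by
  \<open>cball_isolated_right\<close> the rounding leaves the ball at (r, x) unchanged for large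
  i.\<close>

lemma pos_average_measurable [measurable]:
  "(\<lambda>(r, x). pos_average f r x) \<in> borel_measurable (borel \<Otimes>\<^sub>M M)"
proof -
  define U where "U i k p = (if 0 < fst p \<and> 0 \<le> k then ball_average M ((of_int k + 1) / real (Suc i)) f (snd p) else 0)"
    for i and k :: int and p :: "real \<times> 'a"
  define u where "u i r = (of_int \<lfloor>real (Suc i) * r\<rfloor> + 1) / real (Suc i)" for i and r :: real
  have Uk: "U i k \<in> borel_measurable (borel \<Otimes>\<^sub>M M)" for i k
  proof (cases "0 \<le> k")
    case True
    then have "0 < (of_int k + 1) / real (Suc i)" by simp
    note ball_average_measurable[OF this, of f, measurable]
    show ?thesis using True unfolding U_def[abs_def] by simp
  qed (simp add: U_def[abs_def])
  have U: "(\<lambda>p. U i \<lfloor>real (Suc i) * fst p\<rfloor> p) \<in> borel_measurable (borel \<Otimes>\<^sub>M M)" for i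
    by (rule measurable_compose_countable[OF Uk]) simp
  have conv: "(\<lambda>i. U i \<lfloor>real (Suc i) * fst p\<rfloor> p) \<longlonglongrightarrow> pos_average f (fst p) (snd p)" for p
  proof (cases "0 < fst p")
    case True
    let ?r = "fst p" and ?x = "snd p"
    obtain s where s: "s > ?r" "cball ?x s = cball ?x ?r" using cball_isolated_right[OF True] by blast
    obtain N where N: "1 / real (Suc N) < s - ?r" using nat_approx_posE[of "s - ?r"] s(1) by auto
    have eq: "U i \<lfloor>real (Suc i) * ?r\<rfloor> p = pos_average f ?r ?x" if "N \<le> i" for i
    proof -
      have "real (Suc i) * ?r < of_int \<lfloor>real (Suc i) * ?r\<rfloor> + 1" by linarith
      then have 1: "?r < u i ?r" by (simp add: u_def field_simps)
      have "of_int \<lfloor>real (Suc i) * ?r\<rfloor> + 1 \<le> real (Suc i) * ?r + 1" by linarith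
      then have "u i ?r \<le> (real (Suc i) * ?r + 1) / real (Suc i)" unfolding u_def by (intro divide_right_mono) auto
      also have "\<dots> = ?r + 1 / real (Suc i)" by (simp add: add_divide_distrib)
      also have "\<dots> \<le> ?r + 1 / real (Suc N)" using that by (simp add: divide_left_mono)
      finally have 2: "u i ?r < s" using N by simp
      have "cball ?x (u i ?r) \<subseteq> cball ?x s" "cball ?x ?r \<subseteq> cball ?x (u i ?r)" using 1 2 by auto
      then have "cball ?x (u i ?r) = cball ?x ?r" using s(2) by simp
      then have "ball_average M (u i ?r) f ?x = ball_average M ?r f ?x" by (simp add: ball_average_integ)
      moreover have "0 \<le> \<lfloor>real (Suc i) * ?r\<rfloor>" using True by simp
      ultimately show ?thesis using True by (simp add: U_def pos_average_def u_def)
    qed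
    show ?thesis
      by (rule tendsto_eventually) (use eq in \<open>auto simp: eventually_sequentially\<close>)
  qed (simp add: U_def pos_average_def)
  have "(\<lambda>p. pos_average f (fst p) (snd p)) \<in> borel_measurable (borel \<Otimes>\<^sub>M M)"
    by (rule borel_measurable_LIMSEQ_real[OF conv U])
  then show ?thesis by (simp add: case_prod_beta')
qed

theorem isotropic_markov_op_diag:
  assumes dd: "distance_distribution \<sigma>"
  shows "isotropic_markov_op M \<sigma> = diag (\<lambda>n. \<sigma> (scale n))"
proof -
  interpret distance_distribution_function \<sigma> by standard (rule dd)
  let ?S = "stieltjes \<sigma>"
  interpret S: finite_measure ?S by (rule finite_stieltjes)
  interpret M: sigma_finite_measure M by (rule sigma_finite)
  interpret pair_sigma_finite ?S M ..
  have S_fin: "emeasure ?S UNIV < top" using S.emeasure_finite[of UNIV] by (simp add: less_top[symmetric])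
  define P where "P f x = (LINT r|?S. pos_average f r x)" for f x
  have sec: "(\<lambda>r. pos_average f r x) \<in> borel_measurable borel" for f x
    using measurable_compose[OF measurable_Pair2' pos_average_measurable, of x f] by simp
  have pair [measurable]: "(\<lambda>(r, x). pos_average f r x) \<in> borel_measurable (?S \<Otimes>\<^sub>M M)" for f
    using pos_average_measurable[of f] by (simp cong: measurable_cong_sets sets_pair_measure_cong)
  \<comment> \<open>The integrands can differ only at r = 0, a null set for d\<sigma>.\<close>
  have LINT_eq: "(LINT r:{0..}|?S. ball_average M r f x) = P f x" for f x
    unfolding P_def set_lebesgue_integral_def
  proof (rule integral_cong_AE)
    have "(\<lambda>r. indicator {0..} r *\<^sub>R ball_average M r f x) =
        (\<lambda>r. if r = 0 then ball_average M 0 f x else pos_average f r x)"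
      by (auto simp: pos_average_def indicator_def)
    then show "(\<lambda>r. indicator {0..} r *\<^sub>R ball_average M r f x) \<in> borel_measurable ?S"
      using sec[of f x] by (simp add: measurable_If_set)
    show "(\<lambda>r. pos_average f r x) \<in> borel_measurable ?S" using sec[of f x] by simp
    show "AE r in ?S. indicator {0..} r *\<^sub>R ball_average M r f x = pos_average f r x"
      using stieltjes_AE_pos by eventually_elim (simp add: pos_average_def)
  qed
  \<comment> \<open>Averaging is a contraction at every radius and d\<sigma> is finite, so the
    averages are square-integrable in both variables jointly; this prepares Fubini.\<close>
  have L2_pair: "(\<lambda>(r, x). pos_average f r x) \<in> L2 (?S \<Otimes>\<^sub>M M)" if f: "f \<in> L2 M" for f
  proof -
    have "integrable (?S \<Otimes>\<^sub>M M) (\<lambda>p. ((\<lambda>(r, x). pos_average f r x) p)\<^sup>2)"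
    proof (rule integrableI_nonneg)
      have "(\<integral>\<^sup>+p. ennreal (((\<lambda>(r, x). pos_average f r x) p)\<^sup>2) \<partial>(?S \<Otimes>\<^sub>M M)) =
          (\<integral>\<^sup>+r. \<integral>\<^sup>+x. ennreal ((pos_average f r x)\<^sup>2) \<partial>M \<partial>?S)"
        by (subst M.nn_integral_fst[symmetric]) auto
      also have "\<dots> \<le> (\<integral>\<^sup>+r. ennreal (l2_inner M f f) \<partial>?S)"
      proof (rule nn_integral_mono)
        fix r
        show "(\<integral>\<^sup>+x. ennreal ((pos_average f r x)\<^sup>2) \<partial>M) \<le> ennreal (l2_inner M f f)"
          using ball_average_nn_integral[OF f, of r] by (cases "0 < r") (simp_all add: pos_average_def)
      qed
      also have "\<dots> < \<infinity>" using S_fin by (simp add: ennreal_mult_less_top)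
      finally show "(\<integral>\<^sup>+p. ennreal (((\<lambda>(r, x). pos_average f r x) p)\<^sup>2) \<partial>(?S \<Otimes>\<^sub>M M)) < \<infinity>" .
    qed auto
    then show ?thesis by (simp add: L2_def)
  qed
  have P_L2: "P f \<in> L2 M" if f: "f \<in> L2 M" for f
  proof -
    have [measurable]: "P f \<in> borel_measurable M"
    proof -
      have "(\<lambda>(x, r). pos_average f r x) \<in> borel_measurable (M \<Otimes>\<^sub>M ?S)"
        using measurable_compose[OF measurable_pair_swap' pair[of f]] by (simp add: case_prod_beta')
      then show ?thesis unfolding P_def[abs_def] by (rule S.borel_measurable_lebesgue_integral)
    qed
    have int: "integrable (?S \<Otimes>\<^sub>M M) (\<lambda>(r, x). (pos_average f r x)\<^sup>2)"
      using L2_pair[OF f] by (simp add: L2_def case_prod_beta')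
    \<comment> \<open>Cauchy-Schwarz against the constant 1 in the finite measure d\<sigma> bounds
      (P f x)^2 by the integral of the squares times the total mass.\<close>
    have "integrable M (\<lambda>x. (P f x)\<^sup>2)"
    proof (rule Bochner_Integration.integrable_bound)
      show "integrable M (\<lambda>x. (LINT r|?S. (pos_average f r x)\<^sup>2) * measure ?S UNIV)"
        using integrable_snd[OF int] by simp
      show "AE x in M. norm ((P f x)\<^sup>2) \<le> norm ((LINT r|?S. (pos_average f r x)\<^sup>2) * measure ?S UNIV)"
        using AE_integrable_snd[OF int]
      proof eventually_elim
        case (elim x)
        then have "(\<lambda>r. pos_average f r x) \<in> L2 ?S" using sec[of f x] by (simp add: L2_def)
        moreover have "(\<lambda>_. 1) \<in> L2 ?S" by (simp add: L2_def)
        ultimately have "\<bar>P f x\<bar> \<le> l2_norm ?S (\<lambda>r. pos_average f r x) * l2_norm ?S (\<lambda>_. 1)"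
          using l2_Cauchy_Schwarz[of "\<lambda>r. pos_average f r x" ?S "\<lambda>_. 1"] by (simp add: l2_inner_def P_def)
        then have "\<bar>P f x\<bar>\<^sup>2 \<le> (l2_norm ?S (\<lambda>r. pos_average f r x) * l2_norm ?S (\<lambda>_. 1))\<^sup>2"
          by (intro power_mono) auto
        also have "\<dots> = (LINT r|?S. (pos_average f r x)\<^sup>2) * measure ?S UNIV"
          by (simp add: power_mult_distrib) (simp add: l2_inner_def power2_eq_square)
        finally show ?case by simp
      qed
    qed measurable
    then show ?thesis by (simp add: L2_def)
  qed
  have coef_P: "coef (P f) n = \<sigma> (scale n) * coef f n" if f: "f \<in> L2 M" for f n
  proof -
    have [measurable]: "wave n \<in> borel_measurable M" using wave_L2 by (rule L2_measurable)
    have w: "(\<lambda>(r, x). wave n x) \<in> L2 (?S \<Otimes>\<^sub>M M)"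
    proof -
      have "integrable (?S \<Otimes>\<^sub>M M) (\<lambda>p. ((\<lambda>(r, x). wave n x) p)\<^sup>2)"
      proof (rule integrableI_nonneg)
        have "(\<integral>\<^sup>+p. ennreal (((\<lambda>(r, x). wave n x) p)\<^sup>2) \<partial>(?S \<Otimes>\<^sub>M M)) =
            (\<integral>\<^sup>+r. \<integral>\<^sup>+x. ennreal ((wave n x)\<^sup>2) \<partial>M \<partial>?S)"
          by (subst M.nn_integral_fst[symmetric]) auto
        also have "\<dots> = (\<integral>\<^sup>+r. ennreal (LINT x|M. (wave n x)\<^sup>2) \<partial>?S)"
          using wave_L2[of n] by (subst nn_integral_eq_integral) (auto simp: L2_def)
        also have "\<dots> < \<infinity>" using S_fin by (simp add: ennreal_mult_less_top)
        finally show "(\<integral>\<^sup>+p. ennreal (((\<lambda>(r, x). wave n x) p)\<^sup>2) \<partial>(?S \<Otimes>\<^sub>M M)) < \<infinity>" .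
      qed auto
      then show ?thesis by (simp add: L2_def)
    qed
    have int: "integrable (?S \<Otimes>\<^sub>M M) (\<lambda>(r, x). pos_average f r x * wave n x)"
      using L2_integrable_mult[OF L2_pair[OF f] w] by (simp add: case_prod_beta')
    have "coef (P f) n = (LINT x|M. LINT r|?S. pos_average f r x * wave n x)"
      by (simp add: coef_def l2_inner_def P_def)
    also have "\<dots> = (LINT r|?S. LINT x|M. pos_average f r x * wave n x)"
      using integral_snd[OF int] integral_fst[OF int] by simp
    \<comment> \<open>At a fixed radius the coefficient of the average is all or nothing, depending
      on whether r is below the scale.\<close>
    also have "\<dots> = (LINT r|?S. coef f n * indicator {r. 0 < r \<and> ennreal r < scale n} r)"
    proof (rule Bochner_Integration.integral_cong[OF refl])
      fix r
      show "(LINT x|M. pos_average f r x * wave n x) = coef f n * indicator {r. 0 < r \<and> ennreal r < scale n} r"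
        using inner_ball_average_wave[OF f, of r n]
        by (cases "0 < r") (simp_all add: pos_average_def coef_def indicator_def l2_inner_def[of M "ball_average M r f"])
    qed
    also have "\<dots> = coef f n * \<sigma> (scale n)"
      using measure_stieltjes[OF scale_pos, of n] by simp
    finally show ?thesis by simp
  qed
  show ?thesis
  proof (rule set_eqI, clarify, rule iffI)
    fix f g assume fg: "(f, g) \<in> isotropic_markov_op M \<sigma>"
    then have L: "f \<in> L2 M" "g \<in> L2 M" and "AE x in M. g x = P f x"
      by (auto simp: isotropic_markov_op_def LINT_eq)
    then have "coef g n = \<sigma> (scale n) * coef f n" for n
      using AE_eq_iff_coef[OF L(2) P_L2[OF L(1)]] coef_P[OF L(1)] by simp
    then show "(f, g) \<in> diag (\<lambda>n. \<sigma> (scale n))" using L by (simp add: diag_def)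
  next
    fix f g assume fg: "(f, g) \<in> diag (\<lambda>n. \<sigma> (scale n))"
    note d = diagD[OF fg]
    have "AE x in M. g x = P f x"
      using AE_eq_iff_coef[OF d(2) P_L2[OF d(1)]] coef_P[OF d(1)] d(3) by simp
    then show "(f, g) \<in> isotropic_markov_op M \<sigma>" using d by (simp add: isotropic_markov_op_def LINT_eq)
  qed
qed

corollary isotropic_laplacian_diag:
  assumes "distance_distribution \<sigma>"
  shows "isotropic_laplacian M \<sigma> = diag (\<lambda>n. ln (1 / \<sigma> (scale n)))"
  unfolding isotropic_laplacian_def isotropic_markov_op_diag[OF assms]
  by (rule functional_calculus_diag) measurable

end

section \<open>Subordination\<close>

text \<open>L = log 1/\<sigma> decreases strictly from infinity at 0+ to 0 at infinity, and exp(-h)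
  reverses the order back. The value at r = 0 is set by hand: it must be 0, which an exponential of
  a real number never is.\<close>

lemma subordinate_distance_distribution:
  fixes \<psi> :: "ennreal \<Rightarrow> ennreal"
  assumes dd: "distance_distribution \<sigma>"
    and strict: "strict_mono \<psi>"
    and right_cont: "\<And>s. continuous (at_right s) \<psi>"
    and zero: "\<psi> 0 = 0"
    and infinity: "(\<psi> \<longlongrightarrow> \<infinity>) (at_left \<infinity>)"
  defines "h \<equiv> \<lambda>t. enn2real (\<psi> (ennreal t))"
  defines "\<tau> \<equiv> \<lambda>r. if r = 0 then 0 else exp (- h (ln (1 / \<sigma> r)))"
  shows "distance_distribution \<tau>"
proof -
  interpret distance_distribution_function \<sigma> by standard (rule dd)
  define L where "L r = ln (1 / \<sigma> r)" for r
  have \<psi>_less: "\<psi> s < \<psi> t" if "s < t" for s t using strict that by (simp add: strict_mono_def)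
  have fin: "\<psi> (ennreal t) < top" for t
    using \<psi>_less[of "ennreal t" top] by (simp add: less_le_trans)
  have h: "ennreal (h t) = \<psi> (ennreal t)" for t unfolding h_def using fin by simp
  have h_nonneg: "0 \<le> h t" for t by (simp add: h_def)
  have h_less: "h s < h t" if "0 \<le> s" "s < t" for s t
  proof -
    have "ennreal (h s) < ennreal (h t)" unfolding h using that by (intro \<psi>_less) (simp add: ennreal_less_iff)
    then show ?thesis using h_nonneg by (simp add: ennreal_less_iff)
  qed
  have L_nonneg: "0 \<le> L r" if "0 < r" for r
    using sigma_pos[OF that] sigma_le_1[of r] by (simp add: L_def)
  have L_less: "L s < L r" if "0 < r" "r < s" for r s
    using sigma_pos[OF that(1)] sigma_strict[OF that(2)] by (simp add: L_def ln_div)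
  have \<tau>_pos: "0 < r \<Longrightarrow> \<tau> r = exp (- h (L r))" for r by (simp add: \<tau>_def L_def)
  show ?thesis
    unfolding distance_distribution_def
  proof (intro conjI allI)
    show "range \<tau> \<subseteq> {0..1}" using h_nonneg by (auto simp: \<tau>_def)
    show "strict_mono \<tau>"
    proof (rule strict_monoI)
      fix r s :: ennreal assume rs: "r < s"
      then have s: "0 < s" using le_less_trans[OF zero_le] by blast
      show "\<tau> r < \<tau> s"
      proof (cases "r = 0")
        case True
        then show ?thesis using s by (simp add: \<tau>_pos) (simp add: \<tau>_def)
      next
        case False
        then have r: "0 < r" by (simp add: zero_less_iff_neq_zero)
        show ?thesis using h_less[OF L_nonneg[OF s] L_less[OF r rs]] by (simp add: \<tau>_pos r s)
      qed
    qed
    show "\<tau> \<infinity> = 1" using zero sigma_infinity by (simp add: \<tau>_def h_def)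
    show "(\<tau> \<longlongrightarrow> 0) (at_right 0)"
    proof -
      have pos: "\<forall>\<^sub>F r in at_right (0::ennreal). 0 < r"
        unfolding eventually_at_right[OF ennreal_zero_less_top] by (auto intro: exI[of _ top])
      have "\<forall>\<^sub>F r in at_right 0. \<sigma> r \<in> {0<..} \<and> \<sigma> r \<noteq> 0"
        using pos by eventually_elim (simp add: sigma_pos less_imp_neq[symmetric])
      then have "filterlim \<sigma> (at_right 0) (at_right 0)"
        unfolding filterlim_at using sigma_at_0 by blast
      then have "filterlim (\<lambda>r. inverse (\<sigma> r)) at_top (at_right 0)"
        by (rule filterlim_compose[OF filterlim_inverse_at_top_right])
      then have "filterlim L at_top (at_right 0)"
        unfolding L_def[abs_def] by (auto intro: filterlim_compose[OF ln_at_top] simp: inverse_eq_divide)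
      then have "((\<lambda>r. ennreal (L r)) \<longlongrightarrow> top) (at_right 0)"
        by (simp add: ennreal_tendsto_top_eq_at_top)
      \<comment> \<open>Real values stay below the top element, so it is approached from the left,
        as the hypothesis on \<psi> at infinity requires.\<close>
      then have "filterlim (\<lambda>r. ennreal (L r)) (at_left top) (at_right 0)"
        unfolding filterlim_at by auto
      then have "((\<lambda>r. \<psi> (ennreal (L r))) \<longlongrightarrow> top) (at_right 0)"
        using filterlim_compose infinity by fastforce
      then have "filterlim (\<lambda>r. h (L r)) at_top (at_right 0)"
        by (simp add: ennreal_tendsto_top_eq_at_top flip: h)
      then have "((\<lambda>r. exp (- h (L r))) \<longlongrightarrow> 0) (at_right 0)"
        by (intro filterlim_compose[OF exp_at_bot] filterlim_compose[OF filterlim_uminus_at_bot_at_top])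
      then show ?thesis
        by (rule Lim_transform_eventually) (rule eventually_mono[OF pos], simp add: \<tau>_pos)
    qed
    fix r
    show "continuous (at_left r) \<tau>"
    proof (cases "r = 0")
      case True
      then show ?thesis using trivial_limit_at_left_bot[where 'a=ennreal]
        by (simp add: continuous_within bot_ennreal)
    next
      case False
      then have r: "0 < r" by (simp add: zero_less_iff_neq_zero)
      have pos: "\<forall>\<^sub>F s in at_left r. 0 < s \<and> s < r"
        unfolding eventually_at_left[OF r] using r by blast
      have "(L \<longlongrightarrow> L r) (at_left r)"
        unfolding L_def[abs_def] using sigma_pos[OF r] by (auto intro!: tendsto_intros sigma_left)
      then have "((\<lambda>s. ennreal (L s)) \<longlongrightarrow> ennreal (L r)) (at_left r)" by (rule tendsto_ennrealI)
      \<comment> \<open>As L is strictly decreasing, L s tends to L r strictly from the right, so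
        right-continuity of \<psi> applies.\<close>
      moreover have "\<forall>\<^sub>F s in at_left r. ennreal (L s) \<in> {ennreal (L r)<..} \<and> ennreal (L s) \<noteq> ennreal (L r)"
        using pos
      proof eventually_elim
        case (elim s)
        then have "ennreal (L r) < ennreal (L s)"
          using L_less[of s r] L_nonneg[OF r] by (simp add: ennreal_less_iff)
        then show ?case by auto
      qed
      ultimately have "filterlim (\<lambda>s. ennreal (L s)) (at_right (ennreal (L r))) (at_left r)"
        unfolding filterlim_at by blast
      moreover have "(\<psi> \<longlongrightarrow> ennreal (h (L r))) (at_right (ennreal (L r)))"
        using right_cont[of "ennreal (L r)"] by (simp add: continuous_within h)
      ultimately have "((\<lambda>s. \<psi> (ennreal (L s))) \<longlongrightarrow> ennreal (h (L r))) (at_left r)"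
        using filterlim_compose by blast
      then have "((\<lambda>s. enn2real (\<psi> (ennreal (L s)))) \<longlongrightarrow> h (L r)) (at_left r)"
        using h_nonneg by (rule tendsto_enn2real)
      then have "((\<lambda>s. h (L s)) \<longlongrightarrow> h (L r)) (at_left r)"
        by (simp add: h_def)
      then have "((\<lambda>s. exp (- h (L s))) \<longlongrightarrow> exp (- h (L r))) (at_left r)"
        by (intro tendsto_intros)
      then have "(\<tau> \<longlongrightarrow> exp (- h (L r))) (at_left r)"
        by (rule Lim_transform_eventually) (rule eventually_mono[OF pos], simp add: \<tau>_pos)
      then show ?thesis by (simp add: continuous_within \<tau>_pos r)
    qed
  qed
qed

theorem theorem3p1:
  fixes M :: "'a::metric_space measure"
    and \<sigma> :: "ennreal \<Rightarrow> real"
    and \<psi> :: "ennreal \<Rightarrow> ennreal"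
  assumes "ultrametric TYPE('a)"
    and "separable_space (euclidean :: 'a topology)"
    and "\<And>(x::'a) r. compact (cball x r)"
    and "radon_measure M"
    and "full_support M"
    and "distance_distribution \<sigma>"
    and "strict_mono \<psi>"
    and "\<And>s. continuous (at_right s) \<psi>"
    and "\<psi> 0 = 0"
    and "(\<psi> \<longlongrightarrow> \<infinity>) (at_left \<infinity>)"
  shows "\<exists>\<sigma>'. distance_distribution \<sigma>' \<and>
           nonneg_functional_calculus M \<psi> (isotropic_laplacian M \<sigma>) = isotropic_laplacian M \<sigma>'"
proof -
  obtain C :: "'a set" where C: "countable C" "closure C = UNIV"
    using assms(2) by (auto simp: separable_space_def)
  then have "C \<noteq> {}" by auto
  \<comment> \<open>\<open>from_nat_into\<close> repeats points when C is finite; repetitions are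
    absorbed as zero waves.\<close>
  interpret ultrametric_measure M "from_nat_into C"
  proof
    fix x :: 'a and r :: real assume "0 < r"
    then obtain y where "y \<in> C" "dist y x < r"
      using C(2) closure_approachable[of x C] by auto
    then show "\<exists>n. dist (from_nat_into C n) x < r"
      using from_nat_into_surj[OF C(1)] by metis
  qed (use assms in \<open>auto simp: ultrametric_def radon_measure_def full_support_def\<close>)
  define h where "h t = enn2real (\<psi> (ennreal t))" for t
  define \<tau> where "\<tau> r = (if r = 0 then 0 else exp (- h (ln (1 / \<sigma> r))))" for r
  have \<tau>: "distance_distribution \<tau>"
    unfolding \<tau>_def[abs_def] h_def by (rule subordinate_distance_distribution[OF assms(6-10)])
  have h: "h \<in> borel_measurable borel"
  proof (rule borel_measurable_mono, rule monoI)
    fix s t :: real assume "s \<le> t"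
    then have "\<psi> (ennreal s) \<le> \<psi> (ennreal t)"
      by (simp add: strict_mono_less_eq[OF assms(7)] ennreal_leI)
    moreover have "\<psi> (ennreal t) < top"
      using strict_monoD[OF assms(7) ennreal_less_top] top_greatest by (rule less_le_trans)
    ultimately show "h s \<le> h t" unfolding h_def by (rule enn2real_mono)
  qed
  have "nonneg_functional_calculus M \<psi> (isotropic_laplacian M \<sigma>) = functional_calculus M h (isotropic_laplacian M \<sigma>)"
    by (simp add: nonneg_functional_calculus_def h_def[abs_def])
  also have "\<dots> = diag (\<lambda>n. h (ln (1 / \<sigma> (scale n))))"
    unfolding isotropic_laplacian_diag[OF assms(6)] by (rule functional_calculus_diag[OF h])
  also have "\<dots> = diag (\<lambda>n. ln (1 / \<tau> (scale n)))"
  proof (rule arg_cong[where f=diag], rule ext)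
    fix n
    \<comment> \<open>\<open>scale_pos\<close> excludes the argument 0, so the exponential formula
      for \<tau> applies and the logarithm undoes it.\<close>
    show "h (ln (1 / \<sigma> (scale n))) = ln (1 / \<tau> (scale n))"
      using scale_pos[of n] by (simp add: \<tau>_def ln_div)
  qed
  also have "\<dots> = isotropic_laplacian M \<tau>" by (rule isotropic_laplacian_diag[OF \<tau>, symmetric])
  finally show ?thesis using \<tau> by blast
qed

end
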